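(* Suppose that: (i) there are $s>0$ and $h\in L^2(S)$ with $\beta^*=T^{\frac12}(T^{\frac12}CT^{\frac12})^sh$; (ii) for some $b>1$, $i^{-b}\lesssim\tau_i\lesssim i^{-b}$ for all $i\in\mathbb N$, where $(\tau_i,e_i)_{i\in\mathbb N}$ are the eigenvalue–eigenfunction pairs of $T^{\frac12}CT^{\frac12}$; (iii) there is a constant $d_1>0$ such that $\mathbb E[\langle X,f\rangle_{L^2}^4]\le d_1\,[\mathbb E\langle X,f\rangle_{L^2}^2]^2$ for all $f\in L^2(S)$. Let $\nu\ge\frac12$ be the qualification of the regularization family $(g_\lambda)$ and let $\hat\beta=g_\lambda(J^*\hat C_nJ)J^*\hat R$. Then, for $\lambda=n^{-\frac{b}{1+b+2rb}}$, we have $$\|\beta^*-\hat\beta\|_{\mathcal H}\lesssim_p n^{-\frac{br}{1+b+2rb}},\qquad\text{where } r=\min\{s,\nu\}.$$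
   Context: Setting. $S\subset\mathbb R^d$ is compact, $L^2(S)$ is the real $L^2$ space with inner product $\langle f,g\rangle_{L^2}=\int_S fg$. $X$ is a random element of $L^2(S)$ with $\mathbb E\|X\|_{L^2}^2<\infty$; $\beta^*\in L^2(S)$; $Y=\langle X,\beta^*\rangle_{L^2}+\epsilon$, where $\epsilon$ is real, zero mean, independent of $X$, with finite variance $\sigma^2$. $(X_1,Y_1),\dots,(X_n,Y_n)$ are i.i.d. copies of $(X,Y)$. With $(f\otimes f)g=\langle f,g\rangle_{L^2}f$, set $C=\mathbb E[X\otimes X]$, $\hat C_n=\frac1n\sum_{i=1}^nX_i\otimes X_i$, $\hat R=\frac1n\sum_{i=1}^nY_iX_i$. RKHS. $k:S\times S\to\mathbb R$ is a measurable symmetric positive definite kernel with $\sup_{x\in S}k(x,x)\le\kappa<\infty$, with RKHS $\mathcal H$. $J:\mathcal H\to L^2(S)$ is the inclusion operator, $J^*g=\int_Sk(\cdot,x)g(x)\,dx$ its adjoint, and $T=JJ^*:L^2(S)\to L^2(S)$. $\mathcal H$ is regarded as a subset of $L^2(S)$; $T^{1/2}$ is a partial isometry from $L^2(S)$ onto $\mathcal H$, i.e. $\mathcal R(T^{1/2})=\mathcal H$. It is not assumed that $T$ and $C$ commute. Regularization family. $g_\lambda:[0,\eta]\to\mathbb R$, $0<\lambda\le\eta$ ($[0,\eta]$ read as $[0,\infty)$ if $\eta=\infty$), with constants $A,B,D>0$ independent of $\lambda$ such that $\sup_{0<\sigma\le\eta}|\sigma g_\lambda(\sigma)|\le A$,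 $\sup_{0<\sigma\le\eta}|g_\lambda(\sigma)|\le B/\lambda$, $\sup_{0<\sigma\le\eta}|r_\lambda(\sigma)|\le D$, where $r_\lambda(\sigma)=1-\sigma g_\lambda(\sigma)$. The qualification is the maximal $p$ such that $\sup_{0<\sigma\le\eta}|r_\lambda(\sigma)|\sigma^p\le\omega_p\lambda^p$ with $\omega_p$ independent of $\lambda$ (it is $\infty$ if this holds for every $p>0$). Functions of self-adjoint operators are defined by functional calculus, and $\eta$ is such that the spectrum of $J^*\hat C_nJ$ lies in $[0,\eta]$ almost surely for every $n$. Notation. $a\lesssim b$ means $a\le \text{const}\cdot b$ for a positive constant (independent of the index). $W\lesssim_p b$ (for quantities depending on $n$) means: for every $\delta\in(0,1)$ there is a finite constant $c_\delta>0$, independent of $n$, with $P(W\le c_\delta b)\ge\delta$ (for all $n$ for which $\lambda\le\eta$). *)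

theory Defs
  imports "HOL-Probability.Probability"
begin

definition sq_integrable :: "'a::euclidean_space set \<Rightarrow> ('a \<Rightarrow> real) set" where
  "sq_integrable S = {f \<in> borel_measurable (lebesgue_on S). integrable (lebesgue_on S) (\<lambda>x. (f x)\<^sup>2)}"

text \<open>
  Since \<^term>\<open>S\<close> is a variable, the space of square-integrable functions on \<^term>\<open>S\<close> modulo
  equality almost everywhere cannot be a type constructor application. Instead, the type
  \<^typ>\<open>'h\<close> is this space, and \<^term>\<open>cls\<close> is the quotient map sending a function to its class.
  Surjectivity and compatibility with the inner product determine everything else:
  \<^term>\<open>cls\<close> is linear and identifies exactly the functions that are equal almost everywhere
  (see \<open>is_L2_cls_add\<close>, \<open>is_L2_cls_scale\<close> and \<open>is_L2_cls_eq_iff\<close> below). The values of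
  \<^term>\<open>cls\<close> on functions that are not square integrable are irrelevant.
  Completeness and separability of this space are carried by the sort of \<^typ>\<open>'h\<close>.
\<close>

definition is_L2 :: "'a::euclidean_space set \<Rightarrow>
    (('a \<Rightarrow> real) \<Rightarrow> 'h::{real_inner, banach, second_countable_topology}) \<Rightarrow> bool" where
  "is_L2 S cls \<longleftrightarrow>
     cls ` sq_integrable S = UNIV \<and>
     (\<forall>f\<in>sq_integrable S. \<forall>g\<in>sq_integrable S.
        inner (cls f) (cls g) = (\<integral>x. f x * g x \<partial>lebesgue_on S))"

definition bounded_pd_kernel :: "'a::euclidean_space set \<Rightarrow> ('a \<Rightarrow> 'a \<Rightarrow> real) \<Rightarrow> real \<Rightarrow> bool" where
  "bounded_pd_kernel S k \<kappa> \<longleftrightarrow>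
     (\<lambda>(x, y). k x y) \<in> borel_measurable (lebesgue_on S \<Otimes>\<^sub>M lebesgue_on S) \<and>
     (\<forall>x\<in>S. \<forall>y\<in>S. k x y = k y x) \<and>
     (\<forall>F c. finite F \<and> F \<subseteq> S \<longrightarrow> (\<Sum>x\<in>F. \<Sum>y\<in>F. c x * c y * k x y) \<ge> 0) \<and>
     (\<forall>x\<in>S. k x x \<le> \<kappa>)"

text \<open>
  A Hilbert space (the type \<^typ>\<open>'k\<close>) of functions on \<^term>\<open>S\<close>, where \<^term>\<open>eval_at f\<close> is the
  function that the element \<^term>\<open>f\<close> is, and \<^term>\<open>k\<close> is its reproducing kernel.
\<close>

definition is_rkhs :: "'a set \<Rightarrow> ('a \<Rightarrow> 'a \<Rightarrow> real) \<Rightarrow>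
    ('k::{real_inner, banach} \<Rightarrow> 'a \<Rightarrow> real) \<Rightarrow> bool" where
  "is_rkhs S k eval_at \<longleftrightarrow>
     (\<forall>x\<in>S. linear (\<lambda>f. eval_at f x)) \<and>
     (\<forall>f g. (\<forall>x\<in>S. eval_at f x = eval_at g x) \<longrightarrow> f = g) \<and>
     (\<forall>x\<in>S. \<exists>kx. (\<forall>y\<in>S. eval_at kx y = k y x) \<and> (\<forall>f. inner f kx = eval_at f x))"

definition incl :: "(('a \<Rightarrow> real) \<Rightarrow> 'h) \<Rightarrow> ('k \<Rightarrow> 'a \<Rightarrow> real) \<Rightarrow> 'k \<Rightarrow> 'h" where
  "incl cls eval_at f = cls (eval_at f)"

definition eigenspace :: "('v::real_inner \<Rightarrow> 'v) \<Rightarrow> real \<Rightarrow> 'v set" where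
  "eigenspace A \<mu> = {x. A x = \<mu> *\<^sub>R x}"

definition eigenvalues :: "('v::real_inner \<Rightarrow> 'v) \<Rightarrow> real set" where
  "eigenvalues A = {\<mu>. \<exists>x. x \<noteq> 0 \<and> A x = \<mu> *\<^sub>R x}"

definition orth_proj :: "'v::real_inner set \<Rightarrow> 'v \<Rightarrow> 'v" where
  "orth_proj V x = (THE y. y \<in> V \<and> (\<forall>z\<in>V. inner (x - y) z = 0))"

text \<open>
  Functional calculus of a compact self-adjoint operator (all the operators below are of this
  kind): \<open>f(A) = \<Sum>\<^sub>\<mu> f(\<mu>) P\<^sub>\<mu>\<close>, where \<open>P\<^sub>\<mu>\<close> projects onto the
  eigenspace of \<open>\<mu>\<close>. The eigenvalue 0 is included, so \<open>f(A)\<close> acts as \<open>f(0)\<close> on the kernel.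
\<close>

definition op_fun :: "(real \<Rightarrow> real) \<Rightarrow> ('v::{real_inner, banach} \<Rightarrow> 'v) \<Rightarrow> 'v \<Rightarrow> 'v" where
  "op_fun f A x = (\<Sum>\<^sub>\<infinity>\<mu>\<in>eigenvalues A. f \<mu> *\<^sub>R orth_proj (eigenspace A \<mu>) x)"

text \<open>The real spectrum, which is the whole spectrum if \<^term>\<open>A\<close> is self-adjoint.\<close>

definition real_spectrum :: "('v::{real_inner, banach} \<Rightarrow> 'v) \<Rightarrow> real set" where
  "real_spectrum A = {\<mu>. \<not> (\<exists>B. bounded_linear B \<and>
      (\<forall>x. B (A x - \<mu> *\<^sub>R x) = x) \<and> (\<forall>x. A (B x) - \<mu> *\<^sub>R B x = x))}"

text \<open>
  The eigenpairs of \<^term>\<open>A\<close> for its nonzero eigenvalues, repeated according to multiplicity and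
  indexed from 1: by the last condition, no part of the range of \<^term>\<open>A\<close> is missing.
  The kernel of \<^term>\<open>A\<close> may be nontrivial. The order of the eigenvalues is not prescribed.
\<close>

definition eigenpairs :: "('v::real_inner \<Rightarrow> 'v) \<Rightarrow> (nat \<Rightarrow> real) \<Rightarrow> (nat \<Rightarrow> 'v) \<Rightarrow> bool" where
  "eigenpairs A \<tau> e \<longleftrightarrow>
     (\<forall>i\<ge>1. \<forall>j\<ge>1. inner (e i) (e j) = (if i = j then 1 else 0)) \<and>
     (\<forall>i\<ge>1. \<tau> i \<noteq> 0 \<and> A (e i) = \<tau> i *\<^sub>R e i) \<and>
     (\<forall>x. (\<forall>i\<ge>1. inner x (e i) = 0) \<longrightarrow> A x = 0)"

definition T_op :: "('k::{real_inner, banach} \<Rightarrow> 'h::{real_inner, banach}) \<Rightarrow> 'h \<Rightarrow> 'h" where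
  "T_op J = J \<circ> adjoint J"

definition T_half :: "('k::{real_inner, banach} \<Rightarrow> 'h::{real_inner, banach}) \<Rightarrow> 'h \<Rightarrow> 'h" where
  "T_half J = op_fun sqrt (T_op J)"

definition tens :: "'h::real_inner \<Rightarrow> 'h \<Rightarrow> 'h" where
  "tens f g = inner f g *\<^sub>R f"

definition cov_op :: "'w measure \<Rightarrow> ('w \<Rightarrow> 'h::{real_inner, banach, second_countable_topology})
    \<Rightarrow> 'h \<Rightarrow> 'h" where
  "cov_op M X f = (\<integral>\<omega>. tens (X \<omega>) f \<partial>M)"

definition emp_cov :: "(nat \<Rightarrow> 'w \<Rightarrow> 'h::real_inner) \<Rightarrow> nat \<Rightarrow> 'w \<Rightarrow> 'h \<Rightarrow> 'h" where
  "emp_cov Xs n \<omega> f = (1 / real n) *\<^sub>R (\<Sum>i=1..n. tens (Xs i \<omega>) f)"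

definition emp_R :: "(nat \<Rightarrow> 'w \<Rightarrow> 'h::real_inner) \<Rightarrow> (nat \<Rightarrow> 'w \<Rightarrow> real) \<Rightarrow> nat \<Rightarrow> 'w \<Rightarrow> 'h" where
  "emp_R Xs Ys n \<omega> = (1 / real n) *\<^sub>R (\<Sum>i=1..n. Ys i \<omega> *\<^sub>R Xs i \<omega>)"

definition TCT :: "'w measure \<Rightarrow> ('w \<Rightarrow> 'h::{real_inner, banach, second_countable_topology}) \<Rightarrow>
    ('k::{real_inner, banach} \<Rightarrow> 'h) \<Rightarrow> 'h \<Rightarrow> 'h" where
  "TCT M X J = T_half J \<circ> cov_op M X \<circ> T_half J"

definition JCJ_emp :: "('k::{real_inner, banach} \<Rightarrow> 'h::{real_inner, banach}) \<Rightarrow>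
    (nat \<Rightarrow> 'w \<Rightarrow> 'h) \<Rightarrow> nat \<Rightarrow> 'w \<Rightarrow> 'k \<Rightarrow> 'k" where
  "JCJ_emp J Xs n \<omega> = adjoint J \<circ> emp_cov Xs n \<omega> \<circ> J"

definition beta_hat :: "(real \<Rightarrow> real \<Rightarrow> real) \<Rightarrow> real \<Rightarrow>
    ('k::{real_inner, banach} \<Rightarrow> 'h::{real_inner, banach}) \<Rightarrow>
    (nat \<Rightarrow> 'w \<Rightarrow> 'h) \<Rightarrow> (nat \<Rightarrow> 'w \<Rightarrow> real) \<Rightarrow> nat \<Rightarrow> 'w \<Rightarrow> 'k" where
  "beta_hat g l J Xs Ys n \<omega> = op_fun (g l) (JCJ_emp J Xs n \<omega>) (adjoint J (emp_R Xs Ys n \<omega>))"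

text \<open>
  The values of \<^term>\<open>g l\<close> outside the interval from 0 to \<^term>\<open>\<eta>\<close> are unconstrained.
\<close>

definition reg_family :: "ereal \<Rightarrow> (real \<Rightarrow> real \<Rightarrow> real) \<Rightarrow> real \<Rightarrow> real \<Rightarrow> real \<Rightarrow> bool" where
  "reg_family \<eta> g A B D \<longleftrightarrow> A > 0 \<and> B > 0 \<and> D > 0 \<and>
     (\<forall>l x. 0 < l \<and> ereal l \<le> \<eta> \<and> 0 < x \<and> ereal x \<le> \<eta> \<longrightarrow>
        \<bar>x * g l x\<bar> \<le> A \<and> \<bar>g l x\<bar> \<le> B / l \<and> \<bar>1 - x * g l x\<bar> \<le> D)"

definition qualifies :: "ereal \<Rightarrow> (real \<Rightarrow> real \<Rightarrow> real) \<Rightarrow> real \<Rightarrow> bool" where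
  "qualifies \<eta> g p \<longleftrightarrow> (\<exists>w. \<forall>l x. 0 < l \<and> ereal l \<le> \<eta> \<and> 0 < x \<and> ereal x \<le> \<eta> \<longrightarrow>
        \<bar>1 - x * g l x\<bar> * x powr p \<le> w * l powr p)"

definition is_qualification :: "ereal \<Rightarrow> (real \<Rightarrow> real \<Rightarrow> real) \<Rightarrow> ereal \<Rightarrow> bool" where
  "is_qualification \<eta> g \<nu> \<longleftrightarrow>
     (\<nu> = \<infinity> \<and> (\<forall>p>0. qualifies \<eta> g p)) \<or>
     (\<exists>p>0. \<nu> = ereal p \<and> qualifies \<eta> g p \<and> (\<forall>q>p. \<not> qualifies \<eta> g q))"

text \<open>
  The library's \<open>indep_var\<close> requires both random variables to have values in the same type, hence
  the detour over the generated families of events.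
\<close>

definition indep_rv :: "'w measure \<Rightarrow> ('w \<Rightarrow> 'b::topological_space) \<Rightarrow>
    ('w \<Rightarrow> 'c::topological_space) \<Rightarrow> bool" where
  "indep_rv M U V \<longleftrightarrow> U \<in> borel_measurable M \<and> V \<in> borel_measurable M \<and>
     prob_space.indep_set M {U -` A \<inter> space M |A. A \<in> sets borel} {V -` A \<inter> space M |A. A \<in> sets borel}"

text \<open>
  \<open>W \<lesssim>\<^sub>p a\<close>, for indices in \<^term>\<open>I\<close>. The functions \<open>g\<^sub>\<lambda>\<close> of a regularization family are
  not assumed to be measurable, so neither is \<^term>\<open>W\<close>. Hence a lower bound on the
  probability of \<open>W \<le> c a\<close> means that this set contains an event of at least that
  probability. If \<^term>\<open>W\<close> is measurable, this is the same as the probability bound for the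
  set itself (see \<open>lesssim_p_iff\<close> below).
\<close>

definition lesssim_p :: "'w measure \<Rightarrow> nat set \<Rightarrow> (nat \<Rightarrow> 'w \<Rightarrow> real) \<Rightarrow> (nat \<Rightarrow> real) \<Rightarrow> bool" where
  "lesssim_p M I W a \<longleftrightarrow>
     (\<forall>\<delta>. 0 < \<delta> \<and> \<delta> < 1 \<longrightarrow> (\<exists>c>0. \<forall>n\<in>I. \<exists>E\<in>sets M.
        E \<subseteq> {\<omega>\<in>space M. W n \<omega> \<le> c * a n} \<and> measure M E \<ge> \<delta>))"

lemma lesssim_p_iff:
  assumes "prob_space M" "\<And>n. n \<in> I \<Longrightarrow> W n \<in> borel_measurable M"
  shows "lesssim_p M I W a \<longleftrightarrow>
     (\<forall>\<delta>. 0 < \<delta> \<and> \<delta> < 1 \<longrightarrow> (\<exists>c>0. \<forall>n\<in>I. measure M {\<omega>\<in>space M. W n \<omega> \<le> c * a n} \<ge> \<delta>))"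
proof -
  interpret prob_space M by fact
  have meas: "{\<omega>\<in>space M. W n \<omega> \<le> c} \<in> sets M" if "n \<in> I" for n c
    using assms(2)[OF that] by measurable
  have "(\<exists>E\<in>sets M. E \<subseteq> {\<omega>\<in>space M. W n \<omega> \<le> c} \<and> measure M E \<ge> \<delta>) \<longleftrightarrow>
        measure M {\<omega>\<in>space M. W n \<omega> \<le> c} \<ge> \<delta>" if "n \<in> I" for n c \<delta>
    using meas[OF that] by (meson finite_measure_mono order_refl order_trans)
  then show ?thesis
    unfolding lesssim_p_def by (simp cong: ball_cong)
qed

lemma integrable_mult_sq_integrable:
  assumes "f \<in> sq_integrable S" "g \<in> sq_integrable S"
  shows "integrable (lebesgue_on S) (\<lambda>x. f x * g x)"
proof (rule Bochner_Integration.integrable_bound)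
  show "integrable (lebesgue_on S) (\<lambda>x. (f x)\<^sup>2 + (g x)\<^sup>2)"
    using assms by (auto simp: sq_integrable_def)
  show "(\<lambda>x. f x * g x) \<in> borel_measurable (lebesgue_on S)"
    using assms by (auto simp: sq_integrable_def)
  have "\<bar>u * v\<bar> \<le> u\<^sup>2 + v\<^sup>2" for u v :: real
  proof -
    have "2 * (\<bar>u\<bar> * \<bar>v\<bar>) \<le> u\<^sup>2 + v\<^sup>2"
      using sum_squares_bound[of "\<bar>u\<bar>" "\<bar>v\<bar>"] by (simp add: mult.assoc)
    moreover have "0 \<le> \<bar>u\<bar> * \<bar>v\<bar>" by simp
    ultimately show ?thesis unfolding abs_mult by linarith
  qed
  then show "AE x in lebesgue_on S. norm (f x * g x) \<le> norm ((f x)\<^sup>2 + (g x)\<^sup>2)"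
    by (simp add: abs_of_nonneg)
qed

lemma sq_integrable_add:
  assumes "f \<in> sq_integrable S" "g \<in> sq_integrable S"
  shows "(\<lambda>x. f x + g x) \<in> sq_integrable S"
  using assms integrable_mult_sq_integrable[OF assms]
  by (auto simp: sq_integrable_def power2_sum mult.assoc)

lemma sq_integrable_scale:
  assumes "f \<in> sq_integrable S"
  shows "(\<lambda>x. c * f x) \<in> sq_integrable S"
  using assms by (auto simp: sq_integrable_def power_mult_distrib)

lemma is_L2_eqI:
  assumes "is_L2 S cls" "\<And>g. g \<in> sq_integrable S \<Longrightarrow> inner u (cls g) = inner v (cls g)"
  shows "u = v"
proof -
  obtain g where "g \<in> sq_integrable S" "u - v = cls g"
    using assms(1) unfolding is_L2_def by (metis UNIV_I imageE)
  then have "inner (u - v) (u - v) = 0"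
    using assms(2)[of g] inner_diff_left[of u v "cls g"] by simp
  then show ?thesis by simp
qed

lemma is_L2_cls_add:
  assumes L: "is_L2 S cls" and f: "f \<in> sq_integrable S" and g: "g \<in> sq_integrable S"
  shows "cls (\<lambda>x. f x + g x) = cls f + cls g"
proof (rule is_L2_eqI[OF L])
  fix h assume h: "h \<in> sq_integrable S"
  show "inner (cls (\<lambda>x. f x + g x)) (cls h) = inner (cls f + cls g) (cls h)"
    using L f g h sq_integrable_add[OF f g]
      integrable_mult_sq_integrable[OF f h] integrable_mult_sq_integrable[OF g h]
    unfolding is_L2_def by (simp add: inner_add_left distrib_right)
qed

lemma is_L2_cls_scale:
  assumes L: "is_L2 S cls" and f: "f \<in> sq_integrable S"
  shows "cls (\<lambda>x. c * f x) = c *\<^sub>R cls f"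
proof (rule is_L2_eqI[OF L])
  fix h assume h: "h \<in> sq_integrable S"
  show "inner (cls (\<lambda>x. c * f x)) (cls h) = inner (c *\<^sub>R cls f) (cls h)"
    using L f h sq_integrable_scale[OF f] unfolding is_L2_def by (simp add: mult.assoc)
qed

lemma is_L2_cls_eq_iff:
  assumes L: "is_L2 S cls" and f: "f \<in> sq_integrable S" and g: "g \<in> sq_integrable S"
  shows "cls f = cls g \<longleftrightarrow> (AE x in lebesgue_on S. f x = g x)"
proof -
  define d where "d = (\<lambda>x. f x + (-1) * g x)"
  have d: "d \<in> sq_integrable S"
    unfolding d_def by (intro sq_integrable_add sq_integrable_scale f g)
  have "cls d = cls f - cls g"
    unfolding d_def
    using is_L2_cls_add[OF L f sq_integrable_scale[OF g], of "-1"] is_L2_cls_scale[OF L g, of "-1"]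
    by simp
  then have "cls f = cls g \<longleftrightarrow> inner (cls d) (cls d) = 0"
    by simp
  also have "\<dots> \<longleftrightarrow> (\<integral>x. (d x)\<^sup>2 \<partial>lebesgue_on S) = 0"
    using L d unfolding is_L2_def by (simp add: power2_eq_square)
  also have "\<dots> \<longleftrightarrow> (AE x in lebesgue_on S. (d x)\<^sup>2 = 0)"
    using d by (intro integral_nonneg_eq_0_iff_AE) (auto simp: sq_integrable_def)
  also have "\<dots> \<longleftrightarrow> (AE x in lebesgue_on S. f x = g x)"
    by (simp add: d_def)
  finally show ?thesis .
qed

end

theory Submission
  imports Defs
begin

text \<open>
  The error is analysed in the RKHS. With \<open>A = J\<^sup>* C J\<close>, \<open>B = J\<^sup>* C\<^sub>n J\<close> and the noise vector
  \<open>w = n\<^sup>-\<^sup>1 \<Sum> \<epsilon>\<^sub>k J\<^sup>* X\<^sub>k\<close> one has \<open>J\<^sup>* R = B f + w\<close>, where \<open>J f = \<beta>\<close>, so the error is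
  \<open>r\<^sub>\<lambda>(B) f - g\<^sub>\<lambda>(B) w\<close>. If \<open>(\<tau>\<^sub>i, e\<^sub>i)\<close> are the eigenpairs of \<open>T\<^sup>1\<^sup>/\<^sup>2 C T\<^sup>1\<^sup>/\<^sup>2\<close>, then the vectors
  \<open>\<phi>\<^sub>i = \<tau>\<^sub>i\<^sup>-\<^sup>1 J\<^sup>* C T\<^sup>1\<^sup>/\<^sup>2 e\<^sub>i\<close> are orthonormal eigenvectors of \<open>A\<close> with the same eigenvalues and
  \<open>J \<phi>\<^sub>i = T\<^sup>1\<^sup>/\<^sup>2 e\<^sub>i\<close>; hence the source condition becomes \<open>f = A\<^sup>s h'\<close>.

  Second moments and Markov's inequality control three quantities: the Hilbert-Schmidt norm of
  \<open>A - B\<close>, that of \<open>(A + \<mu>)\<^sup>-\<^sup>1\<^sup>/\<^sup>2 (A - B) (A + \<mu>)\<^sup>-\<^sup>1\<^sup>/\<^sup>2\<close>, and the norm of \<open>(A + \<lambda>)\<^sup>-\<^sup>1\<^sup>/\<^sup>2 w\<close>. Taking \<open>\<mu> = K \<lambda>\<close>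
  with \<open>K\<close> large, depending only on the confidence level, makes the second one at most 1/2 for all \<open>n\<close>
  at once, so that \<open>A + \<mu> \<le> 2 (B + \<mu>)\<close>. This yields the variance term, and the bias term
  for \<open>r \<le> 1/2\<close>. For \<open>r > 1/2\<close> the bias is treated with \<open>F(t) = (t + \<lambda>)\<^sup>r\<close>: a Lipschitz function \<open>F\<close>
  is operator Lipschitz with the same constant in the Hilbert-Schmidt norm, because
  \<open>\<parallel>(F(t) - F(B)) x\<parallel> \<le> Lip(F) \<parallel>(t - B) x\<parallel>\<close> for every number \<open>t\<close>.
\<close>

section \<open>Orthonormal families and functional calculus\<close>

text \<open>Only moments of \<open>X\<close> are controlled, but the constant may depend on the
  confidence level in any way, so Markov's inequality suffices. Hilbert-Schmidt norms suit it: their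
  second moments are sums over matrix entries in the basis \<open>\<phi>\<close>, and (iii) bounds
  the variance of entry (i, j) by \<open>d1 * \<tau> i * \<tau> j / n\<close>, so weighted sums
  factorise into traces or effective dimensions. The choice of \<lambda> means 1/n = \<lambda>^(2r +
  1 + 1/b). The case split at r = 1/2 has two reasons. For r \<le> 1/2, A^(2r) is dominated by a
  multiple of A + \<lambda>, so comparing quadratic forms is enough. For r > 1/2 the order of forms
  says nothing about A^(2r), but a Lipschitz constant of order \<lambda>^(r - 1) + 1 times a
  deviation of order \<lambda>^(r + 1/2) is then of order \<lambda>^r. Products such as (A +
  \<mu>)^(1/2) (B + \<mu>)^(-1/2) never appear as operators: the squared norm of z = g(B) w is the
  pairing of w with g(B) z, and each factor of that pairing is estimated by a quadratic
  form.\<close>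

definition orthonormal_on :: "'i set \<Rightarrow> ('i \<Rightarrow> 'v::real_inner) \<Rightarrow> bool" where
  "orthonormal_on I e \<longleftrightarrow> (\<forall>i\<in>I. \<forall>j\<in>I. inner (e i) (e j) = (if i = j then 1 else 0))"

text \<open>The index set is arbitrary and the sum unordered, because the eigenvectors of the
  empirical operator come from Zorn's lemma as a set without enumeration. The orthogonal complement
  of the family is sent to 0.\<close>

definition diag_op :: "'i set \<Rightarrow> ('i \<Rightarrow> 'v::real_inner) \<Rightarrow> ('i \<Rightarrow> real) \<Rightarrow> 'v \<Rightarrow> 'v" where
  "diag_op I e c x = (\<Sum>\<^sub>\<infinity>i\<in>I. (c i * inner x (e i)) *\<^sub>R e i)"

lemma orthonormal_onD:
  "orthonormal_on I e \<Longrightarrow> i \<in> I \<Longrightarrow> j \<in> I \<Longrightarrow> inner (e i) (e j) = (if i = j then 1 else 0)"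
  by (simp add: orthonormal_on_def)

lemma orthonormal_on_subset: "orthonormal_on I e \<Longrightarrow> F \<subseteq> I \<Longrightarrow> orthonormal_on F e"
  unfolding orthonormal_on_def by (meson subsetD)

lemma inner_orthonormal_sum:
  assumes "orthonormal_on I e" "finite F" "F \<subseteq> I" "j \<in> I"
  shows "inner (\<Sum>i\<in>F. c i *\<^sub>R e i) (e j) = (if j \<in> F then c j else 0)"
proof -
  have "inner (\<Sum>i\<in>F. c i *\<^sub>R e i) (e j) = (\<Sum>i\<in>F. if i = j then c i else 0)"
    unfolding inner_sum_left using assms
    by (intro sum.cong) (auto simp: orthonormal_onD)
  also have "\<dots> = (if j \<in> F then c j else 0)"
    using assms by simp
  finally show ?thesis .
qed

lemma norm_orthonormal_sum:
  assumes "orthonormal_on I e" "finite F" "F \<subseteq> I"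
  shows "(norm (\<Sum>i\<in>F. c i *\<^sub>R e i))\<^sup>2 = (\<Sum>i\<in>F. (c i)\<^sup>2)"
proof -
  have "(norm (\<Sum>i\<in>F. c i *\<^sub>R e i))\<^sup>2 = (\<Sum>j\<in>F. c j * inner (\<Sum>i\<in>F. c i *\<^sub>R e i) (e j))"
    unfolding power2_norm_eq_inner by (subst inner_sum_right) simp
  also have "\<dots> = (\<Sum>i\<in>F. (c i)\<^sup>2)"
    using assms by (intro sum.cong) (simp_all add: inner_orthonormal_sum[OF assms(1-3)] subsetD[OF assms(3)] power2_eq_square)
  finally show ?thesis .
qed

lemma bessel_finite:
  assumes "orthonormal_on I e" "finite F" "F \<subseteq> I"
  shows "(\<Sum>i\<in>F. (inner x (e i))\<^sup>2) \<le> (norm x)\<^sup>2"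
proof -
  let ?s = "\<Sum>i\<in>F. inner x (e i) *\<^sub>R e i"
  have "inner x ?s = (\<Sum>i\<in>F. (inner x (e i))\<^sup>2)"
    by (simp add: inner_sum_right power2_eq_square)
  moreover have "0 \<le> (norm (x - ?s))\<^sup>2" by simp
  ultimately show ?thesis
    using norm_orthonormal_sum[OF assms, of "\<lambda>i. inner x (e i)"]
    unfolding power2_norm_eq_inner
    by (simp add: inner_diff_left inner_diff_right inner_commute)
qed

lemma bessel_summable:
  assumes "orthonormal_on I e"
  shows "(\<lambda>i. (inner x (e i))\<^sup>2) summable_on I"
  using bessel_finite[OF assms]
  by (intro nonneg_bdd_above_summable_on bdd_aboveI2[where M = "(norm x)\<^sup>2"]) auto

text \<open>By Pythagoras the squared distance of nested partial sums is a partial sum of the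
  \<open>(c i)\<^sup>2\<close>. The net of partial sums is therefore Cauchy, and completeness
  provides the limit.\<close>

lemma orthonormal_series_summable:
  fixes e :: "'i \<Rightarrow> 'v::{real_inner, banach}"
  assumes e: "orthonormal_on I e" and c: "(\<lambda>i. (c i)\<^sup>2) summable_on I"
  shows "(\<lambda>i. c i *\<^sub>R e i) summable_on I"
proof -
  let ?f = "\<lambda>i. c i *\<^sub>R e i" and ?S = "\<Sum>\<^sub>\<infinity>i\<in>I. (c i)\<^sup>2"
  have "\<exists>P. eventually P (finite_subsets_at_top I) \<and>
          (\<forall>F G. P F \<and> P G \<longrightarrow> dist (sum ?f F) (sum ?f G) < d)" if "d > 0" for d
  proof -
    have "0 < (d/3)\<^sup>2" using \<open>d > 0\<close> by simp
    from infsum_finite_approximation[OF c this]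
    obtain F0 where F0: "finite F0" "F0 \<subseteq> I" "dist (\<Sum>i\<in>F0. (c i)\<^sup>2) ?S \<le> (d / 3)\<^sup>2" by blast
    have close: "norm (sum ?f F - sum ?f F0) \<le> d / 3" if F: "finite F" "F0 \<subseteq> F" "F \<subseteq> I" for F
    proof -
      have "sum ?f F - sum ?f F0 = sum ?f (F - F0)"
        using F by (simp add: sum_diff)
      then have "(norm (sum ?f F - sum ?f F0))\<^sup>2 = (\<Sum>i\<in>F - F0. (c i)\<^sup>2)"
        using norm_orthonormal_sum[OF e, of "F - F0" c] F by auto
      also have "\<dots> = (\<Sum>i\<in>F. (c i)\<^sup>2) - (\<Sum>i\<in>F0. (c i)\<^sup>2)"
        using F by (simp add: sum_diff)
      also have "\<dots> \<le> ?S - (\<Sum>i\<in>F0. (c i)\<^sup>2)"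
        using finite_sum_le_infsum[OF c F(1,3)] by simp
      also have "\<dots> \<le> (d/3)\<^sup>2"
        using F0(3) unfolding dist_real_def by linarith
      finally show ?thesis
        by (rule power2_le_imp_le) (use \<open>d > 0\<close> in simp)
    qed
    define P where "P F \<longleftrightarrow> finite F \<and> F0 \<subseteq> F \<and> F \<subseteq> I" for F
    have "eventually P (finite_subsets_at_top I)"
      unfolding eventually_finite_subsets_at_top P_def using F0(1,2) by blast
    moreover have "dist (sum ?f F) (sum ?f G) < d" if "P F \<and> P G" for F G
    proof -
      have "dist (sum ?f F) (sum ?f G) \<le> norm (sum ?f F - sum ?f F0) + norm (sum ?f G - sum ?f F0)"
        using norm_triangle_ineq4[of "sum ?f F - sum ?f F0" "sum ?f G - sum ?f F0"] by (simp add: dist_norm)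
      also have "\<dots> \<le> d/3 + d/3" using close that unfolding P_def by (intro add_mono) blast+
      finally show ?thesis using \<open>d > 0\<close> by linarith
    qed
    ultimately show ?thesis by blast
  qed
  then have "cauchy_filter (filtermap (sum ?f) (finite_subsets_at_top I))"
    by (simp add: cauchy_filter_metric_filtermap)
  moreover have "Topological_Spaces.complete (UNIV :: 'v set)"
    by (rule complete_UNIV)
  ultimately obtain L where "(sum ?f \<longlongrightarrow> L) (finite_subsets_at_top I)"
    using complete_uniform[where S=UNIV] by (force simp add: filterlim_def)
  then show ?thesis
    using summable_on_def has_sum_def by blast
qed

lemma has_sum_inner_left: "(f has_sum s) I \<Longrightarrow> ((\<lambda>i. inner (f i) y) has_sum inner s y) I"
  using has_sum_bounded_linear[OF bounded_linear_inner_left] .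

lemma inner_orthonormal_series:
  assumes e: "orthonormal_on I e" and s: "((\<lambda>i. c i *\<^sub>R e i) has_sum s) I" and j: "j \<in> I"
  shows "inner s (e j) = c j"
proof -
  have "((\<lambda>i. inner (c i *\<^sub>R e i) (e j)) has_sum inner s (e j)) I"
    by (rule has_sum_inner_left[OF s])
  moreover have "((\<lambda>i. inner (c i *\<^sub>R e i) (e j)) has_sum c j) I"
  proof (subst has_sum_cong_neutral[where T = "{j}" and g = c])
    show "(c has_sum c j) {j}" by (rule has_sum_finiteI) auto
  qed (use e j in \<open>auto simp: orthonormal_onD\<close>)
  ultimately show ?thesis by (rule has_sum_unique)
qed

lemma diag_op_summable_coeff:
  assumes e: "orthonormal_on I e" and c: "\<And>i. i \<in> I \<Longrightarrow> \<bar>c i\<bar> \<le> K"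
  shows "(\<lambda>i. (c i * inner x (e i))\<^sup>2) summable_on I"
proof (rule summable_on_comparison_test)
  show "(\<lambda>i. K\<^sup>2 * (inner x (e i))\<^sup>2) summable_on I"
    by (intro summable_on_cmult_right bessel_summable e)
  show "(c i * inner x (e i))\<^sup>2 \<le> K\<^sup>2 * (inner x (e i))\<^sup>2" if "i \<in> I" for i
    unfolding power_mult_distrib
    using power_mono[OF c[OF that], of 2] by (intro mult_right_mono) auto
qed auto

context
  fixes I :: "'i set" and e :: "'i \<Rightarrow> 'v::{real_inner, banach}" and c :: "'i \<Rightarrow> real" and K :: real
  assumes e: "orthonormal_on I e" and c: "\<And>i. i \<in> I \<Longrightarrow> \<bar>c i\<bar> \<le> K"
begin

lemma diag_op_has_sum: "((\<lambda>i. (c i * inner x (e i)) *\<^sub>R e i) has_sum diag_op I e c x) I"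
  unfolding diag_op_def
  using orthonormal_series_summable[OF e diag_op_summable_coeff[OF e c]] by auto

lemma inner_diag_op_basis: "i \<in> I \<Longrightarrow> inner (diag_op I e c x) (e i) = c i * inner x (e i)"
  using inner_orthonormal_series[OF e diag_op_has_sum] .

lemma inner_diag_op_has_sum:
  "((\<lambda>i. c i * inner x (e i) * inner y (e i)) has_sum inner (diag_op I e c x) y) I"
  using has_sum_inner_left[OF diag_op_has_sum, of x y] by (simp add: inner_commute)

lemma norm_diag_op_has_sum:
  "((\<lambda>i. (c i)\<^sup>2 * (inner x (e i))\<^sup>2) has_sum (norm (diag_op I e c x))\<^sup>2) I"
proof -
  have "((\<lambda>i. c i * inner x (e i) * inner (diag_op I e c x) (e i))
      has_sum inner (diag_op I e c x) (diag_op I e c x)) I"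
    by (rule inner_diag_op_has_sum)
  then show ?thesis
    unfolding power2_norm_eq_inner
    by (subst (asm) has_sum_cong[where g = "\<lambda>i. (c i)\<^sup>2 * (inner x (e i))\<^sup>2"])
       (auto simp: inner_diag_op_basis power2_eq_square)
qed

lemma norm_diag_op_le:
  assumes "K \<ge> 0"
  shows "norm (diag_op I e c x) \<le> K * norm x"
proof -
  have "(norm (diag_op I e c x))\<^sup>2 \<le> K\<^sup>2 * (norm x)\<^sup>2"
  proof (rule has_sum_le_finite_sums[OF norm_diag_op_has_sum])
    fix F assume F: "finite F" "F \<subseteq> I"
    have "(\<Sum>i\<in>F. (c i)\<^sup>2 * (inner x (e i))\<^sup>2) \<le> (\<Sum>i\<in>F. K\<^sup>2 * (inner x (e i))\<^sup>2)"
    proof (intro sum_mono mult_right_mono)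
      fix i assume "i \<in> F"
      then show "(c i)\<^sup>2 \<le> K\<^sup>2" using power_mono[OF c, of i 2] F by auto
    qed auto
    also have "\<dots> \<le> K\<^sup>2 * (norm x)\<^sup>2"
      unfolding sum_distrib_left[symmetric] using bessel_finite[OF e F] by (intro mult_left_mono) auto
    finally show "(\<Sum>i\<in>F. (c i)\<^sup>2 * (inner x (e i))\<^sup>2) \<le> K\<^sup>2 * (norm x)\<^sup>2" .
  qed
  then show ?thesis
    unfolding power_mult_distrib[symmetric] using assms by (simp add: power2_le_iff_abs_le)
qed

lemma inner_diag_op_commute: "inner (diag_op I e c x) y = inner x (diag_op I e c y)"
proof -
  have "((\<lambda>i. c i * inner x (e i) * inner y (e i)) has_sum inner (diag_op I e c y) x) I"
    using inner_diag_op_has_sum[of y x] by (simp add: mult_ac)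
  then show ?thesis
    using inner_diag_op_has_sum[of x y] has_sum_unique by (metis inner_commute)
qed

lemma inner_diag_op_eq_0: "(\<And>i. i \<in> I \<Longrightarrow> inner y (e i) = 0) \<Longrightarrow> inner (diag_op I e c x) y = 0"
  using infsumI[OF inner_diag_op_has_sum, of x y] infsum_0 by (metis (no_types, lifting) mult_zero_right)

lemma bounded_linear_diag_op: "bounded_linear (diag_op I e c)"
proof (rule bounded_linear_intro)
  show "diag_op I e c (x + y) = diag_op I e c x + diag_op I e c y" for x y
  proof (rule has_sum_unique[OF diag_op_has_sum])
    show "((\<lambda>i. (c i * inner (x + y) (e i)) *\<^sub>R e i) has_sum diag_op I e c x + diag_op I e c y) I"
      using has_sum_add[OF diag_op_has_sum[of x] diag_op_has_sum[of y]]
      by (simp add: inner_add_left algebra_simps)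
  qed
  show "diag_op I e c (r *\<^sub>R x) = r *\<^sub>R diag_op I e c x" for r x
  proof (rule has_sum_unique[OF diag_op_has_sum])
    show "((\<lambda>i. (c i * inner (r *\<^sub>R x) (e i)) *\<^sub>R e i) has_sum r *\<^sub>R diag_op I e c x) I"
      using has_sum_scaleR[OF diag_op_has_sum[of x], of r] by (simp add: algebra_simps)
  qed
  \<comment> \<open>For an empty index set nothing prevents \<open>K\<close> from being negative,
    hence the absolute value.\<close>
  show "norm (diag_op I e c x) \<le> norm x * \<bar>K\<bar>" for x
  proof (cases "I = {}")
    case True then show ?thesis by (simp add: diag_op_def)
  next
    case False
    then have "K \<ge> 0" using c abs_ge_zero order_trans by (meson ex_in_conv)
    then show ?thesis using norm_diag_op_le by (simp add: mult.commute)
  qed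
qed

end

abbreviation proj_op :: "'i set \<Rightarrow> ('i \<Rightarrow> 'v::real_inner) \<Rightarrow> 'v \<Rightarrow> 'v" where
  "proj_op I e \<equiv> diag_op I e (\<lambda>_. 1)"

lemma proj_op_residual:
  fixes e :: "'i \<Rightarrow> 'v::{real_inner, banach}"
  assumes "orthonormal_on I e" "i \<in> I"
  shows "inner (x - proj_op I e x) (e i) = 0"
  using inner_diag_op_basis[OF assms(1), of "\<lambda>_. 1" 1 i x] assms by (simp add: inner_diff_left)

text \<open>The second hypothesis puts \<open>x\<close> in the double orthogonal complement of the
  family, that is, in its closed span. The residual is then orthogonal both to \<open>x\<close> and
  to the projection of \<open>x\<close>, hence to itself.\<close>

lemma orthonormal_expansion:
  fixes e :: "'i \<Rightarrow> 'v::{real_inner, banach}"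
  assumes e: "orthonormal_on I e"
    and x: "\<And>y. (\<And>i. i \<in> I \<Longrightarrow> inner y (e i) = 0) \<Longrightarrow> inner x y = 0"
  shows "proj_op I e x = x"
proof -
  let ?y = "x - proj_op I e x"
  have y: "inner ?y (e i) = 0" if "i \<in> I" for i
    using proj_op_residual[OF e that] .
  have "inner (proj_op I e x) ?y = 0"
    using y by (intro inner_diag_op_eq_0[OF e, where K = 1]) auto
  moreover have "inner x ?y = 0" using y by (rule x)
  ultimately have "inner ?y ?y = 0" by (simp add: inner_diff_left)
  then show ?thesis by simp
qed

lemma parseval_proj:
  fixes e :: "'i \<Rightarrow> 'v::{real_inner, banach}"
  assumes e: "orthonormal_on I e"
  shows "((\<lambda>i. (inner x (e i))\<^sup>2) has_sum (norm (proj_op I e x))\<^sup>2) I"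
  using norm_diag_op_has_sum[OF e, of "\<lambda>_. 1" 1 x] by simp

lemma norm_residual_sq:
  fixes e :: "'i \<Rightarrow> 'v::{real_inner, banach}"
  assumes e: "orthonormal_on I e"
  shows "(norm x)\<^sup>2 = (norm (proj_op I e x))\<^sup>2 + (norm (x - proj_op I e x))\<^sup>2"
proof -
  have "inner (proj_op I e x) (x - proj_op I e x) = 0"
    using proj_op_residual[OF e] by (intro inner_diag_op_eq_0[OF e, where K = 1]) auto
  then show ?thesis
    unfolding power2_norm_eq_inner by (simp add: inner_diff_left inner_diff_right inner_commute)
qed

text \<open>A version of \<open>eigenpairs\<close> for any index set, so that it covers the given
  sequence indexed from 1 as well as sets of eigenvectors indexed by themselves. Completeness is a
  condition on the kernel, which spares a basis of the kernel.\<close>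

definition eigensystem :: "('v::real_inner \<Rightarrow> 'v) \<Rightarrow> 'i set \<Rightarrow> ('i \<Rightarrow> 'v) \<Rightarrow> ('i \<Rightarrow> real) \<Rightarrow> bool" where
  "eigensystem A I e a \<longleftrightarrow> orthonormal_on I e \<and> (\<forall>i\<in>I. a i \<noteq> 0 \<and> A (e i) = a i *\<^sub>R e i) \<and>
     (\<forall>x. (\<forall>i\<in>I. inner x (e i) = 0) \<longrightarrow> A x = 0)"

lemma orth_proj_eqI:
  assumes "y \<in> V" "\<And>z. z \<in> V \<Longrightarrow> inner (x - y) z = 0" "subspace V"
  shows "orth_proj V x = y"
  unfolding orth_proj_def
proof (rule the_equality)
  show "y \<in> V \<and> (\<forall>z\<in>V. inner (x - y) z = 0)" using assms by auto
  fix y' assume y': "y' \<in> V \<and> (\<forall>z\<in>V. inner (x - y') z = 0)"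
  have "y - y' \<in> V" using assms y' by (auto intro: subspace_diff)
  then have "inner (x - y') (y - y') = 0" "inner (x - y) (y - y') = 0"
    using assms y' by auto
  then have "inner (y - y') (y - y') = 0" by (simp add: inner_diff_left)
  then show "y' = y" by simp
qed

section \<open>Functional calculus of an operator that is given by an eigensystem\<close>

context
  fixes A :: "'v::{real_inner, banach} \<Rightarrow> 'v" and I :: "'i set" and e :: "'i \<Rightarrow> 'v" and a :: "'i \<Rightarrow> real"
  assumes A: "bounded_linear A" and es: "eigensystem A I e a"
begin

private lemma e: "orthonormal_on I e" using es by (simp add: eigensystem_def)
private lemma Ae: "i \<in> I \<Longrightarrow> A (e i) = a i *\<^sub>R e i" using es by (simp add: eigensystem_def)
private lemma a0: "i \<in> I \<Longrightarrow> a i \<noteq> 0" using es by (simp add: eigensystem_def)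

lemma eigensystem_eigenvalue_le:
  assumes "i \<in> I"
  shows "\<bar>a i\<bar> \<le> onorm A"
proof -
  have "norm (e i) = 1"
    using orthonormal_onD[OF e assms assms] by (simp add: norm_eq_1)
  then show ?thesis
    using onorm[OF A, of "e i"] Ae[OF assms] by simp
qed

lemma eigensystem_diag: "A x = diag_op I e a x"
proof -
  have 1: "A (x - proj_op I e x) = 0"
    using proj_op_residual[OF e] es by (simp add: eigensystem_def)
  have "((\<lambda>i. A ((1 * inner x (e i)) *\<^sub>R e i)) has_sum A (proj_op I e x)) I"
    by (intro has_sum_bounded_linear[OF A] diag_op_has_sum[OF e, where K = 1]) auto
  then have "((\<lambda>i. (a i * inner x (e i)) *\<^sub>R e i) has_sum A (proj_op I e x)) I"
    by (subst (asm) has_sum_cong[where g = "\<lambda>i. (a i * inner x (e i)) *\<^sub>R e i"])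
       (auto simp: linear_cmul[OF bounded_linear.linear[OF A]] Ae)
  then have "A (proj_op I e x) = diag_op I e a x"
    by (rule has_sum_unique[OF _ diag_op_has_sum[OF e eigensystem_eigenvalue_le]])
  then show ?thesis
    using 1 linear_diff[OF bounded_linear.linear[OF A]] by auto
qed

lemma subspace_eigenspace: "subspace (eigenspace A \<mu>)"
  using bounded_linear.linear[OF A]
  unfolding subspace_def eigenspace_def by (auto simp: linear_0 linear_add linear_cmul algebra_simps)

lemma eigensystem_proj_0: "orth_proj (eigenspace A 0) x = x - proj_op I e x"
proof (rule orth_proj_eqI[OF _ _ subspace_eigenspace])
  show "x - proj_op I e x \<in> eigenspace A 0"
    using proj_op_residual[OF e] es by (simp add: eigensystem_def eigenspace_def)
  fix z assume z: "z \<in> eigenspace A 0"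
  have "inner z (e i) = 0" if i: "i \<in> I" for i
  proof -
    have "a i * inner z (e i) = inner (A z) (e i)"
      unfolding eigensystem_diag using inner_diag_op_basis[OF e eigensystem_eigenvalue_le] i by simp
    then show ?thesis using z a0[OF i] by (simp add: eigenspace_def)
  qed
  then have "inner (proj_op I e x) z = 0"
    by (intro inner_diag_op_eq_0[OF e, where K = 1]) auto
  then show "inner (x - (x - proj_op I e x)) z = 0" by simp
qed

text \<open>An eigenvector for \<open>\<mu>\<close> is orthogonal to every \<open>e i\<close> with
  another eigenvalue, and as a multiple of its own image it lies in the closed span of the family.
  So the \<open>e i\<close> with eigenvalue \<open>\<mu>\<close> span the eigenspace.\<close>

lemma eigensystem_proj:
  assumes \<mu>: "\<mu> \<noteq> 0"
  shows "orth_proj (eigenspace A \<mu>) x = proj_op {i\<in>I. a i = \<mu>} e x"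
proof (rule orth_proj_eqI[OF _ _ subspace_eigenspace])
  let ?I = "{i\<in>I. a i = \<mu>}"
  have e': "orthonormal_on ?I e" by (rule orthonormal_on_subset[OF e]) auto
  have hs: "((\<lambda>i. (1 * inner x (e i)) *\<^sub>R e i) has_sum proj_op ?I e x) ?I"
    by (rule diag_op_has_sum[OF e', where K = 1]) auto
  have "((\<lambda>i. A ((1 * inner x (e i)) *\<^sub>R e i)) has_sum A (proj_op ?I e x)) ?I"
    by (intro has_sum_bounded_linear[OF A] hs)
  moreover have "((\<lambda>i. \<mu> *\<^sub>R ((1 * inner x (e i)) *\<^sub>R e i)) has_sum \<mu> *\<^sub>R proj_op ?I e x) ?I"
    by (intro has_sum_scaleR hs)
  ultimately have "A (proj_op ?I e x) = \<mu> *\<^sub>R proj_op ?I e x"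
    by (elim has_sum_unique, subst has_sum_cong[where g = "\<lambda>i. \<mu> *\<^sub>R ((1 * inner x (e i)) *\<^sub>R e i)"])
       (auto simp: linear_cmul[OF bounded_linear.linear[OF A]] Ae)
  then show "proj_op ?I e x \<in> eigenspace A \<mu>" by (simp add: eigenspace_def)
  fix z assume z: "z \<in> eigenspace A \<mu>"
  have z0: "inner z (e i) = 0" if i: "i \<in> I" "a i \<noteq> \<mu>" for i
  proof -
    have "a i * inner z (e i) = inner (A z) (e i)"
      unfolding eigensystem_diag using inner_diag_op_basis[OF e eigensystem_eigenvalue_le] i by simp
    also have "\<dots> = \<mu> * inner z (e i)" using z by (simp add: eigenspace_def)
    finally show ?thesis using i by simp
  qed
  have "proj_op ?I e z = z"
  proof (rule orthonormal_expansion[OF e'])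
    fix y assume y: "\<And>i. i \<in> ?I \<Longrightarrow> inner y (e i) = 0"
    have "\<mu> * inner z y = inner (diag_op I e a z) y"
      using z by (simp add: eigenspace_def eigensystem_diag[symmetric])
    also have "\<dots> = 0"
    proof -
      have "((\<lambda>i. a i * inner z (e i) * inner y (e i)) has_sum inner (diag_op I e a z) y) I"
        by (rule inner_diag_op_has_sum[OF e eigensystem_eigenvalue_le])
      moreover have "((\<lambda>i. a i * inner z (e i) * inner y (e i)) has_sum 0) I"
        by (rule has_sum_0) (use z0 y in fastforce)
      ultimately show ?thesis by (rule has_sum_unique)
    qed
    finally show "inner z y = 0" using \<mu> by simp
  qed
  moreover have "inner (x - proj_op ?I e x) (proj_op ?I e z) = 0"
    unfolding inner_commute[of "x - _"]
    using proj_op_residual[OF e'] by (intro inner_diag_op_eq_0[OF e', where K = 1]) auto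
  ultimately show "inner (x - proj_op ?I e x) z = 0" by simp
qed

text \<open>\<open>op_fun\<close> sums over eigenvalues, the right-hand side over eigenvectors;
  grouping the eigenvectors by eigenvalue turns one sum into the other. The eigenvalue 0 has no
  eigenvector in the family: its projection is the residual, which carries the factor
  \<open>f 0\<close>.\<close>

lemma op_fun_eigensystem:
  assumes f: "\<And>i. i \<in> I \<Longrightarrow> \<bar>f (a i)\<bar> \<le> K"
  shows "op_fun f A x = diag_op I e (\<lambda>i. f (a i)) x + f 0 *\<^sub>R (x - proj_op I e x)"
proof -
  let ?J = "\<lambda>\<mu>. {i\<in>I. a i = \<mu>}"
  define t where "t \<mu> = f \<mu> *\<^sub>R orth_proj (eigenspace A \<mu>) x" for \<mu>
  have "((\<lambda>(\<mu>, i). (f (a i) * inner x (e i)) *\<^sub>R e i) has_sum diag_op I e (\<lambda>i. f (a i)) x) (Sigma (a ` I) ?J)"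
  proof (subst has_sum_reindex_bij_betw[symmetric])
    show "bij_betw (\<lambda>i. (a i, i)) I (Sigma (a ` I) ?J)"
      by (force simp: bij_betw_def inj_on_def image_iff)
    show "((\<lambda>i. case (a i, i) of (\<mu>, i) \<Rightarrow> (f (a i) * inner x (e i)) *\<^sub>R e i)
        has_sum diag_op I e (\<lambda>i. f (a i)) x) I"
      using diag_op_has_sum[where c = "\<lambda>i. f (a i)", OF e f] by simp
  qed
  moreover have "((\<lambda>i. (f (a i) * inner x (e i)) *\<^sub>R e i) has_sum t \<mu>) (?J \<mu>)" if "\<mu> \<in> a ` I" for \<mu>
  proof -
    have "\<mu> \<noteq> 0" using that a0 by auto
    have "((\<lambda>i. (1 * inner x (e i)) *\<^sub>R e i) has_sum proj_op (?J \<mu>) e x) (?J \<mu>)"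
      by (rule diag_op_has_sum[OF orthonormal_on_subset[OF e], where K = 1]) auto
    then have "((\<lambda>i. f \<mu> *\<^sub>R (1 * inner x (e i)) *\<^sub>R e i) has_sum t \<mu>) (?J \<mu>)"
      unfolding t_def eigensystem_proj[OF \<open>\<mu> \<noteq> 0\<close>] by (rule has_sum_scaleR)
    then show ?thesis
      by (subst has_sum_cong[where g = "\<lambda>i. f \<mu> *\<^sub>R (1 * inner x (e i)) *\<^sub>R e i"]) auto
  qed
  ultimately have "(t has_sum diag_op I e (\<lambda>i. f (a i)) x) (a ` I)"
    using has_sum_SigmaD[where f = "\<lambda>(\<mu>, i). (f (a i) * inner x (e i)) *\<^sub>R e i" and g = t
        and A = "a ` I" and B = ?J] by simp
  \<comment> \<open>The index 0 is inserted whether or not it is an eigenvalue; if it is not, its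
    term vanishes by \<open>tz\<close>.\<close>
  then have 2: "(t has_sum (t 0 + diag_op I e (\<lambda>i. f (a i)) x)) (insert 0 (a ` I))"
    using a0 by (intro has_sum_insert) auto
  have t0: "t 0 = f 0 *\<^sub>R (x - proj_op I e x)" unfolding t_def eigensystem_proj_0 ..
  have ev: "\<mu> \<in> eigenvalues A" if "i \<in> I" "a i = \<mu>" for i \<mu>
  proof -
    have "e i \<noteq> 0" using orthonormal_onD[OF e, of i i] that by auto
    then show ?thesis unfolding eigenvalues_def using Ae[OF that(1)] that(2) by blast
  qed
  have tz: "t \<mu> = 0" if "\<mu> \<notin> eigenvalues A" "\<mu> \<in> insert 0 (a ` I)" for \<mu>
  proof -
    from that ev have "\<mu> = 0" by blast
    have "A (x - proj_op I e x) = 0"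
      using proj_op_residual[OF e] es by (simp add: eigensystem_def)
    moreover have "\<forall>y. A y = 0 \<longrightarrow> y = 0"
      using that(1) unfolding eigenvalues_def \<open>\<mu> = 0\<close> by auto
    ultimately have "x - proj_op I e x = 0" by blast
    then show ?thesis using t0 \<open>\<mu> = 0\<close> by simp
  qed
  have ins: "\<mu> \<in> insert 0 (a ` I)" if "\<mu> \<in> eigenvalues A" for \<mu>
  proof (rule ccontr)
    assume n: "\<mu> \<notin> insert 0 (a ` I)"
    obtain y where y: "y \<noteq> 0" "A y = \<mu> *\<^sub>R y" using \<open>\<mu> \<in> eigenvalues A\<close> by (auto simp: eigenvalues_def)
    have "inner y (e i) = 0" if i: "i \<in> I" for i
    proof -
      have "a i * inner y (e i) = inner (A y) (e i)"
        unfolding eigensystem_diag using inner_diag_op_basis[OF e eigensystem_eigenvalue_le] i by simp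
      also have "\<dots> = \<mu> * inner y (e i)" using y by simp
      finally show ?thesis using i n by auto
    qed
    then have "A y = 0" using es by (simp add: eigensystem_def)
    then show False using y n by simp
  qed
  have "(t has_sum (t 0 + diag_op I e (\<lambda>i. f (a i)) x)) (eigenvalues A) \<longleftrightarrow>
      (t has_sum (t 0 + diag_op I e (\<lambda>i. f (a i)) x)) (insert 0 (a ` I))"
    using tz ins by (intro has_sum_cong_neutral) blast+
  then have "(t has_sum (t 0 + diag_op I e (\<lambda>i. f (a i)) x)) (eigenvalues A)"
    using 2 by blast
  then show ?thesis
    unfolding op_fun_def t_def[symmetric] t0 by (simp add: infsumI add.commute)
qed

end

section \<open>Adjoints and the spectral theorem for positive trace class operators\<close>

lemma closed_subspace_projection:
  fixes V :: "'v::{real_inner, banach} set"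
  assumes V: "subspace V" "closed V"
  obtains y where "y \<in> V" "\<And>z. z \<in> V \<Longrightarrow> inner (x - y) z = 0"
proof -
  define D where "D = (INF v\<in>V. (norm (x - v))\<^sup>2)"
  have V0: "V \<noteq> {}" using subspace_0[OF V(1)] by auto
  have D: "D \<le> (norm (x - v))\<^sup>2" if "v \<in> V" for v
    unfolding D_def using that by (intro cINF_lower bdd_belowI[of _ 0]) auto
  have "\<exists>v\<in>V. (norm (x - v))\<^sup>2 < D + 1 / (real n + 1)" for n
  proof -
    have "D < D + 1 / (real n + 1)" by simp
    then show ?thesis using cInf_lessD[of "(\<lambda>v. (norm (x - v))\<^sup>2) ` V"] V0 unfolding D_def by auto
  qed
  then obtain y where y: "\<And>n. y n \<in> V" "\<And>n. (norm (x - y n))\<^sup>2 < D + 1 / (real n + 1)"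
    by metis
  \<comment> \<open>The parallelogram law, with the midpoint of \<open>y m\<close> and
    \<open>y n\<close> as a competitor for the infimum \<open>D\<close>.\<close>
  have close: "(norm (y m - y n))\<^sup>2 \<le> 2 / (real m + 1) + 2 / (real n + 1)" for m n
  proof -
    have "(1/2) *\<^sub>R (y m + y n) \<in> V"
      using y V(1) by (simp add: subspace_add subspace_scale)
    then have "D \<le> (norm (x - (1/2) *\<^sub>R (y m + y n)))\<^sup>2" by (rule D)
    moreover have "(norm (y m - y n))\<^sup>2 = 2 * (norm (x - y m))\<^sup>2 + 2 * (norm (x - y n))\<^sup>2
        - 4 * (norm (x - (1/2) *\<^sub>R (y m + y n)))\<^sup>2"
      unfolding power2_norm_eq_inner
      by (simp add: inner_diff_left inner_diff_right inner_add_left inner_add_right inner_commute algebra_simps)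
    ultimately show ?thesis using y(2)[of m] y(2)[of n] by linarith
  qed
  have "Cauchy y"
  proof (rule CauchyI)
    fix d :: real assume d: "d > 0"
    then obtain N where N: "1 / (real N + 1) < d\<^sup>2 / 4"
      using reals_Archimedean[of "d\<^sup>2 / 4"] by (auto simp: inverse_eq_divide add.commute)
    have "norm (y m - y n) < d" if "m \<ge> N" "n \<ge> N" for m n
    proof -
      have "1 / (real m + 1) \<le> 1 / (real N + 1)" "1 / (real n + 1) \<le> 1 / (real N + 1)"
        using that by (auto intro!: divide_left_mono)
      then have "(norm (y m - y n))\<^sup>2 < d\<^sup>2" using close[of m n] N by simp
      then show ?thesis using d by (meson less_imp_le power_less_imp_less_base)
    qed
    then show "\<exists>M. \<forall>m\<ge>M. \<forall>n\<ge>M. norm (y m - y n) < d" by blast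
  qed
  then obtain l where l: "y \<longlonglongrightarrow> l" using Cauchy_convergent convergent_def by blast
  have lV: "l \<in> V" using closed_sequentially[OF V(2) _ l] y by auto
  have "(\<lambda>n. (norm (x - y n))\<^sup>2) \<longlonglongrightarrow> (norm (x - l))\<^sup>2"
    by (intro tendsto_intros l)
  moreover have "(\<lambda>n. D + 1 / (real n + 1)) \<longlonglongrightarrow> D + 0"
    using LIMSEQ_inverse_real_of_nat by (intro tendsto_intros) (simp add: inverse_eq_divide add.commute)
  ultimately have min: "(norm (x - l))\<^sup>2 \<le> D"
    using y(2) by (intro LIMSEQ_le[of _ _ "\<lambda>n. D + 1 / (real n + 1)" D]) (auto intro: less_imp_le)
  have "inner (x - l) z = 0" if z: "z \<in> V" for z
  proof (cases "z = 0")
    case False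
    \<comment> \<open>This \<open>t\<close> minimises the distance from \<open>x - l\<close> to the
      multiples of \<open>z\<close>; minimality of \<open>l\<close> forbids any gain.\<close>
    define t where "t = inner (x - l) z / (norm z)\<^sup>2"
    have "l + t *\<^sub>R z \<in> V" using V(1) lV z by (simp add: subspace_add subspace_scale)
    from D[OF this] min have "(norm (x - l))\<^sup>2 \<le> (norm (x - l - t *\<^sub>R z))\<^sup>2"
      unfolding diff_diff_eq by linarith
    also have "\<dots> = (norm (x - l))\<^sup>2 - 2 * t * inner (x - l) z + t\<^sup>2 * (norm z)\<^sup>2"
      unfolding power2_norm_eq_inner
      by (simp add: inner_diff_left inner_diff_right inner_commute power2_eq_square algebra_simps)
    also have "\<dots> = (norm (x - l))\<^sup>2 - (inner (x - l) z)\<^sup>2 / (norm z)\<^sup>2"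
      using False unfolding t_def by (simp add: field_simps power2_eq_square)
    finally have "(inner (x - l) z)\<^sup>2 / (norm z)\<^sup>2 \<le> 0" by simp
    then show ?thesis using False by (simp add: divide_le_0_iff)
  qed simp
  with lV that show ?thesis by blast
qed

text \<open>The kernel of a nonzero functional has codimension one: subtracting a multiple of a
  fixed \<open>z\<close> orthogonal to the kernel moves every \<open>x\<close> into it.\<close>

lemma riesz_representation:
  fixes L :: "'v::{real_inner, banach} \<Rightarrow> real"
  assumes L: "bounded_linear L"
  obtains y where "\<And>x. L x = inner x y"
proof (cases "\<forall>x. L x = 0")
  case True then show ?thesis using that[of 0] by simp
next
  case False
  note lin = bounded_linear.linear[OF L]
  define V where "V = {x. L x = 0}"
  have V: "subspace V" "closed V"
    unfolding V_def using linear_subspace_kernel[OF lin]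
    by (auto intro!: closed_Collect_eq bounded_linear.continuous_on[OF L])
  obtain x0 where x0: "L x0 \<noteq> 0" using False by auto
  obtain p where p: "p \<in> V" "\<And>z. z \<in> V \<Longrightarrow> inner (x0 - p) z = 0"
    using closed_subspace_projection[OF V] by blast
  define z where "z = x0 - p"
  have Lz: "L z \<noteq> 0" using x0 p(1) by (simp add: z_def V_def linear_diff[OF lin])
  then have z: "inner z z \<noteq> 0" using linear_0[OF lin] by auto
  have "L x = inner x ((L z / inner z z) *\<^sub>R z)" for x
  proof -
    have "x - (L x / L z) *\<^sub>R z \<in> V" using Lz by (simp add: V_def linear_diff[OF lin] linear_cmul[OF lin])
    then have "inner z (x - (L x / L z) *\<^sub>R z) = 0" using p(2) by (simp add: z_def)
    then have "inner x z = L x / L z * inner z z" by (simp add: inner_diff_right inner_commute)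
    then show ?thesis using Lz z by simp
  qed
  then show ?thesis by (rule that)
qed

text \<open>\<open>adjoint\<close> is a choice operator. Riesz representation shows that some map
  meets its specification, so the chosen one does.\<close>

lemma inner_adjoint:
  fixes J :: "'k::{real_inner, banach} \<Rightarrow> 'h::real_inner"
  assumes J: "bounded_linear J"
  shows "inner (J x) y = inner x (adjoint J y)"
proof -
  have "\<exists>z. \<forall>x. inner (J x) y = inner x z" for y
  proof -
    have "bounded_linear (\<lambda>x. inner (J x) y)" by (rule bounded_linear_inner_left_comp[OF J])
    then show ?thesis using riesz_representation by metis
  qed
  then obtain f where "\<forall>x y. inner (J x) y = inner x (f y)" by metis
  then have "\<forall>x y. inner (J x) y = inner x (adjoint J y)"
    unfolding adjoint_def by (rule someI[where P = "\<lambda>f'. \<forall>x y. inner (J x) y = inner x (f' y)"])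
  then show ?thesis by blast
qed

lemma bounded_linear_adjoint:
  fixes J :: "'k::{real_inner, banach} \<Rightarrow> 'h::real_inner"
  assumes J: "bounded_linear J"
  shows "bounded_linear (adjoint J)"
proof (rule bounded_linear_intro)
  show "adjoint J (x + y) = adjoint J x + adjoint J y" for x y
    by (rule vector_eq_rdot[THEN iffD1])
       (metis inner_adjoint[OF J] inner_add_right inner_commute)
  show "adjoint J (r *\<^sub>R x) = r *\<^sub>R adjoint J x" for r x
    by (rule vector_eq_rdot[THEN iffD1])
       (metis inner_adjoint[OF J] inner_scaleR_right inner_commute)
  show "norm (adjoint J y) \<le> norm y * onorm J" for y
  proof (cases "adjoint J y = 0")
    case False
    have "(norm (adjoint J y))\<^sup>2 = inner (J (adjoint J y)) y"
      by (simp add: inner_adjoint[OF J] power2_norm_eq_inner)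
    also have "\<dots> \<le> norm (J (adjoint J y)) * norm y" by (rule norm_cauchy_schwarz)
    also have "\<dots> \<le> onorm J * norm (adjoint J y) * norm y"
      by (intro mult_right_mono onorm[OF J]) auto
    finally show ?thesis using False by (simp add: power2_eq_square mult_ac)
  qed (simp add: onorm_pos_le[OF J])
qed

section \<open>Compactness and eigenvectors of positive trace class operators\<close>

lemma norm_le_positive_form:
  fixes A :: "'v::real_inner \<Rightarrow> 'v"
  assumes A: "linear A" and W: "subspace W" "\<And>x. x \<in> W \<Longrightarrow> A x \<in> W"
    and sym: "\<And>x y. inner (A x) y = inner x (A y)"
    and pos: "\<And>x. x \<in> W \<Longrightarrow> 0 \<le> inner (A x) x"
    and K: "K > 0" "\<And>x. x \<in> W \<Longrightarrow> inner (A x) x \<le> K * (norm x)\<^sup>2"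
    and x: "x \<in> W"
  shows "(norm (A x))\<^sup>2 \<le> K * inner (A x) x"
proof -
  \<comment> \<open>Non-negativity of the form at this test vector gives the whole inequality. A
    subspace \<open>W\<close> is allowed because \<open>exists_eigenvector\<close> applies this to
    \<open>m - A\<close>, where \<open>m\<close> is the supremum of the form on the unit sphere of
    \<open>W\<close>, and positivity is known on \<open>W\<close> only.\<close>
  let ?y = "x - (1/K) *\<^sub>R A x"
  have "?y \<in> W" using W x by (simp add: subspace_diff subspace_scale)
  then have "0 \<le> inner (A ?y) ?y" by (rule pos)
  also have "\<dots> = inner (A x) x - (2 / K) * (norm (A x))\<^sup>2 + (1 / K\<^sup>2) * inner (A (A x)) (A x)"
    unfolding power2_norm_eq_inner
    by (simp add: linear_diff[OF A] linear_cmul[OF A] inner_diff_left inner_diff_right sym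
        power2_eq_square inner_commute)
  also have "\<dots> \<le> inner (A x) x - (2 / K) * (norm (A x))\<^sup>2 + (1 / K\<^sup>2) * (K * (norm (A x))\<^sup>2)"
    using K W x by (intro add_left_mono mult_left_mono) auto
  also have "\<dots> = inner (A x) x - (norm (A x))\<^sup>2 / K"
    using K(1) by (simp add: power2_eq_square field_simps)
  finally show ?thesis using K(1) by (simp add: field_simps)
qed

text \<open>A sum of finitely many segments is compact. This stands in for local compactness of a
  finite-dimensional span.\<close>

lemma compact_bounded_combinations:
  fixes w :: "'i \<Rightarrow> 'v::real_normed_vector"
  assumes "finite F"
  shows "\<exists>C. compact C \<and> (\<forall>c. (\<forall>u\<in>F. \<bar>c u\<bar> \<le> 1) \<longrightarrow> (\<Sum>u\<in>F. c u *\<^sub>R w u) \<in> C)"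
  using assms
proof induction
  case empty
  then show ?case by (intro exI[of _ "{0}"]) auto
next
  case (insert a F)
  then obtain C where C: "compact C" "\<And>c. (\<forall>u\<in>F. \<bar>c u\<bar> \<le> 1) \<Longrightarrow> (\<Sum>u\<in>F. c u *\<^sub>R w u) \<in> C" by blast
  let ?S = "(\<lambda>t. t *\<^sub>R w a) ` {-1..1::real}"
  have "compact ?S" by (intro compact_continuous_image continuous_intros) auto
  then have "compact {x + y | x y. x \<in> ?S \<and> y \<in> C}" using C by (intro compact_sums)
  moreover have "(\<Sum>u\<in>insert a F. c u *\<^sub>R w u) \<in> {x + y | x y. x \<in> ?S \<and> y \<in> C}"
    if "\<forall>u\<in>insert a F. \<bar>c u\<bar> \<le> 1" for c
  proof -
    have "c a *\<^sub>R w a \<in> ?S" using that by (auto simp: abs_le_iff)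
    moreover have "(\<Sum>u\<in>F. c u *\<^sub>R w u) \<in> C" using C(2) that by auto
    ultimately show ?thesis using insert.hyps by auto
  qed
  ultimately show ?case by blast
qed

text \<open>Bounding the sums over all finite orthonormal sets expresses a finite trace without a
  basis of the space. The bound must be positive because it is divided by; its instances add 1 for
  that purpose.\<close>

locale positive_trace_class =
  fixes A :: "'v::{real_inner, banach} \<Rightarrow> 'v" and K :: real
  assumes A: "bounded_linear A"
    and selfadjoint: "\<And>x y. inner (A x) y = inner x (A y)"
    and pos: "\<And>x. 0 \<le> inner (A x) x"
    and trace: "\<And>F. finite F \<Longrightarrow> orthonormal_on F (\<lambda>u. u) \<Longrightarrow> (\<Sum>u\<in>F. inner (A u) u) \<le> K"
    and K: "K > 0"
begin

lemmas lin = bounded_linear.linear[OF A]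

lemma form_le: "inner (A x) x \<le> K * (norm x)\<^sup>2"
proof (cases "x = 0")
  case False
  define u where "u = (1 / norm x) *\<^sub>R x"
  have "inner (A u) u \<le> K"
    using trace[of "{u}"] False by (simp add: orthonormal_on_def u_def dot_square_norm power2_eq_square)
  moreover have "inner (A u) u = inner (A x) x / (norm x)\<^sup>2"
    unfolding u_def by (simp add: linear_cmul[OF lin] power2_eq_square)
  ultimately show ?thesis using False by (simp add: field_simps)
qed (simp add: linear_0[OF lin])

lemma norm_sq_le: "(norm (A x))\<^sup>2 \<le> K * inner (A x) x"
proof (rule norm_le_positive_form[OF lin, of UNIV])
  show "inner (A x) y = inner x (A y)" for x y by (rule selfadjoint)
qed (auto simp: pos K form_le)

text \<open>Take \<open>F\<close> with a sum within \<open>\<epsilon>\<close> of the supremum. A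
  unit vector orthogonal to \<open>F\<close> with a form value above \<open>\<epsilon>\<close> could
  be added to \<open>F\<close> and would push the sum beyond the supremum.\<close>

lemma exists_small_complement:
  assumes "\<epsilon> > 0"
  obtains F where "finite F" "orthonormal_on F (\<lambda>u. u)"
    "\<forall>x. (\<forall>u\<in>F. inner x u = 0) \<longrightarrow> inner (A x) x \<le> \<epsilon> * (norm x)\<^sup>2"
proof -
  define \<F> where "\<F> = {F. finite F \<and> orthonormal_on F (\<lambda>u::'v. u)}"
  define t where "t F = (\<Sum>u\<in>F. inner (A u) u)" for F
  have bdd: "bdd_above (t ` \<F>)"
    using trace by (intro bdd_aboveI[of _ K]) (auto simp: \<F>_def t_def)
  have "{} \<in> \<F>" by (simp add: \<F>_def orthonormal_on_def)
  then have "t ` \<F> \<noteq> {}" by auto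
  moreover have "Sup (t ` \<F>) - \<epsilon> < Sup (t ` \<F>)" using assms by simp
  ultimately obtain F where F: "F \<in> \<F>" "Sup (t ` \<F>) - \<epsilon> < t F"
    using less_cSup_iff[OF _ bdd] by blast
  have "inner (A x) x \<le> \<epsilon> * (norm x)\<^sup>2" if x: "\<forall>u\<in>F. inner x u = 0" for x
  proof (cases "x = 0")
    case False
    define u where "u = (1 / norm x) *\<^sub>R x"
    have u1: "inner u u = 1" using False by (simp add: u_def dot_square_norm power2_eq_square)
    have u0: "inner u v = 0" if "v \<in> F" for v using x that by (simp add: u_def)
    have "u \<notin> F" using u1 u0 by force
    have "insert u F \<in> \<F>"
      using F(1) u1 u0 unfolding \<F>_def orthonormal_on_def by (auto simp: inner_commute)
    then have "t (insert u F) \<le> Sup (t ` \<F>)" using bdd by (intro cSup_upper) auto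
    moreover have "t (insert u F) = inner (A u) u + t F"
      using F(1) \<open>u \<notin> F\<close> by (simp add: t_def \<F>_def)
    ultimately have "inner (A u) u \<le> \<epsilon>" using F(2) by simp
    moreover have "inner (A u) u = inner (A x) x / (norm x)\<^sup>2"
      unfolding u_def by (simp add: linear_cmul[OF lin] power2_eq_square)
    ultimately show ?thesis using False by (simp add: field_simps)
  qed (simp add: linear_0[OF lin])
  with F(1) show ?thesis unfolding \<F>_def by (intro that[of F]) auto
qed

lemma image_ball_near_compact:
  assumes "d > 0"
  obtains C where "compact C" "\<forall>x. norm x \<le> 1 \<longrightarrow> (\<exists>y\<in>C. norm (A x - y) \<le> d)"
proof -
  \<comment> \<open>\<open>norm_sq_le\<close> costs a factor \<open>K\<close>, so on the complement
    of \<open>F\<close> a form bounded by \<open>d\<^sup>2 / K\<close> yields images of norm at most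
    \<open>d\<close>. The part of \<open>x\<close> in the span of \<open>F\<close> has its image in
    a compact set.\<close>
  have "d\<^sup>2 / K > 0" using assms K by simp
  then obtain F where F: "finite F" "orthonormal_on F (\<lambda>u. u)"
    "\<forall>x. (\<forall>u\<in>F. inner x u = 0) \<longrightarrow> inner (A x) x \<le> d\<^sup>2 / K * (norm x)\<^sup>2"
    by (rule exists_small_complement)
  from compact_bounded_combinations[OF F(1), of A]
  obtain C where C: "compact C" "\<forall>c. (\<forall>u\<in>F. \<bar>c u\<bar> \<le> 1) \<longrightarrow> (\<Sum>u\<in>F. c u *\<^sub>R A u) \<in> C"
    by blast
  have "\<exists>y\<in>C. norm (A x - y) \<le> d" if x: "norm x \<le> 1" for x
  proof
    let ?p = "proj_op F (\<lambda>u. u) x"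
    have p: "?p = (\<Sum>u\<in>F. inner x u *\<^sub>R u)" using F(1) by (simp add: diag_op_def)
    have nu: "norm u = 1" if "u \<in> F" for u
      using orthonormal_onD[OF F(2) that that] by (simp add: norm_eq_1)
    have "\<bar>inner x u\<bar> \<le> 1" if "u \<in> F" for u
      using Cauchy_Schwarz_ineq2[of x u] nu[OF that] x by simp
    then show "(\<Sum>u\<in>F. inner x u *\<^sub>R A u) \<in> C" by (intro C(2)[rule_format])
    define z where "z = x - ?p"
    have z0: "\<forall>u\<in>F. inner z u = 0" unfolding z_def using proj_op_residual[OF F(2)] by blast
    have "(norm z)\<^sup>2 \<le> (norm x)\<^sup>2"
      using norm_residual_sq[OF F(2), of x] zero_le_power2[of "norm ?p"] unfolding z_def by linarith
    then have "norm z \<le> norm x" by (rule power2_le_imp_le) simp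
    then have "norm z \<le> 1" using x by linarith
    then have z1: "(norm z)\<^sup>2 \<le> 1" by (intro power_le_one) auto
    have Az: "inner (A z) z \<le> d\<^sup>2 / K * (norm z)\<^sup>2" using F(3) z0 by blast
    have "A x - (\<Sum>u\<in>F. inner x u *\<^sub>R A u) = A z"
      unfolding z_def p by (simp add: linear_diff[OF lin] linear_sum[OF lin] linear_cmul[OF lin])
    moreover have "norm (A z) \<le> d"
    proof (rule power2_le_imp_le)
      have "(norm (A z))\<^sup>2 \<le> K * inner (A z) z" by (rule norm_sq_le)
      also have "\<dots> \<le> K * (d\<^sup>2 / K * (norm z)\<^sup>2)" by (rule mult_left_mono[OF Az]) (use K in simp)
      also have "\<dots> = d\<^sup>2 * (norm z)\<^sup>2" using K by simp
      also have "\<dots> \<le> d\<^sup>2 * 1" by (rule mult_left_mono[OF z1]) simp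
      finally show "(norm (A z))\<^sup>2 \<le> d\<^sup>2" by simp
    qed (use assms in simp)
    ultimately show "norm (A x - (\<Sum>u\<in>F. inner x u *\<^sub>R A u)) \<le> d" by (simp only:)
  qed
  with C(1) that show ?thesis by blast
qed

lemma compact_closure_image: "compact (closure (A ` cball 0 1))"
  unfolding compact_eq_totally_bounded
proof safe
  show "Topological_Spaces.complete (closure (A ` cball 0 1))"
    by (simp add: complete_eq_closed)
  fix d :: real assume d: "d > 0"
  have "d/4 > 0" using d by simp
  then obtain C where C: "compact C" "\<forall>x. norm x \<le> 1 \<longrightarrow> (\<exists>y\<in>C. norm (A x - y) \<le> d/4)"
    by (rule image_ball_near_compact)
  obtain k where k: "finite k" "C \<subseteq> (\<Union>x\<in>k. ball x (d/2))"
    using C(1) d unfolding compact_eq_totally_bounded by (meson half_gt_zero)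
  \<comment> \<open>Closed balls, because a finite union of them also contains the closure; the
    radius leaves room for open balls of radius \<open>d\<close>.\<close>
  have "A ` cball 0 1 \<subseteq> (\<Union>x\<in>k. cball x (3*d/4))"
  proof safe
    fix x :: 'v assume "x \<in> cball 0 1"
    then obtain y where y: "y \<in> C" "norm (A x - y) \<le> d/4" using C(2) by auto
    then obtain z where z: "z \<in> k" "dist z y < d/2" using k(2) by auto
    have "dist z (A x) \<le> dist z y + dist y (A x)" by (rule dist_triangle)
    also have "\<dots> \<le> d/2 + d/4" using y(2) z(2) by (intro add_mono) (auto simp: dist_norm norm_minus_commute)
    also have "\<dots> = 3*d/4" by simp
    finally show "A x \<in> (\<Union>x\<in>k. cball x (3*d/4))" using z(1) by auto
  qed
  then have "closure (A ` cball 0 1) \<subseteq> (\<Union>x\<in>k. cball x (3*d/4))"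
    using k(1) by (intro closure_minimal) auto
  also have "\<dots> \<subseteq> (\<Union>x\<in>k. ball x d)" using d by (intro UN_mono) (auto simp: subset_iff)
  finally show "\<exists>k. finite k \<and> closure (A ` cball 0 1) \<subseteq> (\<Union>x\<in>k. ball x d)" using k(1) by blast
qed

text \<open>The form has a supremum \<open>m > 0\<close> on the unit sphere of \<open>W\<close>. For
  a maximising sequence, \<open>m *\<^sub>R y n - A (y n)\<close> tends to 0 because
  \<open>m - A\<close> is positive on \<open>W\<close>. Compactness makes \<open>A (y n)\<close>
  converge along a subsequence and, since \<open>m > 0\<close>, so does \<open>y n\<close> itself;
  the limit is the eigenvector.\<close>

lemma exists_eigenvector:
  assumes W: "subspace W" "closed W" "\<And>x. x \<in> W \<Longrightarrow> A x \<in> W"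
    and x: "x \<in> W" "A x \<noteq> 0"
  obtains v a where "v \<in> W" "norm v = 1" "a > 0" "A v = a *\<^sub>R v"
proof -
  define Q where "Q = (\<lambda>x. inner (A x) x) ` {x\<in>W. norm x = 1}"
  define m where "m = Sup Q"
  have bdd: "bdd_above Q"
  proof (rule bdd_aboveI[of _ K])
    fix q assume "q \<in> Q"
    then obtain y where "norm y = 1" "q = inner (A y) y" by (auto simp: Q_def)
    then show "q \<le> K" using form_le[of y] by simp
  qed
  have nx: "norm x > 0" using x(2) linear_0[OF lin] by auto
  let ?u = "(1 / norm x) *\<^sub>R x"
  have "0 < (norm (A x))\<^sup>2" using x by simp
  also have "\<dots> \<le> K * inner (A x) x" by (rule norm_sq_le)
  finally have "inner (A x) x > 0" using K by (simp add: zero_less_mult_iff)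
  then have "inner (A ?u) ?u > 0" using nx by (simp add: linear_cmul[OF lin])
  moreover have "inner (A ?u) ?u \<in> Q"
    unfolding Q_def using x nx W(1) by (intro imageI) (simp add: subspace_scale)
  ultimately have m: "m > 0" and Q0: "Q \<noteq> {}"
    unfolding m_def using cSup_upper[OF _ bdd, of "inner (A ?u) ?u"] by (linarith, blast)
  have mle: "inner (A y) y \<le> m * (norm y)\<^sup>2" if y: "y \<in> W" for y
  proof (cases "y = 0")
    case False
    let ?v = "(1 / norm y) *\<^sub>R y"
    have "inner (A ?v) ?v \<in> Q"
      unfolding Q_def using y False W(1) by (intro imageI) (simp add: subspace_scale)
    then have "inner (A ?v) ?v \<le> m" unfolding m_def by (rule cSup_upper[OF _ bdd])
    then show ?thesis using False by (simp add: linear_cmul[OF lin] field_simps power2_eq_square)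
  qed (simp add: linear_0[OF lin])
  have "\<exists>y\<in>W. norm y = 1 \<and> inner (A y) y > m - 1 / (real n + 1)" for n
  proof -
    have "m - 1 / (real n + 1) < Sup Q" by (simp add: m_def)
    then obtain q where "q \<in> Q" "m - 1 / (real n + 1) < q" using less_cSup_iff[OF Q0 bdd] by blast
    then show ?thesis by (auto simp: Q_def)
  qed
  then obtain y where y: "\<And>n. y n \<in> W" "\<And>n. norm (y n) = 1"
    "\<And>n. inner (A (y n)) (y n) > m - 1 / (real n + 1)" by metis
  have "(norm (m *\<^sub>R y n - A (y n)))\<^sup>2 \<le> m * (1 / (real n + 1))" for n
  proof -
    have "(norm (m *\<^sub>R y n - A (y n)))\<^sup>2 \<le> m * inner (m *\<^sub>R y n - A (y n)) (y n)"
    proof (rule norm_le_positive_form[where W = W and A = "\<lambda>x. m *\<^sub>R x - A x"])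
      show "linear (\<lambda>x. m *\<^sub>R x - A x)"
        by (intro linear_compose_sub linear_compose_scale_right linear_id[unfolded id_def] lin linear_ident)
      show "inner (m *\<^sub>R x - A x) x \<le> m * (norm x)\<^sup>2" for x
        using pos[of x] by (simp add: inner_diff_left dot_square_norm)
      show "m *\<^sub>R x - A x \<in> W" if "x \<in> W" for x
        using that W by (simp add: subspace_diff subspace_scale)
      show "inner (m *\<^sub>R x - A x) z = inner x (m *\<^sub>R z - A z)" for x z
        using selfadjoint[of x z] by (simp add: inner_diff_left inner_diff_right)
      show "0 \<le> inner (m *\<^sub>R x - A x) x" if "x \<in> W" for x
        using mle[OF that] by (simp add: inner_diff_left dot_square_norm)
    qed (use W(1) m y(1) in simp_all)
    also have "\<dots> \<le> m * (1 / (real n + 1))"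
      using m y(2,3)[of n] by (intro mult_left_mono) (auto simp: inner_diff_left dot_square_norm)
    finally show ?thesis .
  qed
  then have nb: "norm (m *\<^sub>R y n - A (y n)) \<le> sqrt (m * (1 / (real n + 1)))" for n
    by (simp add: real_le_rsqrt)
  have "(\<lambda>n. sqrt (m * (1 / (real n + 1)))) \<longlonglongrightarrow> sqrt (m * 0)"
    using LIMSEQ_inverse_real_of_nat by (intro tendsto_intros) (simp add: inverse_eq_divide add.commute)
  then have lim0: "(\<lambda>n. m *\<^sub>R y n - A (y n)) \<longlonglongrightarrow> 0"
    using nb by (intro Lim_null_comparison[of "\<lambda>n. m *\<^sub>R y n - A (y n)"]) auto
  have "A (y n) \<in> closure (A ` cball 0 1)" for n
    using y(2) by (intro subsetD[OF closure_subset] imageI) simp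
  then have "\<exists>l\<in>closure (A ` cball 0 1). \<exists>r. strict_mono r \<and> ((\<lambda>n. A (y n)) \<circ> r) \<longlonglongrightarrow> l"
    by (intro compact_closure_image[unfolded compact_def, rule_format]) auto
  then obtain l r where r: "strict_mono r" "(\<lambda>n. A (y (r n))) \<longlonglongrightarrow> l"
    unfolding comp_def by blast
  have "(\<lambda>n. (m *\<^sub>R y (r n) - A (y (r n))) + A (y (r n))) \<longlonglongrightarrow> 0 + l"
    using LIMSEQ_subseq_LIMSEQ[OF lim0 r(1)] r(2) by (intro tendsto_add) (auto simp: comp_def)
  then have "(\<lambda>n. (1/m) *\<^sub>R (m *\<^sub>R y (r n))) \<longlonglongrightarrow> (1/m) *\<^sub>R l"
    by (intro tendsto_scaleR tendsto_const) simp
  then have yl: "(\<lambda>n. y (r n)) \<longlonglongrightarrow> (1/m) *\<^sub>R l" using m by simp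
  let ?v = "(1/m) *\<^sub>R l"
  have "?v \<in> W" using closed_sequentially[OF W(2) _ yl] y(1) by auto
  moreover have "norm ?v = 1"
    using tendsto_norm[OF yl] unfolding y(2) LIMSEQ_const_iff by (rule sym)
  moreover have "(\<lambda>n. A (y (r n))) \<longlonglongrightarrow> A ?v"
    by (rule bounded_linear.tendsto[OF A yl])
  then have "A ?v = l" using r(2) by (rule LIMSEQ_unique)
  then have "A ?v = m *\<^sub>R ?v" using m by simp
  ultimately show ?thesis using that m by blast
qed

text \<open>For a maximal orthonormal set of eigenvectors with positive eigenvalues, the orthogonal
  complement is closed and invariant. If \<open>A\<close> did not vanish there,
  \<open>exists_eigenvector\<close> would enlarge the set. Zorn's lemma is used because separability
  of the space is not assumed.\<close>

theorem exists_eigensystem: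
  obtains U where "eigensystem A U (\<lambda>u. u) (\<lambda>u. inner (A u) u)" "\<And>u. u \<in> U \<Longrightarrow> inner (A u) u > 0"
proof -
  define \<U> where "\<U> = {U. orthonormal_on U (\<lambda>u. u) \<and> (\<forall>u\<in>U. \<exists>a>0. A u = a *\<^sub>R u)}"
  have "\<exists>M\<in>\<U>. \<forall>X\<in>\<U>. M \<subseteq> X \<longrightarrow> X = M"
  proof (rule subset_Zorn')
    fix C assume C: "subset.chain \<U> C"
    have C\<U>: "C \<subseteq> \<U>" and ch: "\<And>U V. U \<in> C \<Longrightarrow> V \<in> C \<Longrightarrow> U \<subseteq> V \<or> V \<subseteq> U"
      using C unfolding subset_chain_def by blast+
    have "inner u v = (if u = v then 1 else 0)" if uv: "u \<in> \<Union>C" "v \<in> \<Union>C" for u v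
    proof -
      obtain U V where "U \<in> C" "V \<in> C" "u \<in> U" "v \<in> V" using uv by blast
      then obtain U where "U \<in> C" "u \<in> U" "v \<in> U" using ch[of U V] by blast
      then have "orthonormal_on U (\<lambda>u. u)" using C\<U> by (auto simp: \<U>_def)
      then show ?thesis using orthonormal_onD \<open>u \<in> U\<close> \<open>v \<in> U\<close> by fast
    qed
    moreover have "\<exists>a>0. A u = a *\<^sub>R u" if "u \<in> \<Union>C" for u
      using that C\<U> unfolding \<U>_def by blast
    ultimately show "\<Union>C \<in> \<U>" unfolding \<U>_def orthonormal_on_def by simp
  qed
  then obtain U where U: "U \<in> \<U>" and max: "\<And>X. X \<in> \<U> \<Longrightarrow> U \<subseteq> X \<Longrightarrow> X = U" by blast
  have on: "orthonormal_on U (\<lambda>u. u)" using U by (simp add: \<U>_def)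
  have eig: "A u = inner (A u) u *\<^sub>R u" "inner (A u) u > 0" if u: "u \<in> U" for u
  proof -
    obtain a where "a > 0" "A u = a *\<^sub>R u" using U u by (auto simp: \<U>_def)
    moreover have "inner u u = 1" using orthonormal_onD[OF on u u] by simp
    ultimately show "A u = inner (A u) u *\<^sub>R u" "inner (A u) u > 0" by auto
  qed
  define W where "W = {x. \<forall>u\<in>U. inner x u = 0}"
  have "A x = 0" if x: "x \<in> W" for x
  proof (rule ccontr)
    assume "A x \<noteq> 0"
    have 1: "subspace W" unfolding W_def subspace_def by (auto simp: inner_add_left)
    have "W = (\<Inter>u\<in>U. {x. inner x u = 0})" by (auto simp: W_def)
    then have 2: "closed W" by (auto intro!: closed_INT closed_Collect_eq continuous_intros)
    have 3: "A y \<in> W" if "y \<in> W" for y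
      unfolding W_def
    proof safe
      fix u assume u: "u \<in> U"
      have "inner (A y) u = inner y (inner (A u) u *\<^sub>R u)"
        unfolding selfadjoint[of y u] eig(1)[OF u, symmetric] ..
      then show "inner (A y) u = 0" using that u by (simp add: W_def)
    qed
    obtain v a where v: "v \<in> W" "norm v = 1" "a > 0" "A v = a *\<^sub>R v"
      using exists_eigenvector[OF 1 2 3 x \<open>A x \<noteq> 0\<close>] by blast
    have "insert v U \<in> \<U>"
      using U v unfolding \<U>_def orthonormal_on_def W_def by (auto simp: inner_commute norm_eq_1)
    then have "v \<in> U" using max by blast
    then show False using v by (auto simp: W_def)
  qed
  then have "eigensystem A U (\<lambda>u. u) (\<lambda>u. inner (A u) u)"
    unfolding eigensystem_def using on eig by (fastforce simp: W_def)
  with eig(2) that show ?thesis by blast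
qed

end

section \<open>The inclusion of the RKHS\<close>

locale rkhs_in_L2 =
  fixes S :: "'a::euclidean_space set"
    and cls :: "('a \<Rightarrow> real) \<Rightarrow> 'h::{real_inner, banach, second_countable_topology}"
    and k :: "'a \<Rightarrow> 'a \<Rightarrow> real" and \<kappa> :: real
    and eval_at :: "'k::{real_inner, banach} \<Rightarrow> 'a \<Rightarrow> real"
  assumes S: "compact S" and L2: "is_L2 S cls"
    and kernel: "bounded_pd_kernel S k \<kappa>" and rkhs: "is_rkhs S k eval_at"
begin

definition feature :: "'a \<Rightarrow> 'k" where
  "feature x = (SOME kx. (\<forall>y\<in>S. eval_at kx y = k y x) \<and> (\<forall>f. inner f kx = eval_at f x))"

lemma feature:
  assumes "x \<in> S"
  shows "y \<in> S \<Longrightarrow> eval_at (feature x) y = k y x" "inner f (feature x) = eval_at f x"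
proof -
  have "\<exists>kx. (\<forall>y\<in>S. eval_at kx y = k y x) \<and> (\<forall>f. inner f kx = eval_at f x)"
    using rkhs assms by (simp add: is_rkhs_def)
  from someI_ex[OF this]
  show "y \<in> S \<Longrightarrow> eval_at (feature x) y = k y x" "inner f (feature x) = eval_at f x"
    by (simp_all add: feature_def)
qed

lemma norm_feature_le: "x \<in> S \<Longrightarrow> (norm (feature x))\<^sup>2 \<le> \<bar>\<kappa>\<bar>"
  using kernel feature(1)[of x x] feature(2)[of x "feature x"]
  unfolding power2_norm_eq_inner bounded_pd_kernel_def by force

text \<open>The elements with a measurable evaluation form a closed subspace, since norm convergence
  implies pointwise convergence, and it contains every \<open>feature x\<close> by measurability of
  the kernel. What is orthogonal to this subspace evaluates to 0 on \<open>S\<close>, hence is 0, so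
  the subspace is everything.\<close>

lemma eval_at_measurable: "eval_at f \<in> borel_measurable (lebesgue_on S)"
proof -
  define V where "V = {f. (\<lambda>x. inner f (feature x)) \<in> borel_measurable (lebesgue_on S)}"
  have V_iff: "f \<in> V \<longleftrightarrow> eval_at f \<in> borel_measurable (lebesgue_on S)" for f
    unfolding V_def mem_Collect_eq by (rule measurable_cong) (simp add: feature)
  have "subspace V" unfolding subspace_def V_def by (auto simp: inner_add_left)
  moreover have "closed V"
    unfolding closed_sequential_limits
  proof safe
    fix F l assume F: "\<forall>n. F n \<in> V" "F \<longlonglongrightarrow> l"
    have "(\<lambda>x. inner l (feature x)) \<in> borel_measurable (lebesgue_on S)"
    proof (rule borel_measurable_LIMSEQ_real)
      show "(\<lambda>n. inner (F n) (feature x)) \<longlonglongrightarrow> inner l (feature x)" for x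
        by (intro tendsto_inner F(2) tendsto_const)
      show "(\<lambda>x. inner (F n) (feature x)) \<in> borel_measurable (lebesgue_on S)" for n
        using F(1) by (simp add: V_def)
    qed
    then show "l \<in> V" by (simp add: V_def)
  qed
  ultimately obtain p where p: "p \<in> V" "\<And>z. z \<in> V \<Longrightarrow> inner (f - p) z = 0"
    using closed_subspace_projection by blast
  have fV: "feature x \<in> V" if x: "x \<in> S" for x
  proof -
    have "(\<lambda>(x, y). k x y) \<in> borel_measurable (lebesgue_on S \<Otimes>\<^sub>M lebesgue_on S)"
      using kernel by (simp add: bounded_pd_kernel_def)
    from measurable_compose[OF measurable_Pair1' this, of x]
    have "(\<lambda>y. k x y) \<in> borel_measurable (lebesgue_on S)" using x by simp
    moreover have "k x y = eval_at (feature x) y" if "y \<in> S" for y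
      using kernel x that feature[OF x] by (simp add: bounded_pd_kernel_def)
    ultimately show ?thesis
      unfolding V_iff by (subst measurable_cong[where g = "k x"]) simp_all
  qed
  have "eval_at (f - p) x = eval_at 0 x" if "x \<in> S" for x
    using p(2)[OF fV[OF that]] by (simp add: feature(2)[OF that, symmetric])
  then have "f - p = 0" using rkhs unfolding is_rkhs_def by blast
  with p(1) show ?thesis unfolding V_iff by simp
qed

sublocale finite_measure "lebesgue_on S"
  using S by (intro finite_measure_lebesgue_on lmeasurable_compact)

lemma eval_at_sq_integrable: "eval_at f \<in> sq_integrable S"
proof -
  have "(eval_at f x)\<^sup>2 \<le> (norm f)\<^sup>2 * \<bar>\<kappa>\<bar>" if "x \<in> S" for x
  proof -
    have "(eval_at f x)\<^sup>2 = (inner f (feature x))\<^sup>2" by (simp add: feature[OF that])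
    also have "\<dots> \<le> (norm f)\<^sup>2 * (norm (feature x))\<^sup>2"
      unfolding power2_norm_eq_inner by (rule Cauchy_Schwarz_ineq)
    also have "\<dots> \<le> (norm f)\<^sup>2 * \<bar>\<kappa>\<bar>" by (intro mult_left_mono norm_feature_le that) auto
    finally show ?thesis .
  qed
  then have "integrable (lebesgue_on S) (\<lambda>x. (eval_at f x)\<^sup>2)"
    using eval_at_measurable[of f]
    by (intro integrable_const_bound[where B = "(norm f)\<^sup>2 * \<bar>\<kappa>\<bar>"]) auto
  then show ?thesis using eval_at_measurable by (simp add: sq_integrable_def)
qed

lemma linear_incl: "linear (incl cls eval_at)"
proof (rule linearI)
  fix f g :: 'k and c :: real
  have "cls (eval_at (f + g)) = cls (\<lambda>x. eval_at f x + eval_at g x)"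
  proof (subst is_L2_cls_eq_iff[OF L2])
    show "AE x in lebesgue_on S. eval_at (f + g) x = eval_at f x + eval_at g x"
      by (intro AE_I2) (simp add: feature(2)[symmetric] inner_add_left)
  qed (intro sq_integrable_add eval_at_sq_integrable)+
  then show "incl cls eval_at (f + g) = incl cls eval_at f + incl cls eval_at g"
    unfolding incl_def using is_L2_cls_add[OF L2 eval_at_sq_integrable eval_at_sq_integrable] by simp
  have "cls (eval_at (c *\<^sub>R f)) = cls (\<lambda>x. c * eval_at f x)"
  proof (subst is_L2_cls_eq_iff[OF L2])
    show "AE x in lebesgue_on S. eval_at (c *\<^sub>R f) x = c * eval_at f x"
      by (intro AE_I2) (simp add: feature(2)[symmetric])
  qed (intro sq_integrable_scale eval_at_sq_integrable)+
  then show "incl cls eval_at (c *\<^sub>R f) = c *\<^sub>R incl cls eval_at f"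
    unfolding incl_def using is_L2_cls_scale[OF L2 eval_at_sq_integrable] by simp
qed

lemma norm_incl: "(norm (incl cls eval_at f))\<^sup>2 = (\<integral>x. (eval_at f x)\<^sup>2 \<partial>lebesgue_on S)"
  using L2 eval_at_sq_integrable
  unfolding power2_norm_eq_inner incl_def is_L2_def by (simp add: power2_eq_square)

text \<open>At a fixed point \<open>x\<close> the values \<open>eval_at (e i) x\<close> are the
  coefficients of \<open>feature x\<close>, so Bessel's inequality bounds their squares by the
  kernel diagonal, uniformly in \<open>x\<close>. Integration over \<open>S\<close> gives the
  claim.\<close>

lemma incl_hilbert_schmidt:
  assumes "finite F" "orthonormal_on F e"
  shows "(\<Sum>i\<in>F. (norm (incl cls eval_at (e i)))\<^sup>2) \<le> \<bar>\<kappa>\<bar> * measure (lebesgue_on S) S"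
proof -
  have int: "integrable (lebesgue_on S) (\<lambda>x. (eval_at f x)\<^sup>2)" for f
    using eval_at_sq_integrable by (simp add: sq_integrable_def)
  have "(\<Sum>i\<in>F. (norm (incl cls eval_at (e i)))\<^sup>2) = (\<integral>x. (\<Sum>i\<in>F. (eval_at (e i) x)\<^sup>2) \<partial>lebesgue_on S)"
    unfolding norm_incl using int by (subst Bochner_Integration.integral_sum) auto
  also have "\<dots> \<le> (\<integral>x. \<bar>\<kappa>\<bar> \<partial>lebesgue_on S)"
  proof (rule integral_mono)
    fix x assume "x \<in> space (lebesgue_on S)"
    then have x: "x \<in> S" by simp
    have "(\<Sum>i\<in>F. (eval_at (e i) x)\<^sup>2) = (\<Sum>i\<in>F. (inner (feature x) (e i))\<^sup>2)"
      by (simp add: feature[OF x, symmetric] inner_commute)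
    also have "\<dots> \<le> (norm (feature x))\<^sup>2" by (rule bessel_finite[OF assms(2,1)]) simp
    also have "\<dots> \<le> \<bar>\<kappa>\<bar>" by (rule norm_feature_le[OF x])
    finally show "(\<Sum>i\<in>F. (eval_at (e i) x)\<^sup>2) \<le> \<bar>\<kappa>\<bar>" .
  qed (auto intro: int)
  also have "\<dots> = \<bar>\<kappa>\<bar> * measure (lebesgue_on S) S" by simp
  finally show ?thesis .
qed

lemma bounded_linear_incl: "bounded_linear (incl cls eval_at)"
proof -
  let ?K = "\<bar>\<kappa>\<bar> * measure (lebesgue_on S) S"
  have "norm (incl cls eval_at f) \<le> norm f * sqrt ?K" for f
  proof (cases "f = 0")
    case False
    define u where "u = (1 / norm f) *\<^sub>R f"
    have "(norm (incl cls eval_at u))\<^sup>2 \<le> ?K"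
      using incl_hilbert_schmidt[of "{()}" "\<lambda>_. u"] False
      by (simp add: orthonormal_on_def u_def dot_square_norm power2_eq_square)
    then have "norm (incl cls eval_at u) \<le> sqrt ?K" by (rule real_le_rsqrt)
    then show ?thesis using False by (simp add: u_def linear_cmul[OF linear_incl] field_simps)
  qed (simp add: linear_0[OF linear_incl])
  then show ?thesis
    by (intro bounded_linear_intro[where K = "sqrt ?K"]) (auto simp: linear_add linear_cmul linear_incl)
qed

lemma positive_trace_class_incl:
  "positive_trace_class (\<lambda>x. adjoint (incl cls eval_at) (incl cls eval_at x))
     (\<bar>\<kappa>\<bar> * measure (lebesgue_on S) S + 1)"
proof (rule positive_trace_class.intro)
  let ?J = "incl cls eval_at"
  note J = bounded_linear_incl
  show "bounded_linear (\<lambda>x. adjoint ?J (?J x))"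
    by (rule bounded_linear_compose[OF bounded_linear_adjoint[OF J] J])
  have eq: "inner (adjoint ?J (?J x)) y = inner (?J x) (?J y)" for x y
    by (metis inner_adjoint[OF J] inner_commute)
  show "inner (adjoint ?J (?J x)) y = inner x (adjoint ?J (?J y))" for x y
    by (simp add: eq inner_adjoint[OF J, symmetric])
  show "0 \<le> inner (adjoint ?J (?J x)) x" for x by (simp add: eq)
  show "(\<Sum>u\<in>F. inner (adjoint ?J (?J u)) u) \<le> \<bar>\<kappa>\<bar> * measure (lebesgue_on S) S + 1"
    if "finite F" "orthonormal_on F (\<lambda>u. u)" for F
    using incl_hilbert_schmidt[OF that] by (simp add: eq power2_norm_eq_inner)
  show "0 < \<bar>\<kappa>\<bar> * measure (lebesgue_on S) S + 1"
    by (intro add_nonneg_pos mult_nonneg_nonneg) auto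
qed

end

section \<open>The square root of \<open>T_op J\<close> and the transfer of the source condition to
  the RKHS\<close>

lemma diag_op_diag_op:
  fixes e :: "'i \<Rightarrow> 'v::{real_inner, banach}"
  assumes "orthonormal_on I e" "\<And>i. i \<in> I \<Longrightarrow> \<bar>d i\<bar> \<le> K"
  shows "diag_op I e c (diag_op I e d x) = diag_op I e (\<lambda>i. c i * d i) x"
  unfolding diag_op_def[of I e c] diag_op_def[of I e "\<lambda>i. c i * d i"]
  by (rule infsum_cong) (simp add: inner_diag_op_basis[OF assms])

locale compact_inclusion =
  fixes J :: "'k::{real_inner, banach} \<Rightarrow> 'h::{real_inner, banach}" and K :: real
  assumes J: "bounded_linear J" and JJ: "positive_trace_class (\<lambda>x. adjoint J (J x)) K"
begin

lemma inner_adjoint': "inner (adjoint J y) x = inner y (J x)"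
  using inner_adjoint[OF J, of x y] by (simp add: inner_commute)

text \<open>Singular value decomposition: the eigenvectors of \<open>J\<^sup>* J\<close>, for which
  the trace bound is known, are mapped by \<open>J\<close> to eigenvectors of
  \<open>J J\<^sup>*\<close> and only need rescaling. Completeness holds since
  \<open>J\<^sup>* J J\<^sup>* x = 0\<close> forces \<open>J J\<^sup>* x = 0\<close>.\<close>

lemma T_op_eigensystem:
  obtains U :: "'k set" and e t where "eigensystem (T_op J) U e t" "\<forall>u\<in>U. t u > 0"
proof -
  obtain U where U: "eigensystem (\<lambda>x. adjoint J (J x)) U (\<lambda>u. u) (\<lambda>u. inner (adjoint J (J u)) u)"
    and t0: "\<And>u. u \<in> U \<Longrightarrow> inner (adjoint J (J u)) u > 0"
    using positive_trace_class.exists_eigensystem[OF JJ] by blast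
  define t where "t u = inner (adjoint J (J u)) u" for u
  define e where "e u = (1 / sqrt (t u)) *\<^sub>R J u" for u
  note linJ = bounded_linear.linear[OF J]
  have t: "t u > 0" if "u \<in> U" for u using t0[OF that] by (simp add: t_def)
  have JJu: "adjoint J (J u) = t u *\<^sub>R u" if "u \<in> U" for u
    using U that by (simp add: eigensystem_def t_def)
  have on: "orthonormal_on U (\<lambda>u. u)" using U by (simp add: eigensystem_def)
  have "orthonormal_on U e"
    unfolding orthonormal_on_def
  proof safe
    fix u v assume uv: "u \<in> U" "v \<in> U"
    have "inner (J u) (J v) = t u * inner u v"
      using inner_adjoint'[of "J u" v] JJu[OF uv(1)] by simp
    then show "inner (e u) (e v) = (if u = v then 1 else 0)"
      using orthonormal_onD[OF on uv] t[OF uv(1)] by (auto simp: e_def)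
  qed
  moreover have "T_op J (e u) = t u *\<^sub>R e u" if "u \<in> U" for u
    using JJu[OF that] unfolding T_op_def e_def
    by (simp add: linear_cmul[OF linJ] linear_cmul[OF bounded_linear.linear[OF bounded_linear_adjoint[OF J]]])
  moreover have "T_op J x = 0" if x: "\<forall>u\<in>U. inner x (e u) = 0" for x
  proof -
    have "inner (adjoint J x) u = 0" if "u \<in> U" for u
      using x that t[OF that] by (auto simp: inner_adjoint' e_def)
    then have "adjoint J (J (adjoint J x)) = 0" using U by (simp add: eigensystem_def)
    then have "inner (J (adjoint J x)) (J (adjoint J x)) = 0"
      using inner_adjoint'[of "J (adjoint J x)" "adjoint J x"] by simp
    then show ?thesis by (simp add: T_op_def)
  qed
  ultimately have "eigensystem (T_op J) U e t"
    using t unfolding eigensystem_def by (metis less_irrefl)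
  with t that show ?thesis by blast
qed

lemma bounded_linear_T_op: "bounded_linear (T_op J)"
  unfolding T_op_def comp_def by (rule bounded_linear_compose[OF J bounded_linear_adjoint[OF J]])

lemma T_half:
  shows bounded_linear_T_half: "bounded_linear (T_half J)"
    and T_half_commute: "inner (T_half J x) y = inner x (T_half J y)"
    and T_half_T_half: "T_half J (T_half J x) = J (adjoint J x)"
proof -
  obtain U :: "'k set" and e t where U: "eigensystem (T_op J) U e t" and t: "\<forall>u\<in>U. t u > 0"
    by (rule T_op_eigensystem)
  have on: "orthonormal_on U e" using U by (simp add: eigensystem_def)
  have tle: "\<bar>t u\<bar> \<le> onorm (T_op J)" if "u \<in> U" for u
    using eigensystem_eigenvalue_le[OF bounded_linear_T_op U that] .
  have sle: "\<bar>sqrt (t u)\<bar> \<le> sqrt (onorm (T_op J))" if "u \<in> U" for u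
    using tle[OF that] t that by (auto simp: less_imp_le)
  \<comment> \<open>The kernel term of the functional calculus drops out because
    \<open>sqrt 0 = 0\<close>.\<close>
  have eq: "T_half J = diag_op U e (\<lambda>u. sqrt (t u))"
    unfolding T_half_def
    by (rule ext, subst op_fun_eigensystem[where f = sqrt, OF bounded_linear_T_op U sle]) simp_all
  show "bounded_linear (T_half J)"
    unfolding eq by (rule bounded_linear_diag_op[OF on sle])
  show "inner (T_half J x) y = inner x (T_half J y)"
    unfolding eq by (rule inner_diag_op_commute[OF on sle])
  have "T_half J (T_half J x) = diag_op U e (\<lambda>u. sqrt (t u) * sqrt (t u)) x"
    unfolding eq by (rule diag_op_diag_op[OF on sle])
  also have "\<dots> = diag_op U e t x"
    unfolding diag_op_def using t by (intro infsum_cong) (simp add: less_imp_le)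
  also have "\<dots> = J (adjoint J x)"
    using eigensystem_diag[OF bounded_linear_T_op U, of x] by (simp add: T_op_def)
  finally show "T_half J (T_half J x) = J (adjoint J x)" .
qed

end

locale preconditioned_covariance = compact_inclusion J K
    for J :: "'k::{real_inner, banach} \<Rightarrow> 'h::{real_inner, banach}" and K +
  fixes C :: "'h \<Rightarrow> 'h" and \<tau> :: "nat \<Rightarrow> real" and e :: "nat \<Rightarrow> 'h"
  assumes C: "bounded_linear C"
    and C_commute: "\<And>x y. inner (C x) y = inner x (C y)"
    and C_pos: "\<And>x. 0 \<le> inner (C x) x"
    and C_kernel: "\<And>x. inner (C x) x = 0 \<Longrightarrow> C x = 0"
    and ep: "eigensystem (T_half J \<circ> C \<circ> T_half J) {1..} e \<tau>"
    and \<tau>_pos: "\<And>i. i \<ge> 1 \<Longrightarrow> \<tau> i > 0"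
begin

text \<open>The preimage of \<open>T_half J (e i)\<close> under \<open>J\<close>, written without an
  inverse: \<open>J J\<^sup>*\<close> is the square of \<open>T_half J\<close>, so one factor of it
  completes \<open>C (T_half J (e i))\<close> to the eigenvalue equation and the other
  remains.\<close>

definition \<phi> :: "nat \<Rightarrow> 'k" where
  "\<phi> i = (1 / \<tau> i) *\<^sub>R adjoint J (C (T_half J (e i)))"

lemma e_on: "orthonormal_on {1..} e" using ep by (simp add: eigensystem_def)

lemma e_eig: "i \<ge> 1 \<Longrightarrow> T_half J (C (T_half J (e i))) = \<tau> i *\<^sub>R e i"
  using ep by (simp add: eigensystem_def)

lemma J_\<phi>: "i \<ge> 1 \<Longrightarrow> J (\<phi> i) = T_half J (e i)"
proof -
  assume i: "i \<ge> 1"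
  have "J (\<phi> i) = (1 / \<tau> i) *\<^sub>R T_half J (T_half J (C (T_half J (e i))))"
    by (simp add: \<phi>_def linear_cmul[OF bounded_linear.linear[OF J]] T_half_T_half)
  also have "\<dots> = T_half J (e i)"
    using \<tau>_pos[OF i] by (simp add: e_eig[OF i] linear_cmul[OF bounded_linear.linear[OF bounded_linear_T_half]])
  finally show ?thesis .
qed

lemma A_\<phi>: "i \<ge> 1 \<Longrightarrow> adjoint J (C (J (\<phi> i))) = \<tau> i *\<^sub>R \<phi> i"
  using \<tau>_pos[of i] by (simp add: J_\<phi>) (simp add: \<phi>_def)

text \<open>The number \<open>inner (C (J (\<phi> i))) (J (\<phi> j))\<close> is
  \<open>\<tau> i\<close> times the Gram entry of the \<open>\<phi>\<close> and also
  \<open>\<tau> i\<close> times that of the \<open>e\<close>.\<close>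

lemma \<phi>_on: "orthonormal_on {1..} \<phi>"
  unfolding orthonormal_on_def
proof (intro ballI)
  fix i j :: nat assume "i \<in> {1..}" "j \<in> {1..}"
  then have i: "i \<ge> 1" and j: "j \<ge> 1" by auto
  have "\<tau> i * inner (\<phi> i) (\<phi> j) = inner (C (J (\<phi> i))) (J (\<phi> j))"
    unfolding inner_adjoint'[symmetric] A_\<phi>[OF i] by simp
  also have "\<dots> = inner (T_half J (C (T_half J (e i)))) (e j)"
    unfolding J_\<phi>[OF i] J_\<phi>[OF j] by (simp add: T_half_commute)
  also have "\<dots> = \<tau> i * inner (e i) (e j)" by (simp add: e_eig[OF i])
  finally show "inner (\<phi> i) (\<phi> j) = (if i = j then 1 else 0)"
    using \<tau>_pos[OF i] orthonormal_onD[OF e_on, of i j] i j by simp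
qed

text \<open>The vector \<open>?w\<close> is orthogonal to all \<open>e i\<close>, hence killed by
  \<open>T_half J \<circ> C \<circ> T_half J\<close>; positivity of \<open>C\<close> then gives
  \<open>C (T_half J ?w) = 0\<close>, and moving operators across the inner product gives
  \<open>?w = 0\<close>. The conclusion is stated for \<open>C\<close> itself because it is needed
  later to see that \<open>X\<close> is almost surely orthogonal to \<open>J x\<close>.\<close>

lemma A_kernel:
  assumes x: "\<forall>i\<in>{1..}. inner x (\<phi> i) = 0"
  shows "C (J x) = 0"
proof -
  let ?w = "T_half J (C (J x))"
  have "inner ?w (e i) = 0" if i: "i \<in> {1..}" for i
  proof -
    have "inner ?w (e i) = inner x (adjoint J (C (J (\<phi> i))))"
      using i by (simp add: T_half_commute C_commute J_\<phi> inner_adjoint[OF J, symmetric])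
    then show ?thesis using x i by (simp add: A_\<phi>)
  qed
  then have "T_half J (C (T_half J ?w)) = 0" using ep by (simp add: eigensystem_def)
  then have "inner (T_half J (C (T_half J ?w))) ?w = 0" by simp
  then have "inner (C (T_half J ?w)) (T_half J ?w) = 0" by (simp add: T_half_commute)
  then have "C (T_half J ?w) = 0" by (rule C_kernel)
  then have "inner (C (T_half J ?w)) (J x) = 0" by simp
  then have "inner (T_half J ?w) (C (J x)) = 0" by (simp add: C_commute)
  then have "inner ?w ?w = 0" using T_half_commute[of ?w "C (J x)"] by (simp only:)
  then have w: "?w = 0" by simp
  have "J (adjoint J (C (J x))) = 0"
    using w linear_0[OF bounded_linear.linear[OF bounded_linear_T_half]] by (simp add: T_half_T_half[symmetric])
  then have "inner (adjoint J (C (J x))) (adjoint J (C (J x))) = 0"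
    by (simp add: inner_adjoint')
  then have "adjoint J (C (J x)) = 0" by simp
  then have "inner (C (J x)) (J x) = 0" by (metis inner_adjoint' inner_zero_left)
  then show ?thesis by (rule C_kernel)
qed

lemma eigensystem_A: "eigensystem (\<lambda>x. adjoint J (C (J x))) {1..} \<phi> \<tau>"
  unfolding eigensystem_def
proof (intro conjI ballI allI impI)
  show "orthonormal_on {1..} \<phi>" by (rule \<phi>_on)
  show "\<tau> i \<noteq> 0" if "i \<in> {1..}" for i using \<tau>_pos[of i] that by simp
  show "adjoint J (C (J (\<phi> i))) = \<tau> i *\<^sub>R \<phi> i" if "i \<in> {1..}" for i
    using A_\<phi>[of i] that by simp
  show "adjoint J (C (J x)) = 0" if "\<forall>i\<in>{1..}. inner x (\<phi> i) = 0" for x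
    using A_kernel[OF that] linear_0[OF bounded_linear.linear[OF bounded_linear_adjoint[OF J]]] by simp
qed

lemma bounded_linear_TCT: "bounded_linear (T_half J \<circ> C \<circ> T_half J)"
  unfolding comp_def
  by (rule bounded_linear_compose[OF bounded_linear_T_half bounded_linear_compose[OF C bounded_linear_T_half]])

text \<open>Since \<open>J\<close> maps \<open>\<phi> i\<close> to \<open>T_half J (e i)\<close>,
  keeping the coefficients of the series for the power of the operator and replacing
  \<open>e i\<close> by \<open>\<phi> i\<close> yields the preimage. The new series converges
  because the coefficients are square summable.\<close>

lemma source_element:
  assumes s: "s > 0"
  obtains f where "J f = T_half J (op_fun (\<lambda>t. t powr s) (T_half J \<circ> C \<circ> T_half J) h)"
    "((\<lambda>i. (\<tau> i powr s * inner h (e i)) *\<^sub>R \<phi> i) has_sum f) {1..}"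
proof -
  let ?\<Lambda> = "T_half J \<circ> C \<circ> T_half J" and ?c = "\<lambda>i. \<tau> i powr s * inner h (e i)"
  have \<tau>_le: "\<bar>\<tau> i powr s\<bar> \<le> onorm ?\<Lambda> powr s" if "i \<in> {1..}" for i
    using eigensystem_eigenvalue_le[OF bounded_linear_TCT ep that] \<tau>_pos[of i] that s
    by (simp add: powr_mono2)
  \<comment> \<open>No kernel term is left, because \<open>0 powr s = 0\<close>.\<close>
  have eq: "op_fun (\<lambda>t. t powr s) ?\<Lambda> h = diag_op {1..} e (\<lambda>i. \<tau> i powr s) h"
    by (subst op_fun_eigensystem[where f = "\<lambda>t. t powr s", OF bounded_linear_TCT ep \<tau>_le]) simp_all
  have "(\<lambda>i. ?c i *\<^sub>R \<phi> i) summable_on {1..}"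
    by (rule orthonormal_series_summable[OF \<phi>_on diag_op_summable_coeff[OF e_on \<tau>_le]])
  then obtain f where f: "((\<lambda>i. ?c i *\<^sub>R \<phi> i) has_sum f) {1..}" unfolding summable_on_def by blast
  have 1: "((\<lambda>i. J (?c i *\<^sub>R \<phi> i)) has_sum J f) {1..}" by (rule has_sum_bounded_linear[OF J f])
  have 2: "((\<lambda>i. T_half J (?c i *\<^sub>R e i)) has_sum T_half J (diag_op {1..} e (\<lambda>i. \<tau> i powr s) h)) {1..}"
    by (rule has_sum_bounded_linear[OF bounded_linear_T_half diag_op_has_sum[OF e_on \<tau>_le]])
  have "J (?c i *\<^sub>R \<phi> i) = T_half J (?c i *\<^sub>R e i)" if "i \<in> {1..}" for i
    using that J_\<phi>[of i]
    by (simp add: linear_cmul[OF bounded_linear.linear[OF J]] linear_cmul[OF bounded_linear.linear[OF bounded_linear_T_half]])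
  then have "((\<lambda>i. T_half J (?c i *\<^sub>R e i)) has_sum J f) {1..}"
    using 1 by (subst (asm) has_sum_cong) auto
  then have "J f = T_half J (diag_op {1..} e (\<lambda>i. \<tau> i powr s) h)"
    using 2 by (rule has_sum_unique)
  then show ?thesis by (intro that[OF _ f]) (simp add: eq)
qed

end

section \<open>Functions of a perturbed operator\<close>

lemma has_sum_norm_le:
  fixes f :: "'i \<Rightarrow> 'v::real_normed_vector"
  assumes "(f has_sum s) I" "\<And>F. finite F \<Longrightarrow> F \<subseteq> I \<Longrightarrow> norm (sum f F) \<le> c"
  shows "norm s \<le> c"
proof (rule tendsto_upperbound)
  show "((\<lambda>F. norm (sum f F)) \<longlongrightarrow> norm s) (finite_subsets_at_top I)"
    using assms(1) unfolding has_sum_def by (rule tendsto_norm)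
  show "\<forall>\<^sub>F F in finite_subsets_at_top I. norm (sum f F) \<le> c"
    using assms(2) by (intro eventually_finite_subsets_at_top_weakI) auto
qed simp

lemma power2_le_mult_self_imp_le:
  fixes x c :: real
  assumes "x\<^sup>2 \<le> c * x" "0 \<le> x" "0 \<le> c"
  shows "x \<le> c"
  using assms by (cases "x = 0") (auto simp: power2_eq_square)

text \<open>With a shifted eigenvalue as \<open>p i\<close>, this is the pairing of (A + l)^(-1/2) w
  with (A + l)^(1/2) y in coordinates, so that neither operator has to be constructed.\<close>

lemma cauchy_schwarz_weighted:
  fixes a y p :: "'i \<Rightarrow> real"
  assumes p: "\<And>i. i \<in> F \<Longrightarrow> p i > 0" and q: "0 \<le> q" and v: "0 \<le> v"
    and a: "(\<Sum>i\<in>F. (a i)\<^sup>2 / p i) \<le> q\<^sup>2" and y: "(\<Sum>i\<in>F. p i * (y i)\<^sup>2) \<le> v\<^sup>2"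
  shows "\<bar>\<Sum>i\<in>F. a i * y i\<bar> \<le> q * v"
proof -
  have "(\<Sum>i\<in>F. a i * y i) = (\<Sum>i\<in>F. (a i / sqrt (p i)) * (sqrt (p i) * y i))"
    using p by (intro sum.cong) force+
  then have "(\<Sum>i\<in>F. a i * y i)\<^sup>2 \<le> (\<Sum>i\<in>F. (a i / sqrt (p i))\<^sup>2) * (\<Sum>i\<in>F. (sqrt (p i) * y i)\<^sup>2)"
    using Cauchy_Schwarz_ineq_sum by metis
  also have "(\<Sum>i\<in>F. (a i / sqrt (p i))\<^sup>2) = (\<Sum>i\<in>F. (a i)\<^sup>2 / p i)"
    using p by (intro sum.cong) (auto simp: power_divide less_imp_le)
  also have "(\<Sum>i\<in>F. (sqrt (p i) * y i)\<^sup>2) = (\<Sum>i\<in>F. p i * (y i)\<^sup>2)"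
    using p by (intro sum.cong) (auto simp: power_mult_distrib less_imp_le)
  also have "(\<Sum>i\<in>F. (a i)\<^sup>2 / p i) * (\<Sum>i\<in>F. p i * (y i)\<^sup>2) \<le> q\<^sup>2 * v\<^sup>2"
  proof (intro mult_mono[OF a y])
    show "0 \<le> (\<Sum>i\<in>F. p i * (y i)\<^sup>2)" using p by (intro sum_nonneg) (simp add: less_imp_le)
  qed simp
  finally have "\<bar>\<Sum>i\<in>F. a i * y i\<bar>\<^sup>2 \<le> (q * v)\<^sup>2" by (simp add: power_mult_distrib)
  then show ?thesis by (rule power2_le_imp_le) (use q v in simp)
qed

lemma has_sum_sum:
  fixes f :: "'j \<Rightarrow> 'i \<Rightarrow> 'v::topological_comm_monoid_add"
  assumes "\<And>j. j \<in> F \<Longrightarrow> (f j has_sum s j) I"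
  shows "((\<lambda>i. \<Sum>j\<in>F. f j i) has_sum (\<Sum>j\<in>F. s j)) I"
  using assms by (induction F rule: infinite_finite_induct) (auto intro: has_sum_add)

section \<open>Calculus rules for functions of one operator\<close>

locale spectral_calculus =
  fixes B :: "'k::{real_inner, banach} \<Rightarrow> 'k" and U :: "'u set" and u :: "'u \<Rightarrow> 'k" and b :: "'u \<Rightarrow> real"
  assumes B: "bounded_linear B" and esB: "eigensystem B U u b"
    and b_pos: "\<And>v. v \<in> U \<Longrightarrow> b v > 0"
begin

text \<open>By \<open>op_fun_eigensystem\<close> this is \<open>op_fun f B\<close> whenever
  \<open>f\<close> is bounded on the eigenvalues. Written in eigenvectors, it allows the rules below
  to be checked coefficient by coefficient.\<close>

definition spec_fun :: "(real \<Rightarrow> real) \<Rightarrow> 'k \<Rightarrow> 'k" where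
  "spec_fun f x = diag_op U u (\<lambda>v. f (b v)) x + f 0 *\<^sub>R (x - proj_op U u x)"

definition bdd_on_spec :: "(real \<Rightarrow> real) \<Rightarrow> bool" where
  "bdd_on_spec f \<longleftrightarrow> (\<exists>K. \<forall>v\<in>U. \<bar>f (b v)\<bar> \<le> K)"

lemma u_on: "orthonormal_on U u" using esB by (simp add: eigensystem_def)

lemma bdd_on_spec_id: "bdd_on_spec (\<lambda>s. s)"
  unfolding bdd_on_spec_def using eigensystem_eigenvalue_le[OF B esB] by blast

lemma bdd_on_spec_const: "bdd_on_spec (\<lambda>s. c)"
  unfolding bdd_on_spec_def by blast

lemma bdd_on_spec_diff:
  assumes "bdd_on_spec f" "bdd_on_spec g"
  shows "bdd_on_spec (\<lambda>s. f s - g s)"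
proof -
  obtain K L where "\<forall>v\<in>U. \<bar>f (b v)\<bar> \<le> K" "\<forall>v\<in>U. \<bar>g (b v)\<bar> \<le> L"
    using assms unfolding bdd_on_spec_def by blast
  then have "\<forall>v\<in>U. \<bar>f (b v) - g (b v)\<bar> \<le> K + L" by (smt (verit, best))
  then show ?thesis unfolding bdd_on_spec_def by blast
qed

lemma bdd_on_spec_mult:
  assumes "bdd_on_spec f" "bdd_on_spec g"
  shows "bdd_on_spec (\<lambda>s. f s * g s)"
proof -
  obtain K L where "\<forall>v\<in>U. \<bar>f (b v)\<bar> \<le> K" "\<forall>v\<in>U. \<bar>g (b v)\<bar> \<le> L"
    using assms unfolding bdd_on_spec_def by blast
  then have "\<forall>v\<in>U. \<bar>f (b v) * g (b v)\<bar> \<le> K * L"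
    unfolding abs_mult by (meson abs_ge_zero mult_mono order_trans)
  then show ?thesis unfolding bdd_on_spec_def by blast
qed

lemma inner_spec_fun:
  assumes f: "bdd_on_spec f" and v: "v \<in> U"
  shows "inner (spec_fun f x) (u v) = f (b v) * inner x (u v)"
proof -
  obtain K where K: "\<And>v. v \<in> U \<Longrightarrow> \<bar>f (b v)\<bar> \<le> K" using f unfolding bdd_on_spec_def by blast
  show ?thesis
    using inner_diag_op_basis[where c = "\<lambda>v. f (b v)", OF u_on K v, of x] proj_op_residual[OF u_on v, of x]
    by (simp add: spec_fun_def inner_add_left)
qed

lemma proj_spec_fun:
  assumes f: "bdd_on_spec f"
  shows "proj_op U u (spec_fun f x) = diag_op U u (\<lambda>v. f (b v)) x"
  unfolding diag_op_def[of U u] by (rule infsum_cong) (simp add: inner_spec_fun[OF f])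

lemma norm_spec_fun:
  assumes f: "bdd_on_spec f"
  shows "((\<lambda>v. (f (b v))\<^sup>2 * (inner x (u v))\<^sup>2) has_sum
           ((norm (spec_fun f x))\<^sup>2 - (f 0)\<^sup>2 * (norm (x - proj_op U u x))\<^sup>2)) U"
proof -
  obtain K where K: "\<And>v. v \<in> U \<Longrightarrow> \<bar>f (b v)\<bar> \<le> K" using f unfolding bdd_on_spec_def by blast
  have "spec_fun f x - proj_op U u (spec_fun f x) = f 0 *\<^sub>R (x - proj_op U u x)"
    unfolding proj_spec_fun[OF f] by (simp add: spec_fun_def)
  then have "(norm (spec_fun f x))\<^sup>2 = (norm (diag_op U u (\<lambda>v. f (b v)) x))\<^sup>2
      + (norm (f 0 *\<^sub>R (x - proj_op U u x)))\<^sup>2"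
    using norm_residual_sq[OF u_on, of "spec_fun f x"] unfolding proj_spec_fun[OF f] by simp
  then have "(norm (spec_fun f x))\<^sup>2 - (f 0)\<^sup>2 * (norm (x - proj_op U u x))\<^sup>2
      = (norm (diag_op U u (\<lambda>v. f (b v)) x))\<^sup>2"
    by (simp add: power_mult_distrib)
  then show ?thesis using norm_diag_op_has_sum[where c = "\<lambda>v. f (b v)", OF u_on K] by simp
qed

text \<open>Comparison of squared coefficients, including the one on the kernel. Applied to
  \<open>G (\<tau> i) - G x\<close> and \<open>\<tau> i - x\<close> as functions of
  \<open>x\<close>, it becomes the Lipschitz estimate for operators.\<close>

lemma spec_fun_mono:
  assumes f: "bdd_on_spec f" and g: "bdd_on_spec g" and L: "L \<ge> 0"
    and le: "\<And>v. v \<in> U \<Longrightarrow> \<bar>f (b v)\<bar> \<le> L * \<bar>g (b v)\<bar>" "\<bar>f 0\<bar> \<le> L * \<bar>g 0\<bar>"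
  shows "norm (spec_fun f x) \<le> L * norm (spec_fun g x)"
proof -
  let ?r = "norm (x - proj_op U u x)"
  have sq: "(f s)\<^sup>2 \<le> L\<^sup>2 * (g s)\<^sup>2" if "\<bar>f s\<bar> \<le> L * \<bar>g s\<bar>" for s
    using power_mono[OF that, of 2] by (simp add: power_mult_distrib)
  have "((norm (spec_fun f x))\<^sup>2 - (f 0)\<^sup>2 * ?r\<^sup>2) \<le> L\<^sup>2 * ((norm (spec_fun g x))\<^sup>2 - (g 0)\<^sup>2 * ?r\<^sup>2)"
  proof (rule has_sum_mono[OF norm_spec_fun[OF f] has_sum_cmult_right[OF norm_spec_fun[OF g]]])
    fix v assume "v \<in> U"
    then show "(f (b v))\<^sup>2 * (inner x (u v))\<^sup>2 \<le> L\<^sup>2 * ((g (b v))\<^sup>2 * (inner x (u v))\<^sup>2)"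
      using mult_right_mono[OF sq[OF le(1)], of v "(inner x (u v))\<^sup>2"] by (simp add: mult.assoc)
  qed
  moreover have "(f 0)\<^sup>2 * ?r\<^sup>2 \<le> L\<^sup>2 * ((g 0)\<^sup>2 * ?r\<^sup>2)"
    using mult_right_mono[OF sq[OF le(2)], of "?r\<^sup>2"] by (simp add: mult.assoc)
  ultimately have "(norm (spec_fun f x))\<^sup>2 \<le> (L * norm (spec_fun g x))\<^sup>2"
    by (simp add: power_mult_distrib algebra_simps)
  then show ?thesis by (rule power2_le_imp_le) (use L in simp)
qed

lemma spec_fun_id: "spec_fun (\<lambda>s. s) x = B x"
  unfolding spec_fun_def eigensystem_diag[OF B esB] by simp

lemma spec_fun_const: "spec_fun (\<lambda>s. c) x = c *\<^sub>R x"
proof -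
  have "diag_op U u (\<lambda>v. c) x = diag_op U u (\<lambda>v. c * 1) x" by simp
  also have "\<dots> = c *\<^sub>R proj_op U u x"
    using has_sum_unique[OF diag_op_has_sum[OF u_on, of "\<lambda>v. c * 1" "\<bar>c\<bar>" x]]
      has_sum_scaleR[OF diag_op_has_sum[OF u_on, of "\<lambda>v. 1" "1" x], of c] by simp
  finally show ?thesis by (simp add: spec_fun_def scaleR_diff_right)
qed

lemma norm_spec_fun_le:
  assumes f: "bdd_on_spec f" and L: "L \<ge> 0"
    and le: "\<And>v. v \<in> U \<Longrightarrow> \<bar>f (b v)\<bar> \<le> L" "\<bar>f 0\<bar> \<le> L"
  shows "norm (spec_fun f x) \<le> L * norm x"
  using spec_fun_mono[OF f bdd_on_spec_const[of 1] L, of x] le by (simp add: spec_fun_const)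

lemma spec_fun_diff:
  assumes f: "bdd_on_spec f" and g: "bdd_on_spec g"
  shows "spec_fun (\<lambda>s. f s - g s) x = spec_fun f x - spec_fun g x"
proof -
  obtain K L where K: "\<And>v. v \<in> U \<Longrightarrow> \<bar>f (b v)\<bar> \<le> K" and L: "\<And>v. v \<in> U \<Longrightarrow> \<bar>g (b v)\<bar> \<le> L"
    using f g unfolding bdd_on_spec_def by blast
  obtain M where M: "\<And>v. v \<in> U \<Longrightarrow> \<bar>f (b v) - g (b v)\<bar> \<le> M"
    using bdd_on_spec_diff[OF f g] unfolding bdd_on_spec_def by blast
  have "diag_op U u (\<lambda>v. f (b v) - g (b v)) x
      = diag_op U u (\<lambda>v. f (b v)) x - diag_op U u (\<lambda>v. g (b v)) x"
  proof (rule has_sum_unique[OF diag_op_has_sum[where c = "\<lambda>v. f (b v) - g (b v)", OF u_on M]])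
    have "((\<lambda>v. (f (b v) * inner x (u v)) *\<^sub>R u v + - ((g (b v) * inner x (u v)) *\<^sub>R u v)) has_sum
       diag_op U u (\<lambda>v. f (b v)) x + - diag_op U u (\<lambda>v. g (b v)) x) U"
    proof (rule has_sum_add[OF diag_op_has_sum[where c = "\<lambda>v. f (b v)", OF u_on K]])
      show "((\<lambda>v. - ((g (b v) * inner x (u v)) *\<^sub>R u v)) has_sum - diag_op U u (\<lambda>v. g (b v)) x) U"
        unfolding has_sum_uminus minus_minus by (rule diag_op_has_sum[where c = "\<lambda>v. g (b v)", OF u_on L])
    qed
    then show "((\<lambda>v. ((f (b v) - g (b v)) * inner x (u v)) *\<^sub>R u v) has_sum
       diag_op U u (\<lambda>v. f (b v)) x - diag_op U u (\<lambda>v. g (b v)) x) U"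
      by (simp add: left_diff_distrib scaleR_diff_left)
  qed
  then show ?thesis by (simp add: spec_fun_def algebra_simps)
qed

lemma spec_fun_mult:
  assumes f: "bdd_on_spec f" and g: "bdd_on_spec g"
  shows "spec_fun (\<lambda>s. f s * g s) x = spec_fun f (spec_fun g x)"
proof -
  have "diag_op U u (\<lambda>v. f (b v)) (spec_fun g x) = diag_op U u (\<lambda>v. f (b v) * g (b v)) x"
    unfolding diag_op_def[of U u] by (rule infsum_cong) (simp add: inner_spec_fun[OF g])
  moreover have "spec_fun g x - proj_op U u (spec_fun g x) = g 0 *\<^sub>R (x - proj_op U u x)"
    unfolding proj_spec_fun[OF g] by (simp add: spec_fun_def)
  ultimately show ?thesis by (simp add: spec_fun_def[of f] spec_fun_def[of "\<lambda>s. f s * g s"])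
qed

lemma spec_fun_commute:
  assumes f: "bdd_on_spec f"
  shows "inner (spec_fun f x) y = inner x (spec_fun f y)"
proof -
  obtain K where K: "\<And>v. v \<in> U \<Longrightarrow> \<bar>f (b v)\<bar> \<le> K" using f unfolding bdd_on_spec_def by blast
  show ?thesis
    using inner_diag_op_commute[where c = "\<lambda>v. f (b v)", OF u_on K, of x y]
      inner_diag_op_commute[OF u_on, of "\<lambda>v. 1" 1 x y]
    by (simp add: spec_fun_def inner_add_left inner_add_right inner_diff_left inner_diff_right)
qed

lemma bounded_linear_spec_fun:
  assumes f: "bdd_on_spec f"
  shows "bounded_linear (spec_fun f)"
proof -
  obtain K where K: "\<And>v. v \<in> U \<Longrightarrow> \<bar>f (b v)\<bar> \<le> K" using f unfolding bdd_on_spec_def by blast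
  show ?thesis
    unfolding spec_fun_def[abs_def]
    by (intro bounded_linear_add bounded_linear_const_scaleR bounded_linear_sub bounded_linear_ident
        bounded_linear_diag_op[where c = "\<lambda>v. f (b v)", OF u_on K]
        bounded_linear_diag_op[OF u_on, of "\<lambda>v. 1" 1]) auto
qed

text \<open>The quadratic form of \<open>B + \<mu>\<close> at \<open>f(B) x\<close> is a squared norm, because
  \<open>(B + \<mu>)\<^sup>1\<^sup>/\<^sup>2\<close> is a function of \<open>B\<close>.\<close>

lemma form_spec_fun:
  assumes f: "bdd_on_spec f" and c: "c \<ge> 0" and \<mu>: "\<mu> \<ge> 0"
    and le: "\<And>v. v \<in> U \<Longrightarrow> (b v + \<mu>) * (f (b v))\<^sup>2 \<le> c\<^sup>2" "\<mu> * (f 0)\<^sup>2 \<le> c\<^sup>2"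
  shows "inner (B (spec_fun f x)) (spec_fun f x) + \<mu> * (norm (spec_fun f x))\<^sup>2 \<le> (c * norm x)\<^sup>2"
proof -
  define h where "h s = sqrt (\<bar>s\<bar> + \<mu>) * f s" for s
  have h_le: "\<bar>h s\<bar> \<le> c" if "(s + \<mu>) * (f s)\<^sup>2 \<le> c\<^sup>2" "s \<ge> 0" for s
  proof (rule power2_le_imp_le[OF _ c])
    show "\<bar>h s\<bar>\<^sup>2 \<le> c\<^sup>2" using that \<mu> by (simp add: h_def power_mult_distrib)
  qed
  have hb: "bdd_on_spec h"
    unfolding bdd_on_spec_def using h_le[OF le(1)] b_pos by (intro exI[of _ c]) (auto simp: less_imp_le)
  have hh: "bdd_on_spec (\<lambda>s. h s * h s)" by (intro bdd_on_spec_mult hb)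
  have ff: "bdd_on_spec (\<lambda>s. f s * f s)" by (intro bdd_on_spec_mult f)
  have eq: "(\<lambda>s. s + \<mu>) = (\<lambda>s. s - (- \<mu>))" by simp
  have m: "bdd_on_spec (\<lambda>s. s + \<mu>)"
    unfolding eq by (intro bdd_on_spec_diff bdd_on_spec_id bdd_on_spec_const)
  let ?y = "spec_fun f x"
  have "inner (B ?y) ?y + \<mu> * (norm ?y)\<^sup>2 = inner (spec_fun (\<lambda>s. s + \<mu>) ?y) ?y"
    unfolding eq spec_fun_diff[OF bdd_on_spec_id bdd_on_spec_const] spec_fun_id spec_fun_const
    by (simp add: inner_add_left power2_norm_eq_inner)
  also have "\<dots> = inner (spec_fun f (spec_fun (\<lambda>s. s + \<mu>) ?y)) x"
    using spec_fun_commute[OF f] by simp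
  also have "spec_fun f (spec_fun (\<lambda>s. s + \<mu>) ?y) = spec_fun (\<lambda>s. f s * ((s + \<mu>) * f s)) x"
    by (simp add: spec_fun_mult[OF f bdd_on_spec_mult[OF m f]] spec_fun_mult[OF m f])
  also have "\<dots> = spec_fun (\<lambda>s. h s * h s) x"
    unfolding spec_fun_def diag_op_def[of U u "\<lambda>v. f (b v) * ((b v + \<mu>) * f (b v))"]
      diag_op_def[of U u "\<lambda>v. h (b v) * h (b v)"]
    using b_pos \<mu>
    by (intro arg_cong2[where f = "(+)"] infsum_cong arg_cong2[where f = scaleR])
       (auto simp: h_def less_imp_le real_sqrt_mult_self algebra_simps abs_of_pos)
  also have "inner (spec_fun (\<lambda>s. h s * h s) x) x = (norm (spec_fun h x))\<^sup>2"
    by (simp add: spec_fun_mult[OF hb hb] spec_fun_commute[OF hb] power2_norm_eq_inner)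
  also have "\<dots> \<le> (c * norm x)\<^sup>2"
    using norm_spec_fun_le[OF hb c, of x] h_le[OF le(1)] h_le[of 0] le(2) b_pos
    by (intro power_mono) (auto simp: less_imp_le)
  finally show ?thesis .
qed

end

text \<open>\<open>rel_dev\<close> says that (A + \<mu>)^(-1/2) (A - B) (A + \<mu>)^(-1/2) has
  Hilbert-Schmidt norm at most 1/2, whence the 1/4; \<open>hs_dev\<close> says that A - B has
  Hilbert-Schmidt norm at most \<open>H\<close>. By \<open>B_kernel\<close>, \<open>B\<close>
  vanishes wherever the \<open>\<phi> i\<close> give no information, so matrix entries determine A -
  B.\<close>

locale perturbed_calculus = spectral_calculus B U u b
  for B :: "'k::{real_inner, banach} \<Rightarrow> 'k" and U :: "'u set" and u b +
  fixes A :: "'k \<Rightarrow> 'k" and I :: "'i set" and \<phi> :: "'i \<Rightarrow> 'k" and \<tau> :: "'i \<Rightarrow> real"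
    and \<mu> H t0 :: real
  assumes A: "bounded_linear A" and esA: "eigensystem A I \<phi> \<tau>"
    and \<tau>_pos: "\<And>i. i \<in> I \<Longrightarrow> \<tau> i > 0" and \<tau>_le: "\<And>i. i \<in> I \<Longrightarrow> \<tau> i \<le> t0"
    and B_kernel: "\<And>x. (\<And>i. i \<in> I \<Longrightarrow> inner x (\<phi> i) = 0) \<Longrightarrow> B x = 0"
    and \<mu>: "\<mu> > 0" and H: "H \<ge> 0" and t0: "t0 > 0"
    and rel_dev: "\<And>F. finite F \<Longrightarrow> F \<subseteq> I \<Longrightarrow>
      (\<Sum>i\<in>F. \<Sum>j\<in>F. (inner (A (\<phi> i) - B (\<phi> i)) (\<phi> j))\<^sup>2 / ((\<tau> i + \<mu>) * (\<tau> j + \<mu>))) \<le> 1/4"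
    and hs_dev: "\<And>F G. finite F \<Longrightarrow> F \<subseteq> I \<Longrightarrow> finite G \<Longrightarrow> G \<subseteq> I \<Longrightarrow>
      (\<Sum>i\<in>F. \<Sum>j\<in>G. (inner (A (\<phi> i) - B (\<phi> i)) (\<phi> j))\<^sup>2) \<le> H\<^sup>2"
begin

lemma \<phi>_on: "orthonormal_on I \<phi>" using esA by (simp add: eigensystem_def)

lemma A_commute: "inner (A x) y = inner x (A y)"
  unfolding eigensystem_diag[OF A esA]
  by (rule inner_diag_op_commute[OF \<phi>_on eigensystem_eigenvalue_le[OF A esA]])

lemma B_commute: "inner (B x) y = inner x (B y)"
  using spec_fun_commute[OF bdd_on_spec_id] by (simp add: spec_fun_id)

lemma form_A: "((\<lambda>i. \<tau> i * (inner x (\<phi> i))\<^sup>2) has_sum inner (A x) x) I"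
  using inner_diag_op_has_sum[where c = \<tau>, OF \<phi>_on eigensystem_eigenvalue_le[OF A esA], of x x]
  unfolding eigensystem_diag[OF A esA, symmetric] by (simp add: power2_eq_square mult.assoc)

lemma form_A_le_finite:
  assumes F: "finite F" "F \<subseteq> I" and c: "c \<ge> 0"
  shows "(\<Sum>i\<in>F. (\<tau> i + c) * (inner x (\<phi> i))\<^sup>2) \<le> inner (A x) x + c * (norm x)\<^sup>2"
proof -
  have "(\<Sum>i\<in>F. \<tau> i * (inner x (\<phi> i))\<^sup>2) \<le> inner (A x) x"
    using form_A F \<tau>_pos by (intro finite_sum_le_has_sum[OF form_A]) (auto simp: less_imp_le)
  moreover have "c * (\<Sum>i\<in>F. (inner x (\<phi> i))\<^sup>2) \<le> c * (norm x)\<^sup>2"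
    by (intro mult_left_mono bessel_finite[OF \<phi>_on F] c)
  ultimately show ?thesis by (simp add: distrib_right sum.distrib sum_distrib_left)
qed

lemma diff_proj: "A (proj_op I \<phi> x) - B (proj_op I \<phi> x) = A x - B x"
proof -
  let ?y = "x - proj_op I \<phi> x"
  have "A ?y = 0" using esA proj_op_residual[OF \<phi>_on] by (simp add: eigensystem_def)
  moreover have "B ?y = 0" using proj_op_residual[OF \<phi>_on] by (rule B_kernel)
  ultimately show ?thesis
    by (simp add: linear_diff[OF bounded_linear.linear[OF A]] linear_diff[OF bounded_linear.linear[OF B]])
qed

text \<open>Cauchy-Schwarz over pairs (i, j) with the weight
  \<open>(\<tau> i + \<mu>) * (\<tau> j + \<mu>)\<close>: one factor is the 1/2 from
  \<open>rel_dev\<close>, and the other is a double sum that is the square of a single one, bounded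
  by the form of A + \<mu>.\<close>

lemma form_diff_finite:
  fixes x :: 'k
  assumes F: "finite F" "F \<subseteq> I"
  defines "y \<equiv> (\<Sum>i\<in>F. inner x (\<phi> i) *\<^sub>R \<phi> i)"
  shows "\<bar>inner (A y - B y) y\<bar> \<le> (inner (A x) x + \<mu> * (norm x)\<^sup>2) / 2"
proof -
  let ?D = "\<lambda>i j. inner (A (\<phi> i) - B (\<phi> i)) (\<phi> j)" and ?x = "\<lambda>i. inner x (\<phi> i)"
  let ?p = "\<lambda>i. \<tau> i + \<mu>" and ?v = "inner (A x) x + \<mu> * (norm x)\<^sup>2"
  have p: "?p i > 0" if "i \<in> F" for i using \<tau>_pos[of i] that F \<mu> by (auto simp: add_pos_pos)
  have S: "(\<Sum>i\<in>F. ?p i * (?x i)\<^sup>2) \<le> ?v"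
    using form_A_le_finite[OF F, where c = \<mu> and x = x] \<mu> by simp
  have S0: "0 \<le> (\<Sum>i\<in>F. ?p i * (?x i)\<^sup>2)" using p by (intro sum_nonneg) (simp add: less_imp_le)
  have "A y - B y = (\<Sum>i\<in>F. ?x i *\<^sub>R (A (\<phi> i) - B (\<phi> i)))"
    unfolding y_def
    by (simp add: linear_sum[OF bounded_linear.linear[OF A]] linear_cmul[OF bounded_linear.linear[OF A]]
        linear_sum[OF bounded_linear.linear[OF B]] linear_cmul[OF bounded_linear.linear[OF B]]
        sum_subtractf scaleR_diff_right)
  then have "inner (A y - B y) y = (\<Sum>i\<in>F. ?x i * inner (A (\<phi> i) - B (\<phi> i)) y)"
    by (simp add: inner_sum_left)
  also have "\<dots> = (\<Sum>i\<in>F. \<Sum>j\<in>F. ?D i j * (?x i * ?x j))"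
    unfolding y_def inner_sum_right sum_distrib_left by (simp add: mult_ac)
  also have "\<dots> = (\<Sum>(i, j)\<in>F \<times> F. ?D i j * (?x i * ?x j))" by (simp add: sum.cartesian_product)
  finally have "\<bar>inner (A y - B y) y\<bar> = \<bar>\<Sum>q\<in>F \<times> F. ?D (fst q) (snd q) * (?x (fst q) * ?x (snd q))\<bar>"
    by (simp add: case_prod_beta)
  also have "\<dots> \<le> 1/2 * (\<Sum>i\<in>F. ?p i * (?x i)\<^sup>2)"
  proof (rule cauchy_schwarz_weighted[where p = "\<lambda>q. ?p (fst q) * ?p (snd q)"])
    show "(\<Sum>q\<in>F \<times> F. (?D (fst q) (snd q))\<^sup>2 / (?p (fst q) * ?p (snd q))) \<le> (1/2)\<^sup>2"
      using rel_dev[OF F] by (simp add: sum.cartesian_product case_prod_beta power2_eq_square)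
    show "(\<Sum>q\<in>F \<times> F. ?p (fst q) * ?p (snd q) * (?x (fst q) * ?x (snd q))\<^sup>2) \<le> (\<Sum>i\<in>F. ?p i * (?x i)\<^sup>2)\<^sup>2"
      unfolding power2_eq_square[of "\<Sum>i\<in>F. ?p i * (?x i)\<^sup>2"] sum_product sum.cartesian_product
      by (simp add: case_prod_beta power_mult_distrib mult_ac)
  qed (use p S0 in auto)
  also have "\<dots> \<le> ?v / 2" using S by simp
  finally show ?thesis .
qed

lemma form_diff: "\<bar>inner (A x - B x) x\<bar> \<le> (inner (A x) x + \<mu> * (norm x)\<^sup>2) / 2"
proof -
  let ?y = "\<lambda>F. \<Sum>i\<in>F. inner x (\<phi> i) *\<^sub>R \<phi> i" and ?P = "proj_op I \<phi> x"
  have "((\<lambda>i. (1 * inner x (\<phi> i)) *\<^sub>R \<phi> i) has_sum ?P) I"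
    by (rule diag_op_has_sum[OF \<phi>_on, where K = 1]) auto
  then have lim: "(?y \<longlongrightarrow> ?P) (finite_subsets_at_top I)" by (simp add: has_sum_def)
  have "((\<lambda>F. \<bar>inner (A (?y F) - B (?y F)) (?y F)\<bar>) \<longlongrightarrow> \<bar>inner (A ?P - B ?P) ?P\<bar>) (finite_subsets_at_top I)"
    by (intro tendsto_rabs tendsto_inner tendsto_diff bounded_linear.tendsto[OF A] bounded_linear.tendsto[OF B] lim)
  then have "\<bar>inner (A ?P - B ?P) ?P\<bar> \<le> (inner (A x) x + \<mu> * (norm x)\<^sup>2) / 2"
  proof (rule tendsto_upperbound)
    show "\<forall>\<^sub>F F in finite_subsets_at_top I. \<bar>inner (A (?y F) - B (?y F)) (?y F)\<bar>
        \<le> (inner (A x) x + \<mu> * (norm x)\<^sup>2) / 2"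
      using form_diff_finite by (intro eventually_finite_subsets_at_top_weakI) auto
  qed simp
  moreover have "inner (A ?P - B ?P) ?P = inner (A x - B x) x"
  proof -
    have "inner (A ?P - B ?P) ?P = inner (A x - B x) ?P" by (simp only: diff_proj)
    also have "\<dots> = inner x (A ?P - B ?P)"
      by (simp add: inner_diff_left inner_diff_right A_commute B_commute)
    finally show ?thesis by (simp only: diff_proj inner_commute)
  qed
  ultimately show ?thesis by simp
qed

lemma form_A_le_B: "inner (A x) x + \<mu> * (norm x)\<^sup>2 \<le> 2 * (inner (B x) x + \<mu> * (norm x)\<^sup>2)"
proof -
  have "inner (A x) x - inner (B x) x \<le> (inner (A x) x + \<mu> * (norm x)\<^sup>2) / 2"
    using form_diff[of x] abs_ge_self[of "inner (A x - B x) x"] unfolding inner_diff_left by linarith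
  moreover have "0 \<le> \<mu> * (norm x)\<^sup>2" using \<mu> by simp
  ultimately show ?thesis by (simp add: field_simps)
qed

text \<open>\<open>form_diff\<close> at a unit eigenvector: the form of \<open>A\<close> is at most
  \<open>t0\<close> there, and the deviation adds at most (t0 + \<mu>)/2. This confines the random
  eigenvalues to a fixed interval on which a Lipschitz constant can be chosen.\<close>

lemma b_le: "v \<in> U \<Longrightarrow> b v \<le> 3/2 * t0 + \<mu> / 2"
proof -
  assume v: "v \<in> U"
  have n: "norm (u v) = 1" using orthonormal_onD[OF u_on v v] by (simp add: norm_eq_1)
  have "inner (A (u v)) (u v) \<le> t0 * (norm (u v))\<^sup>2"
  proof (rule has_sum_le_finite_sums[OF form_A])
    fix F assume F: "finite F" "F \<subseteq> I"
    have "(\<Sum>i\<in>F. \<tau> i * (inner (u v) (\<phi> i))\<^sup>2) \<le> (\<Sum>i\<in>F. t0 * (inner (u v) (\<phi> i))\<^sup>2)"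
      using F \<tau>_le by (intro sum_mono mult_right_mono) auto
    also have "\<dots> \<le> t0 * (norm (u v))\<^sup>2"
      unfolding sum_distrib_left[symmetric] using t0 by (intro mult_left_mono bessel_finite[OF \<phi>_on F]) simp
    finally show "(\<Sum>i\<in>F. \<tau> i * (inner (u v) (\<phi> i))\<^sup>2) \<le> t0 * (norm (u v))\<^sup>2" .
  qed
  moreover have "inner (B (u v)) (u v) = b v"
    using esB v n by (simp add: eigensystem_def dot_square_norm)
  moreover have "inner (B (u v)) (u v) - inner (A (u v)) (u v) \<le> (inner (A (u v)) (u v) + \<mu> * (norm (u v))\<^sup>2) / 2"
    using form_diff[of "u v"] abs_ge_minus_self[of "inner (A (u v) - B (u v)) (u v)"]
    unfolding inner_diff_left by linarith
  ultimately show ?thesis using n by simp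
qed

text \<open>Both operators are self-adjoint and vanish on the complement of the
  \<open>\<phi> i\<close>, so their images lie in the closed span and Parseval's identity turns
  entries into norms.\<close>

lemma hs_diff:
  assumes F: "finite F" "F \<subseteq> I"
  shows "(\<Sum>i\<in>F. (norm (A (\<phi> i) - B (\<phi> i)))\<^sup>2) \<le> H\<^sup>2"
proof -
  let ?d = "\<lambda>i. A (\<phi> i) - B (\<phi> i)"
  have "proj_op I \<phi> (?d i) = ?d i" for i
  proof (rule orthonormal_expansion[OF \<phi>_on])
    fix y assume y: "\<And>i. i \<in> I \<Longrightarrow> inner y (\<phi> i) = 0"
    then have "A y = 0" "B y = 0" using esA B_kernel by (auto simp: eigensystem_def)
    then show "inner (?d i) y = 0" by (simp add: inner_diff_left A_commute B_commute)
  qed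
  then have "((\<lambda>j. (inner (?d i) (\<phi> j))\<^sup>2) has_sum (norm (?d i))\<^sup>2) I" for i
    using parseval_proj[OF \<phi>_on, of "?d i"] by simp
  then have "((\<lambda>j. \<Sum>i\<in>F. (inner (?d i) (\<phi> j))\<^sup>2) has_sum (\<Sum>i\<in>F. (norm (?d i))\<^sup>2)) I"
    by (intro has_sum_sum)
  then show ?thesis
  proof (rule has_sum_le_finite_sums)
    fix G assume "finite G" "G \<subseteq> I"
    then show "(\<Sum>j\<in>G. \<Sum>i\<in>F. (inner (?d i) (\<phi> j))\<^sup>2) \<le> H\<^sup>2"
      using hs_dev[OF F] by (subst sum.swap) simp
  qed
qed

text \<open>Duality: the squared norm of \<open>z = g(B) w\<close> is the inner product of
  \<open>w\<close> with \<open>y = g(B) z\<close>. In the coordinates \<open>\<phi>\<close> the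
  first factor is controlled by \<open>Q\<close>; the second is the form of \<open>A\<close> shifted
  by \<open>l\<close> at \<open>y\<close>, which \<open>form_A_le_B\<close> and
  \<open>form_spec_fun\<close> bound in terms of the norm of \<open>z\<close>. One such norm is then
  cancelled.\<close>

lemma variance_bound:
  fixes g :: "real \<Rightarrow> real"
  assumes w: "\<And>x. (\<And>i. i \<in> I \<Longrightarrow> inner x (\<phi> i) = 0) \<Longrightarrow> inner w x = 0"
    and l: "0 < l" "l \<le> \<mu>" and q: "q \<ge> 0"
    and Q: "\<And>F. finite F \<Longrightarrow> F \<subseteq> I \<Longrightarrow> (\<Sum>i\<in>F. (inner w (\<phi> i))\<^sup>2 / (\<tau> i + l)) \<le> q\<^sup>2"
    and g: "bdd_on_spec g" and c: "c \<ge> 0"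
    and gle: "\<And>v. v \<in> U \<Longrightarrow> (b v + \<mu>) * (g (b v))\<^sup>2 \<le> c\<^sup>2" "\<mu> * (g 0)\<^sup>2 \<le> c\<^sup>2"
  shows "norm (spec_fun g w) \<le> sqrt 2 * q * c"
proof -
  let ?z = "spec_fun g w"
  let ?y = "spec_fun g ?z"
  let ?v = "sqrt 2 * c * norm ?z"
  have "inner (A ?y) ?y + l * (norm ?y)\<^sup>2 \<le> inner (A ?y) ?y + \<mu> * (norm ?y)\<^sup>2"
    using l by (intro add_left_mono mult_right_mono) auto
  also have "\<dots> \<le> 2 * (inner (B ?y) ?y + \<mu> * (norm ?y)\<^sup>2)" by (rule form_A_le_B)
  also have "\<dots> \<le> 2 * (c * norm ?z)\<^sup>2"
    using form_spec_fun[OF g c less_imp_le[OF \<mu>] gle, of ?z] by simp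
  also have "\<dots> = ?v\<^sup>2" by (simp add: power_mult_distrib)
  finally have y: "inner (A ?y) ?y + l * (norm ?y)\<^sup>2 \<le> ?v\<^sup>2" .
  have "proj_op I \<phi> w = w" using w by (rule orthonormal_expansion[OF \<phi>_on])
  then have hs: "((\<lambda>i. inner w (\<phi> i) * inner ?y (\<phi> i)) has_sum inner w ?y) I"
    using inner_diag_op_has_sum[OF \<phi>_on, of "\<lambda>_. 1" 1 w ?y] by simp
  have "norm (inner w ?y) \<le> q * ?v"
  proof (rule has_sum_norm_le[OF hs])
    fix F assume F: "finite F" "F \<subseteq> I"
    have "\<bar>\<Sum>i\<in>F. inner w (\<phi> i) * inner ?y (\<phi> i)\<bar> \<le> q * ?v"
    proof (rule cauchy_schwarz_weighted[where p = "\<lambda>i. \<tau> i + l"])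
      show "(\<Sum>i\<in>F. (\<tau> i + l) * (inner ?y (\<phi> i))\<^sup>2) \<le> ?v\<^sup>2"
        using form_A_le_finite[OF F, where c = l and x = ?y] y l by linarith
      show "\<tau> i + l > 0" if "i \<in> F" for i using \<tau>_pos[of i] that F l by (auto simp: add_pos_pos)
    qed (use Q[OF F] q c in auto)
    then show "norm (\<Sum>i\<in>F. inner w (\<phi> i) * inner ?y (\<phi> i)) \<le> q * ?v" by simp
  qed
  moreover have "inner w ?y = (norm ?z)\<^sup>2"
    using spec_fun_commute[OF g, of w ?z] by (simp add: power2_norm_eq_inner)
  ultimately have "(norm ?z)\<^sup>2 \<le> (sqrt 2 * q * c) * norm ?z" by (simp add: mult_ac)
  then show ?thesis by (rule power2_le_mult_self_imp_le) (use q c in simp_all)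
qed

context
  fixes f :: 'k and h :: "'i \<Rightarrow> real" and s r l hn :: real and \<rho> :: "real \<Rightarrow> real"
  assumes src: "((\<lambda>i. (\<tau> i powr s * h i) *\<^sub>R \<phi> i) has_sum f) I"
    and h: "\<And>F. finite F \<Longrightarrow> F \<subseteq> I \<Longrightarrow> (\<Sum>i\<in>F. (h i)\<^sup>2) \<le> hn\<^sup>2" and hn: "hn \<ge> 0"
    and r: "0 < r" "r \<le> s" and l: "0 < l" "l \<le> \<mu>"
    and \<rho>: "bdd_on_spec \<rho>"
begin

lemma \<tau>_powr_le: "i \<in> I \<Longrightarrow> \<tau> i powr (s - r) \<le> t0 powr (s - r)"
  using \<tau>_pos[of i] \<tau>_le[of i] r by (intro powr_mono2) auto

text \<open>The duality of \<open>variance_bound\<close> with \<open>f\<close> in place of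
  \<open>w\<close>: the powers \<open>\<tau> i powr s\<close> are shifted to the other factor, where
  \<open>r \<le> 1/2\<close> permits \<open>(\<tau> i powr s)\<^sup>2\<close> to be absorbed by
  \<open>\<tau> i + l\<close>.\<close>

lemma bias_bound_low:
  assumes c: "c \<ge> 0" and r2: "r \<le> 1/2"
    and \<rho>le: "\<And>v. v \<in> U \<Longrightarrow> (b v + \<mu>) * (\<rho> (b v))\<^sup>2 \<le> c\<^sup>2" "\<mu> * (\<rho> 0)\<^sup>2 \<le> c\<^sup>2"
  shows "norm (spec_fun \<rho> f) \<le> sqrt 2 * hn * t0 powr (s - r) * l powr (r - 1/2) * c"
proof -
  let ?z = "spec_fun \<rho> f"
  let ?y = "spec_fun \<rho> ?z"
  let ?v = "sqrt 2 * c * norm ?z" and ?k = "t0 powr (s - r) * l powr (r - 1/2)"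
  have "inner (A ?y) ?y + l * (norm ?y)\<^sup>2 \<le> inner (A ?y) ?y + \<mu> * (norm ?y)\<^sup>2"
    using l by (intro add_left_mono mult_right_mono) auto
  also have "\<dots> \<le> 2 * (inner (B ?y) ?y + \<mu> * (norm ?y)\<^sup>2)" by (rule form_A_le_B)
  also have "\<dots> \<le> 2 * (c * norm ?z)\<^sup>2"
    using form_spec_fun[OF \<rho> c less_imp_le[OF \<mu>] \<rho>le, of ?z] by simp
  also have "\<dots> = ?v\<^sup>2" by (simp add: power_mult_distrib)
  finally have y: "inner (A ?y) ?y + l * (norm ?y)\<^sup>2 \<le> ?v\<^sup>2" .
  have pw: "(\<tau> i powr s)\<^sup>2 \<le> ?k\<^sup>2 * (\<tau> i + l)" if i: "i \<in> I" for i
  proof -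
    have \<tau>: "\<tau> i > 0" by (rule \<tau>_pos[OF i])
    have "(\<tau> i powr r)\<^sup>2 \<le> (l powr (r - 1/2))\<^sup>2 * (\<tau> i + l)"
    proof -
      \<comment> \<open>For t = \<open>\<tau> i / l\<close> this is t^(2r) \<le> max(1, t) \<le> t +
        1, valid because 2r \<le> 1.\<close>
      have "(\<tau> i / l) powr (2 * r) \<le> \<tau> i / l + 1"
      proof (cases "\<tau> i \<le> l")
        case True
        then have "(\<tau> i / l) powr (2 * r) \<le> 1" using \<tau> l r by (intro powr_le1) auto
        then show ?thesis using \<tau> l by (simp add: add_increasing)
      next
        case False
        then have "(\<tau> i / l) powr (2 * r) \<le> (\<tau> i / l) powr 1" using \<tau> l r2 by (intro powr_mono) auto
        then show ?thesis using \<tau> l by simp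
      qed
      then have "\<tau> i powr (2 * r) \<le> (l powr (2 * r) / l) * (\<tau> i + l)"
        using \<tau> l by (simp add: powr_divide field_simps)
      moreover have "l powr (2 * r) / l = (l powr (r - 1/2))\<^sup>2"
      proof -
        have "(l powr (r - 1/2))\<^sup>2 = l powr ((r - 1/2) + (r - 1/2))"
          unfolding power2_eq_square powr_add ..
        also have "\<dots> = l powr (2 * r - 1)" by simp
        also have "\<dots> = l powr (2 * r) / l" using l by (simp add: powr_diff)
        finally show ?thesis ..
      qed
      moreover have "\<tau> i powr (2 * r) = (\<tau> i powr r)\<^sup>2" using \<tau> by (simp add: powr_power mult.commute)
      ultimately show ?thesis by simp
    qed
    moreover have "(\<tau> i powr (s - r))\<^sup>2 \<le> (t0 powr (s - r))\<^sup>2"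
      using \<tau>_powr_le[OF i] by (intro power_mono) auto
    ultimately have "(\<tau> i powr (s - r))\<^sup>2 * (\<tau> i powr r)\<^sup>2 \<le> (t0 powr (s - r))\<^sup>2 * ((l powr (r - 1/2))\<^sup>2 * (\<tau> i + l))"
      by (intro mult_mono) auto
    moreover have "(\<tau> i powr (s - r))\<^sup>2 * (\<tau> i powr r)\<^sup>2 = (\<tau> i powr s)\<^sup>2"
      by (simp add: power_mult_distrib[symmetric] powr_add[symmetric])
    ultimately show ?thesis by (simp add: power_mult_distrib mult.assoc)
  qed
  have hs: "((\<lambda>i. inner ((\<tau> i powr s * h i) *\<^sub>R \<phi> i) ?y) has_sum inner f ?y) I"
    by (rule has_sum_inner_left[OF src])
  have "norm (inner f ?y) \<le> hn * (?k * ?v)"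
  proof (rule has_sum_norm_le[OF hs])
    fix F assume F: "finite F" "F \<subseteq> I"
    have "\<bar>\<Sum>i\<in>F. h i * (\<tau> i powr s * inner ?y (\<phi> i))\<bar> \<le> hn * (?k * ?v)"
    proof (rule cauchy_schwarz_weighted[where p = "\<lambda>i. 1"])
      have "(\<Sum>i\<in>F. 1 * (\<tau> i powr s * inner ?y (\<phi> i))\<^sup>2) \<le> (\<Sum>i\<in>F. ?k\<^sup>2 * ((\<tau> i + l) * (inner ?y (\<phi> i))\<^sup>2))"
      proof (rule sum_mono)
        fix i assume "i \<in> F"
        then have "(\<tau> i powr s)\<^sup>2 * (inner ?y (\<phi> i))\<^sup>2 \<le> (?k\<^sup>2 * (\<tau> i + l)) * (inner ?y (\<phi> i))\<^sup>2"
          using pw F by (intro mult_right_mono) auto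
        then show "1 * (\<tau> i powr s * inner ?y (\<phi> i))\<^sup>2 \<le> ?k\<^sup>2 * ((\<tau> i + l) * (inner ?y (\<phi> i))\<^sup>2)"
          by (simp only: power_mult_distrib mult.assoc mult_1)
      qed
      also have "\<dots> \<le> ?k\<^sup>2 * ?v\<^sup>2"
        unfolding sum_distrib_left[symmetric]
        using form_A_le_finite[OF F, where c = l and x = ?y] y l by (intro mult_left_mono) auto
      finally show "(\<Sum>i\<in>F. 1 * (\<tau> i powr s * inner ?y (\<phi> i))\<^sup>2) \<le> (?k * ?v)\<^sup>2"
        by (simp only: power_mult_distrib)
    qed (use h[OF F] hn c in auto)
    then show "norm (\<Sum>i\<in>F. inner ((\<tau> i powr s * h i) *\<^sub>R \<phi> i) ?y) \<le> hn * (?k * ?v)"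
      by (simp add: mult_ac inner_commute)
  qed
  moreover have "inner f ?y = (norm ?z)\<^sup>2"
    using spec_fun_commute[OF \<rho>, of f ?z] by (simp add: power2_norm_eq_inner)
  ultimately have "(norm ?z)\<^sup>2 \<le> (sqrt 2 * hn * t0 powr (s - r) * l powr (r - 1/2) * c) * norm ?z"
    by (simp add: mult_ac)
  then show ?thesis by (rule power2_le_mult_self_imp_le) (use hn c in simp_all)
qed

text \<open>With G(t) = (t + l)^r and f = G(A) y, one has \<rho>(B) f = \<rho>(B) (G(A) - G(B)) y +
  (\<rho> G)(B) y. The first term is small through the Lipschitz constant of G and the bound
  \<open>H\<close>, the second through the qualification, which enters as \<open>c\<close>.\<close>

lemma bias_bound_high:
  assumes L: "L \<ge> 0" "\<And>x y. 0 \<le> x \<Longrightarrow> x \<le> 3/2 * t0 + \<mu> / 2 \<Longrightarrow> 0 \<le> y \<Longrightarrow> y \<le> 3/2 * t0 + \<mu> / 2 \<Longrightarrow>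
      \<bar>(x + l) powr r - (y + l) powr r\<bar> \<le> L * \<bar>x - y\<bar>"
    and D: "\<And>v. v \<in> U \<Longrightarrow> \<bar>\<rho> (b v)\<bar> \<le> D" "\<bar>\<rho> 0\<bar> \<le> D"
    and c: "\<And>v. v \<in> U \<Longrightarrow> \<bar>\<rho> (b v)\<bar> * (b v + l) powr r \<le> c" "\<bar>\<rho> 0\<bar> * l powr r \<le> c"
  shows "norm (spec_fun \<rho> f) \<le> (D * L * H + c) * (t0 powr (s - r) * hn)"
proof -
  let ?k = "t0 powr (s - r)"
  have D0: "D \<ge> 0" using D(2) by linarith
  have c0: "c \<ge> 0" using c(2) by (meson abs_ge_zero mult_nonneg_nonneg order_trans powr_ge_zero)
  define G where "G x = (\<bar>x\<bar> + l) powr r" for x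
  \<comment> \<open>The coordinates of \<open>y\<close>: the source coefficients divided by
    \<open>G (\<tau> i)\<close>. The first factor is at most 1, which bounds the norm of
    \<open>y\<close> uniformly in \<open>l\<close>.\<close>
  define a where "a i = (\<tau> i / (\<tau> i + l)) powr r * (\<tau> i powr (s - r) * h i)" for i
  have a_le: "(a i)\<^sup>2 \<le> ?k\<^sup>2 * (h i)\<^sup>2" if i: "i \<in> I" for i
  proof -
    have "(\<tau> i / (\<tau> i + l)) powr r \<le> 1" using \<tau>_pos[OF i] l r by (intro powr_le1) auto
    then have "((\<tau> i / (\<tau> i + l)) powr r)\<^sup>2 \<le> 1" by (intro power_le_one) auto
    moreover have "(\<tau> i powr (s - r))\<^sup>2 * (h i)\<^sup>2 \<le> ?k\<^sup>2 * (h i)\<^sup>2"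
      using \<tau>_powr_le[OF i] by (intro mult_right_mono power_mono) auto
    ultimately have "((\<tau> i / (\<tau> i + l)) powr r)\<^sup>2 * ((\<tau> i powr (s - r))\<^sup>2 * (h i)\<^sup>2) \<le> 1 * (?k\<^sup>2 * (h i)\<^sup>2)"
      by (rule mult_mono) auto
    then show ?thesis by (simp add: a_def power_mult_distrib)
  qed
  have a_sum: "(\<Sum>i\<in>F. (a i)\<^sup>2) \<le> (?k * hn)\<^sup>2" if F: "finite F" "F \<subseteq> I" for F
  proof -
    have "(\<Sum>i\<in>F. (a i)\<^sup>2) \<le> ?k\<^sup>2 * (\<Sum>i\<in>F. (h i)\<^sup>2)"
      unfolding sum_distrib_left using a_le F by (intro sum_mono) auto
    also have "\<dots> \<le> ?k\<^sup>2 * hn\<^sup>2" by (intro mult_left_mono h F) auto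
    finally show ?thesis by (simp add: power_mult_distrib)
  qed
  have "(\<lambda>i. (a i)\<^sup>2) summable_on I"
    using a_sum by (intro nonneg_bdd_above_summable_on bdd_aboveI2[where M = "(?k * hn)\<^sup>2"]) auto
  then obtain y where y: "((\<lambda>i. a i *\<^sub>R \<phi> i) has_sum y) I"
    using orthonormal_series_summable[OF \<phi>_on] unfolding summable_on_def by blast
  have ny: "norm y \<le> ?k * hn"
  proof (rule has_sum_norm_le[OF y])
    fix F assume F: "finite F" "F \<subseteq> I"
    have "(norm (\<Sum>i\<in>F. a i *\<^sub>R \<phi> i))\<^sup>2 \<le> (?k * hn)\<^sup>2"
      using a_sum[OF F] by (simp add: norm_orthonormal_sum[OF \<phi>_on F])
    then show "norm (\<Sum>i\<in>F. a i *\<^sub>R \<phi> i) \<le> ?k * hn" by (rule power2_le_imp_le) (use hn in simp)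
  qed
  have G: "bdd_on_spec G"
    unfolding bdd_on_spec_def
  proof (intro exI ballI)
    fix v assume v: "v \<in> U"
    then show "\<bar>G (b v)\<bar> \<le> ((3/2 * t0 + \<mu> / 2) + l) powr r"
      unfolding G_def using b_pos[OF v] b_le[OF v] l r by (auto intro!: powr_mono2)
  qed
  have G\<tau>: "G (\<tau> i) * a i = \<tau> i powr s * h i" if i: "i \<in> I" for i
  proof -
    have "G (\<tau> i) * (\<tau> i / (\<tau> i + l)) powr r = \<tau> i powr r"
      using \<tau>_pos[OF i] l by (simp add: G_def powr_divide)
    moreover have "\<tau> i powr r * \<tau> i powr (s - r) = \<tau> i powr s" by (simp add: powr_add[symmetric])
    ultimately show ?thesis unfolding a_def by (metis mult.assoc)
  qed
  have "((\<lambda>i. spec_fun G (a i *\<^sub>R \<phi> i)) has_sum spec_fun G y) I"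
    by (rule has_sum_bounded_linear[OF bounded_linear_spec_fun[OF G] y])
  then have "((\<lambda>i. (\<tau> i powr s * h i) *\<^sub>R \<phi> i + - spec_fun G (a i *\<^sub>R \<phi> i)) has_sum (f + - spec_fun G y)) I"
    by (intro has_sum_add src has_sum_uminus[THEN iffD2]) simp
  \<comment> \<open>On its eigenvector \<open>\<phi> i\<close> the operator G(A) is the number
    \<open>G (\<tau> i)\<close>, so each term is a function of \<open>B\<close> alone.\<close>
  then have hs: "((\<lambda>i. a i *\<^sub>R spec_fun (\<lambda>x. G (\<tau> i) - G x) (\<phi> i)) has_sum (f - spec_fun G y)) I"
  proof (subst (asm) has_sum_cong)
    fix i assume i: "i \<in> I"
    show "(\<tau> i powr s * h i) *\<^sub>R \<phi> i + - spec_fun G (a i *\<^sub>R \<phi> i) = a i *\<^sub>R spec_fun (\<lambda>x. G (\<tau> i) - G x) (\<phi> i)"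
      unfolding G\<tau>[OF i, symmetric]
      by (simp add: spec_fun_diff[OF bdd_on_spec_const G] spec_fun_const scaleR_diff_right mult.commute
          linear_cmul[OF bounded_linear.linear[OF bounded_linear_spec_fun[OF G]]])
  qed simp
  have lip: "norm (spec_fun (\<lambda>x. G (\<tau> i) - G x) (\<phi> i)) \<le> L * norm (A (\<phi> i) - B (\<phi> i))" if i: "i \<in> I" for i
  proof -
    have eq: "A (\<phi> i) - B (\<phi> i) = spec_fun (\<lambda>x. \<tau> i - x) (\<phi> i)"
      using esA i by (simp add: spec_fun_diff[OF bdd_on_spec_const bdd_on_spec_id] spec_fun_const spec_fun_id eigensystem_def)
    have \<tau>R: "\<tau> i \<le> 3/2 * t0 + \<mu> / 2" using \<tau>_le[OF i] t0 \<mu> by linarith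
    have R0: "0 \<le> 3/2 * t0 + \<mu> / 2" using t0 \<mu> by simp
    show ?thesis
      unfolding eq
    proof (rule spec_fun_mono[OF bdd_on_spec_diff[OF bdd_on_spec_const G]
          bdd_on_spec_diff[OF bdd_on_spec_const bdd_on_spec_id] L(1)])
      show "\<bar>G (\<tau> i) - G (b v)\<bar> \<le> L * \<bar>\<tau> i - b v\<bar>" if v: "v \<in> U" for v
        using L(2)[of "\<tau> i" "b v"] \<tau>_pos[OF i] \<tau>R b_pos[OF v] b_le[OF v] by (simp add: G_def)
      show "\<bar>G (\<tau> i) - G 0\<bar> \<le> L * \<bar>\<tau> i - 0\<bar>"
        using L(2)[of "\<tau> i" 0] \<tau>_pos[OF i] \<tau>R R0 by (simp add: G_def)
    qed
  qed
  have diff: "norm (f - spec_fun G y) \<le> (?k * hn) * (L * H)"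
  proof (rule has_sum_norm_le[OF hs])
    fix F assume F: "finite F" "F \<subseteq> I"
    let ?n = "\<lambda>i. norm (A (\<phi> i) - B (\<phi> i))"
    have "norm (\<Sum>i\<in>F. a i *\<^sub>R spec_fun (\<lambda>x. G (\<tau> i) - G x) (\<phi> i)) \<le> (\<Sum>i\<in>F. \<bar>a i\<bar> * (L * ?n i))"
      using F lip by (intro sum_norm_le) (auto intro!: mult_left_mono)
    also have "\<dots> = L * (\<Sum>i\<in>F. \<bar>a i\<bar> * ?n i)" by (simp add: sum_distrib_left mult_ac)
    also have "\<dots> \<le> L * ((?k * hn) * H)"
    proof (rule mult_left_mono[OF _ L(1)])
      \<comment> \<open>The coefficients \<open>a i\<close> are only square summable, so the norms
        of \<open>A (\<phi> i) - B (\<phi> i)\<close> have to be as well: here the Hilbert-Schmidt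
        norm cannot be replaced by the operator norm.\<close>
      have "\<bar>\<Sum>i\<in>F. \<bar>a i\<bar> * ?n i\<bar> \<le> (?k * hn) * H"
        by (rule cauchy_schwarz_weighted[where p = "\<lambda>i. 1"])
           (use a_sum[OF F] hs_diff[OF F] hn H in auto)
      then show "(\<Sum>i\<in>F. \<bar>a i\<bar> * ?n i) \<le> (?k * hn) * H" by linarith
    qed
    finally show "norm (\<Sum>i\<in>F. a i *\<^sub>R spec_fun (\<lambda>x. G (\<tau> i) - G x) (\<phi> i)) \<le> (?k * hn) * (L * H)"
      by (simp add: mult_ac)
  qed
  have "spec_fun \<rho> f = spec_fun \<rho> (f - spec_fun G y) + spec_fun (\<lambda>x. \<rho> x * G x) y"
    by (simp add: spec_fun_mult[OF \<rho> G] linear_diff[OF bounded_linear.linear[OF bounded_linear_spec_fun[OF \<rho>]]])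
  then have "norm (spec_fun \<rho> f) \<le> norm (spec_fun \<rho> (f - spec_fun G y)) + norm (spec_fun (\<lambda>x. \<rho> x * G x) y)"
    by (metis norm_triangle_ineq)
  also have "\<dots> \<le> D * ((?k * hn) * (L * H)) + c * (?k * hn)"
  proof (intro add_mono)
    have "norm (spec_fun \<rho> (f - spec_fun G y)) \<le> D * norm (f - spec_fun G y)"
      by (rule norm_spec_fun_le[OF \<rho> D0 D])
    also have "\<dots> \<le> D * ((?k * hn) * (L * H))" by (rule mult_left_mono[OF diff D0])
    finally show "norm (spec_fun \<rho> (f - spec_fun G y)) \<le> D * ((?k * hn) * (L * H))" .
    have "norm (spec_fun (\<lambda>x. \<rho> x * G x) y) \<le> c * norm y"
    proof (rule norm_spec_fun_le[OF bdd_on_spec_mult[OF \<rho> G] c0])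
      show "\<bar>\<rho> (b v) * G (b v)\<bar> \<le> c" if v: "v \<in> U" for v
        using c(1)[OF v] b_pos[OF v] l by (simp add: G_def abs_mult)
      show "\<bar>\<rho> 0 * G 0\<bar> \<le> c" using c(2) l by (simp add: G_def abs_mult)
    qed
    also have "\<dots> \<le> c * (?k * hn)" by (rule mult_left_mono[OF ny c0])
    finally show "norm (spec_fun (\<lambda>x. \<rho> x * G x) y) \<le> c * (?k * hn)" .
  qed
  finally show ?thesis by (simp add: algebra_simps)
qed

end

text \<open>The value \<open>g 0\<close> does not matter, because the data lie in the range of \<open>B\<close>; it is
  replaced by 0.\<close>

lemma error_decomposition:
  fixes g :: "real \<Rightarrow> real"
  assumes w: "\<And>x. (\<And>v. v \<in> U \<Longrightarrow> inner x (u v) = 0) \<Longrightarrow> inner w x = 0"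
    and g: "bdd_on_spec g"
  shows "f - op_fun g B (B f + w) =
     spec_fun (\<lambda>s. 1 - s * (if s = 0 then 0 else g s)) f - spec_fun (\<lambda>s. if s = 0 then 0 else g s) w"
proof -
  let ?g = "\<lambda>s. if s = 0 then 0 else g s"
  obtain K where K: "\<And>v. v \<in> U \<Longrightarrow> \<bar>g (b v)\<bar> \<le> K" using g unfolding bdd_on_spec_def by blast
  have b0: "b v \<noteq> 0" if "v \<in> U" for v using b_pos[OF that] by simp
  have g': "bdd_on_spec ?g"
    unfolding bdd_on_spec_def using K b0 by (intro exI[of _ K]) auto
  let ?z = "B f + w"
  have "proj_op U u ?z = ?z"
  proof (rule orthonormal_expansion[OF u_on])
    fix y assume y: "\<And>v. v \<in> U \<Longrightarrow> inner y (u v) = 0"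
    then have "B y = 0" using esB by (simp add: eigensystem_def)
    then show "inner ?z y = 0" using w[OF y] by (simp add: inner_add_left B_commute)
  qed
  then have "op_fun g B ?z = diag_op U u (\<lambda>v. g (b v)) ?z"
    by (subst op_fun_eigensystem[where f = g, OF B esB K]) simp_all
  also have "\<dots> = spec_fun ?g ?z"
    unfolding spec_fun_def diag_op_def[of U u "\<lambda>v. g (b v)"] diag_op_def[of U u "\<lambda>v. ?g (b v)"]
    using b0 by (simp cong: infsum_cong)
  also have "\<dots> = spec_fun ?g (B f) + spec_fun ?g w"
    by (rule linear_add[OF bounded_linear.linear[OF bounded_linear_spec_fun[OF g']]])
  also have "spec_fun ?g (B f) = spec_fun (\<lambda>s. s * ?g s) f"
    by (simp only: mult.commute[of _ "?g _"] spec_fun_mult[OF g' bdd_on_spec_id] spec_fun_id)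
  finally show ?thesis
    unfolding spec_fun_diff[OF bdd_on_spec_const bdd_on_spec_mult[OF bdd_on_spec_id g']] spec_fun_const
    by simp
qed

end

section \<open>Eigenvalue sums and rates\<close>

text \<open>Mean value theorem. The derivative is increasing for \<open>r \<ge> 1\<close> and
  decreasing for \<open>r < 1\<close>; adding its values at both ends of the interval covers both
  cases.\<close>

lemma powr_lipschitz:
  fixes r l M x y :: real
  assumes r: "r > 0" and l: "l > 0" and xy: "0 \<le> x" "x + l \<le> M" "0 \<le> y" "y + l \<le> M"
  shows "\<bar>(x + l) powr r - (y + l) powr r\<bar> \<le> r * (l powr (r - 1) + M powr (r - 1)) * \<bar>x - y\<bar>"
proof -
  have le: "(y + l) powr r - (x + l) powr r \<le> r * (l powr (r - 1) + M powr (r - 1)) * (y - x)"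
    if "0 \<le> x" "x < y" "y + l \<le> M" for x y
  proof -
    have "\<exists>z>x. z < y \<and> (y + l) powr r - (x + l) powr r = (y - x) * (r * (z + l) powr (r - 1))"
    proof (rule MVT2[OF \<open>x < y\<close>])
      fix z assume "x \<le> z"
      then show "((\<lambda>z. (z + l) powr r) has_real_derivative r * (z + l) powr (r - 1)) (at z)"
        using \<open>0 \<le> x\<close> l by (auto intro!: derivative_eq_intros)
    qed
    then obtain z where z: "x < z" "z < y" "(y + l) powr r - (x + l) powr r = (y - x) * (r * (z + l) powr (r - 1))" by blast
    have "(z + l) powr (r - 1) \<le> l powr (r - 1) + M powr (r - 1)"
    proof (cases "r \<ge> 1")
      case True
      then have "(z + l) powr (r - 1) \<le> M powr (r - 1)" using z that l by (intro powr_mono2) auto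
      then show ?thesis by (simp add: add_increasing)
    next
      case False
      then have "(z + l) powr (r - 1) \<le> l powr (r - 1)" using z that l by (intro powr_mono2') auto
      then show ?thesis by (simp add: add_increasing2)
    qed
    then have "(y - x) * (r * (z + l) powr (r - 1)) \<le> (y - x) * (r * (l powr (r - 1) + M powr (r - 1)))"
      using that r by (intro mult_left_mono) auto
    then show ?thesis unfolding z(3) by (simp add: mult_ac)
  qed
  have mono: "(x + l) powr r \<le> (y + l) powr r" if "0 \<le> x" "x \<le> y" for x y
    using that l r by (intro powr_mono2) auto
  consider "x < y" | "x = y" | "y < x" by linarith
  then show ?thesis
  proof cases
    case 1 then show ?thesis using le[of x y] mono[of x y] xy by simp
  next
    case 2 then show ?thesis by simp
  next
    case 3 then show ?thesis using le[of y x] mono[of y x] xy by simp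
  qed
qed

text \<open>Comparison with an integral, done by telescoping: the mean value theorem bounds each
  term by a difference of values of x^(1 - a) / (a - 1). The subtracted endpoint makes the induction
  work.\<close>

lemma sum_powr_tail:
  fixes a :: real
  assumes a: "a > 1" and m: "1 \<le> m" "m \<le> N"
  shows "(\<Sum>i=Suc m..N. real i powr (- a)) \<le> (real m powr (1 - a) - real N powr (1 - a)) / (a - 1)"
  using m(2)
proof (induction N rule: dec_induct)
  case base
  then show ?case by simp
next
  case (step N)
  have N: "real N > 0" using step m by simp
  have "\<exists>z>real N. z < real (Suc N) \<and>
      real (Suc N) powr (1 - a) - real N powr (1 - a) = (real (Suc N) - real N) * ((1 - a) * z powr (- a))"
  proof (rule MVT2)
    fix z assume "real N \<le> z"
    then show "((\<lambda>z. z powr (1 - a)) has_real_derivative (1 - a) * z powr (- a)) (at z)"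
      using N by (auto intro!: derivative_eq_intros)
  qed simp
  then obtain z where z: "real N < z" "z < real (Suc N)"
    "real (Suc N) powr (1 - a) - real N powr (1 - a) = (1 - a) * z powr (- a)" by auto
  have "real (Suc N) powr (- a) \<le> z powr (- a)" using z N a by (intro powr_mono2') auto
  then have "(a - 1) * real (Suc N) powr (- a) \<le> (a - 1) * z powr (- a)" using a by (intro mult_left_mono) auto
  also have "\<dots> = real N powr (1 - a) - real (Suc N) powr (1 - a)" using z(3) by (simp add: algebra_simps)
  finally have "real (Suc N) powr (- a) \<le> (real N powr (1 - a) - real (Suc N) powr (1 - a)) / (a - 1)"
    using a by (simp add: field_simps)
  moreover have "(\<Sum>i=Suc m..Suc N. real i powr (- a)) = (\<Sum>i=Suc m..N. real i powr (- a)) + real (Suc N) powr (- a)"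
    using step by simp
  ultimately show ?case using step.IH by (simp add: diff_divide_distrib)
qed

lemma sum_powr_tail_le:
  fixes a :: real
  assumes a: "a > 1" and m: "1 \<le> m"
  shows "(\<Sum>i=Suc m..N. real i powr (- a)) \<le> real m powr (1 - a) / (a - 1)"
proof (cases "m \<le> N")
  case True
  have "(real m powr (1 - a) - real N powr (1 - a)) / (a - 1) \<le> real m powr (1 - a) / (a - 1)"
    using a by (intro divide_right_mono) auto
  then show ?thesis using sum_powr_tail[OF a m True] by linarith
qed (use a in simp)

lemma sum_powr_le:
  fixes a :: real
  assumes a: "a > 1"
  shows "(\<Sum>i=1..N. real i powr (- a)) \<le> 1 + 1 / (a - 1)"
proof (cases "N \<ge> 1")
  case True
  then have "(\<Sum>i=1..N. real i powr (- a)) = real 1 powr (- a) + (\<Sum>i=Suc 1..N. real i powr (- a))"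
    by (rule sum.atLeast_Suc_atMost)
  then show ?thesis using sum_powr_tail_le[OF a, of 1 N] by simp
qed (use a in simp)

section \<open>Trace and effective dimension under polynomial decay of the eigenvalues\<close>

context
  fixes \<tau> :: "nat \<Rightarrow> real" and b c :: real
  assumes \<tau>: "\<And>i. i \<ge> 1 \<Longrightarrow> 0 < \<tau> i" "\<And>i. i \<ge> 1 \<Longrightarrow> \<tau> i \<le> c * real i powr (- b)"
    and b: "b > 1" and c: "c > 0"
begin

lemma trace_le: "(\<Sum>i=1..N. \<tau> i) \<le> c * (1 + 1 / (b - 1))"
proof -
  have "(\<Sum>i=1..N. \<tau> i) \<le> c * (\<Sum>i=1..N. real i powr (- b))"
    unfolding sum_distrib_left using \<tau>(2) by (intro sum_mono) auto
  also have "\<dots> \<le> c * (1 + 1 / (b - 1))" using c by (intro mult_left_mono sum_powr_le b) auto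
  finally show ?thesis .
qed

text \<open>The sum is cut at \<open>m\<close>, about l^(-1/b), the index near which i^(-b) falls
  below \<open>l\<close>: each term up to \<open>m\<close> is at most 1, each later one at most
  \<open>c / l * i powr (- b)\<close>. Since \<open>x \<ge> 1\<close>, rounding up at most doubles
  \<open>x\<close>.\<close>

lemma effective_dimension_le:
  assumes l: "0 < l" "l \<le> 1"
  shows "(\<Sum>i=1..N. \<tau> i / (\<tau> i + l)) \<le> (2 + c / (b - 1)) * l powr (- (1 / b))"
proof -
  define x where "x = l powr (- (1 / b))"
  define m where "m = nat \<lceil>x\<rceil>"
  have x1: "x \<ge> 1" unfolding x_def using l b by (simp add: powr_minus_divide powr_le1)
  have m: "x \<le> real m" "real m \<le> 2 * x" "1 \<le> m" using x1 unfolding m_def by linarith+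
  have tm: "0 \<le> \<tau> i / (\<tau> i + l)" "\<tau> i / (\<tau> i + l) \<le> 1" "\<tau> i / (\<tau> i + l) \<le> c / l * real i powr (- b)" if "i \<ge> 1" for i
  proof -
    show "0 \<le> \<tau> i / (\<tau> i + l)" "\<tau> i / (\<tau> i + l) \<le> 1" using \<tau>(1)[OF that] l by auto
    have "\<tau> i / (\<tau> i + l) \<le> \<tau> i / l" using \<tau>(1)[OF that] l by (intro divide_left_mono) auto
    also have "\<dots> \<le> (c * real i powr (- b)) / l" using \<tau>(2)[OF that] l by (intro divide_right_mono) auto
    finally show "\<tau> i / (\<tau> i + l) \<le> c / l * real i powr (- b)" by simp
  qed
  have "(\<Sum>i=1..N. \<tau> i / (\<tau> i + l)) \<le> (\<Sum>i\<in>{1..m} \<union> {Suc m..N}. \<tau> i / (\<tau> i + l))"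
    using tm(1) by (intro sum_mono2) auto
  also have "\<dots> = (\<Sum>i=1..m. \<tau> i / (\<tau> i + l)) + (\<Sum>i=Suc m..N. \<tau> i / (\<tau> i + l))"
    by (intro sum.union_disjoint) auto
  also have "\<dots> \<le> (\<Sum>i=1..m. 1) + (\<Sum>i=Suc m..N. c / l * real i powr (- b))"
    using tm(2,3) by (intro add_mono sum_mono) auto
  also have "\<dots> \<le> 2 * x + c / l * (x powr (1 - b) / (b - 1))"
  proof (intro add_mono)
    have "(\<Sum>i=Suc m..N. real i powr (- b)) \<le> real m powr (1 - b) / (b - 1)"
      by (rule sum_powr_tail_le[OF b m(3)])
    also have "\<dots> \<le> x powr (1 - b) / (b - 1)"
      using m(1) x1 b by (intro divide_right_mono powr_mono2') auto
    finally show "(\<Sum>i=Suc m..N. c / l * real i powr (- b)) \<le> c / l * (x powr (1 - b) / (b - 1))"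
      unfolding sum_distrib_left[symmetric] using c l by (intro mult_left_mono) auto
  qed (use m(2) in simp)
  finally have bound: "(\<Sum>i=1..N. \<tau> i / (\<tau> i + l)) \<le> 2 * x + c / l * (x powr (1 - b) / (b - 1))" .
  have "x powr (1 - b) / l = x"
  proof -
    have "- (1 / b) * (1 - b) = 1 - 1 / b" using b by (simp add: divide_simps)
    then have "x powr (1 - b) = l powr (1 - 1 / b)"
      unfolding x_def powr_powr by (simp only:)
    also have "\<dots> = l * x" unfolding x_def using l by (simp add: powr_diff powr_minus_divide)
    finally show ?thesis using l by simp
  qed
  moreover have "c / l * (x powr (1 - b) / (b - 1)) = c / (b - 1) * (x powr (1 - b) / l)"
    by (simp add: mult.commute)
  ultimately have "c / l * (x powr (1 - b) / (b - 1)) = c / (b - 1) * x" by (simp only:)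
  with bound show ?thesis unfolding x_def by (simp add: algebra_simps)
qed

text \<open>For \<open>\<mu> = K * l\<close> there is no bound by 1. A ratio below 1 is at most its
  power \<open>\<theta>\<close>, which gives an estimate for every \<open>\<mu>\<close> at the price
  of an exponent larger than 1/b. This \<open>\<theta>\<close> keeps
  \<open>b * \<theta> > 1\<close>, so the series converges, and 2\<theta> = 1 + 1/b is still within
  what 1/n compensates.\<close>

lemma effective_dimension_le':
  assumes \<mu>: "0 < \<mu>"
  defines "\<theta> \<equiv> (1 + 1 / b) / 2"
  shows "(\<Sum>i=1..N. \<tau> i / (\<tau> i + \<mu>)) \<le> c powr \<theta> * (1 + 2 / (b - 1)) * \<mu> powr (- \<theta>)"
proof -
  have \<theta>: "0 < \<theta>" "\<theta> \<le> 1" "b * \<theta> = (b + 1) / 2" using b unfolding \<theta>_def by (auto simp: field_simps)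
  have "\<tau> i / (\<tau> i + \<mu>) \<le> c powr \<theta> * \<mu> powr (- \<theta>) * real i powr (- ((b + 1) / 2))" if i: "i \<ge> 1" for i
  proof -
    have "\<tau> i / (\<tau> i + \<mu>) \<le> (\<tau> i / (\<tau> i + \<mu>)) powr \<theta>"
      using \<tau>(1)[OF i] \<mu> \<theta> powr_mono'[of \<theta> 1 "\<tau> i / (\<tau> i + \<mu>)"] by simp
    also have "\<dots> \<le> (c * real i powr (- b) / \<mu>) powr \<theta>"
    proof (intro powr_mono2)
      have "\<tau> i / (\<tau> i + \<mu>) \<le> \<tau> i / \<mu>" using \<tau>(1)[OF i] \<mu> by (intro divide_left_mono) auto
      also have "\<dots> \<le> c * real i powr (- b) / \<mu>" using \<tau>(2)[OF i] \<mu> by (intro divide_right_mono) auto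
      finally show "\<tau> i / (\<tau> i + \<mu>) \<le> c * real i powr (- b) / \<mu>" .
    qed (use \<tau>(1)[OF i] \<mu> \<theta> in auto)
    also have "\<dots> = c powr \<theta> * \<mu> powr (- \<theta>) * real i powr (- (b * \<theta>))"
      using c \<mu> i by (simp add: powr_mult powr_divide powr_powr powr_minus_divide)
    finally show ?thesis by (simp add: \<theta>(3))
  qed
  then have "(\<Sum>i=1..N. \<tau> i / (\<tau> i + \<mu>)) \<le> c powr \<theta> * \<mu> powr (- \<theta>) * (\<Sum>i=1..N. real i powr (- ((b + 1) / 2)))"
    unfolding sum_distrib_left by (intro sum_mono) auto
  also have "\<dots> \<le> c powr \<theta> * \<mu> powr (- \<theta>) * (1 + 1 / ((b + 1) / 2 - 1))"
    using b by (intro mult_left_mono sum_powr_le) auto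
  also have "1 / ((b + 1) / 2 - 1) = 2 / (b - 1)" using b by (simp add: field_simps)
  finally show ?thesis by (simp add: mult_ac)
qed

end

text \<open>For \<open>x \<le> l\<close> the bound \<open>D\<close> on the residual suffices; for
  \<open>x > l\<close> the surplus power \<open>x powr (r - p)\<close> is at most
  \<open>l powr (r - p)\<close>.\<close>

lemma qualifies_mono:
  assumes reg: "reg_family \<eta> g A B D" and q: "qualifies \<eta> g p" and r: "0 < r" "r \<le> p"
  shows "qualifies \<eta> g r"
proof -
  obtain w where w: "\<And>l x. 0 < l \<Longrightarrow> ereal l \<le> \<eta> \<Longrightarrow> 0 < x \<Longrightarrow> ereal x \<le> \<eta> \<Longrightarrow>
      \<bar>1 - x * g l x\<bar> * x powr p \<le> w * l powr p" using q unfolding qualifies_def by blast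
  have p: "p > 0" using r by simp
  have "\<bar>1 - x * g l x\<bar> * x powr r \<le> (max D \<bar>w\<bar>) * l powr r"
    if lx: "0 < l" "ereal l \<le> \<eta>" "0 < x" "ereal x \<le> \<eta>" for l x
  proof -
    let ?\<rho> = "\<bar>1 - x * g l x\<bar>"
    have D: "?\<rho> \<le> D" using reg lx unfolding reg_family_def by blast
    show ?thesis
    proof (cases "x \<le> l")
      case True
      then have "?\<rho> * x powr r \<le> D * l powr r" using D lx r by (intro mult_mono powr_mono2) auto
      also have "\<dots> \<le> (max D \<bar>w\<bar>) * l powr r" by (intro mult_right_mono) auto
      finally show ?thesis .
    next
      case False
      have "?\<rho> * x powr r = ?\<rho> * x powr p * x powr (r - p)" using lx by (simp add: powr_diff)
      also have "\<dots> \<le> (\<bar>w\<bar> * l powr p) * l powr (r - p)"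
      proof (rule mult_mono)
        have "?\<rho> * x powr p \<le> w * l powr p" by (rule w[OF lx])
        also have "\<dots> \<le> \<bar>w\<bar> * l powr p" by (intro mult_right_mono) auto
        finally show "?\<rho> * x powr p \<le> \<bar>w\<bar> * l powr p" .
        show "x powr (r - p) \<le> l powr (r - p)" using False lx r by (intro powr_mono2') auto
      qed auto
      also have "\<dots> = \<bar>w\<bar> * l powr r" using lx by (simp add: powr_diff)
      also have "\<dots> \<le> (max D \<bar>w\<bar>) * l powr r" by (intro mult_right_mono) auto
      finally show ?thesis .
    qed
  qed
  then show ?thesis unfolding qualifies_def by blast
qed

lemma is_qualification_qualifies:
  assumes reg: "reg_family \<eta> g A B D" and q: "is_qualification \<eta> g \<nu>" and r: "0 < r" "ereal r \<le> \<nu>"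
  shows "qualifies \<eta> g r"
  using q qualifies_mono[OF reg _ r(1)] r unfolding is_qualification_def by auto

section \<open>The deterministic error bound in powers of the regularization parameter\<close>

context perturbed_calculus
begin

text \<open>Counting powers of \<open>l\<close>: in the variance l^(r + 1/2) meets l^(-1/2), in the
  low bias l^(r - 1/2) meets l^(1/2), and in the high bias the Lipschitz constant meets the
  deviation. The constants of both bias cases are added, so that one expression serves for every
  \<open>r\<close>.\<close>

lemma error_rate:
  fixes f w :: 'k and g :: "real \<Rightarrow> real" and h :: "'i \<Rightarrow> real"
    and s r l hn K Ac Bc D w1 wr Cq CH :: real
  assumes src: "((\<lambda>i. (\<tau> i powr s * h i) *\<^sub>R \<phi> i) has_sum f) I"
    and h: "\<And>F. finite F \<Longrightarrow> F \<subseteq> I \<Longrightarrow> (\<Sum>i\<in>F. (h i)\<^sup>2) \<le> hn\<^sup>2" and hn: "hn \<ge> 0"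
    and r: "0 < r" "r \<le> s" and l: "0 < l" "l \<le> 1" and \<mu>_eq: "\<mu> = K * l" and K: "K \<ge> 1"
    and wU: "\<And>x. (\<And>v. v \<in> U \<Longrightarrow> inner x (u v) = 0) \<Longrightarrow> inner w x = 0"
    and wI: "\<And>x. (\<And>i. i \<in> I \<Longrightarrow> inner x (\<phi> i) = 0) \<Longrightarrow> inner w x = 0"
    and Q: "\<And>F. finite F \<Longrightarrow> F \<subseteq> I \<Longrightarrow> (\<Sum>i\<in>F. (inner w (\<phi> i))\<^sup>2 / (\<tau> i + l)) \<le> (Cq * l powr (r + 1/2))\<^sup>2"
    and H_eq: "H = CH * l powr (r + 1/2)" and CH: "CH \<ge> 0" and Cq: "Cq \<ge> 0"
    and gA: "\<And>v. v \<in> U \<Longrightarrow> \<bar>b v * g (b v)\<bar> \<le> Ac" and gB: "\<And>v. v \<in> U \<Longrightarrow> \<bar>g (b v)\<bar> \<le> Bc / l"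
    and gD: "\<And>v. v \<in> U \<Longrightarrow> \<bar>1 - b v * g (b v)\<bar> \<le> D"
    and g1: "\<And>v. v \<in> U \<Longrightarrow> \<bar>1 - b v * g (b v)\<bar> * b v powr (1/2) \<le> w1 * l powr (1/2)"
    and gr: "\<And>v. v \<in> U \<Longrightarrow> \<bar>1 - b v * g (b v)\<bar> * b v powr r \<le> wr * l powr r"
    and nn: "Ac \<ge> 0" "Bc \<ge> 0" "D \<ge> 0" "w1 \<ge> 0" "wr \<ge> 0"
  shows "norm (f - op_fun g B (B f + w)) \<le>
     (sqrt 2 * hn * t0 powr (s - r) * sqrt (w1\<^sup>2 + K * (D + 1)\<^sup>2)
      + ((D + 1) * (r * (1 + (3/2 * t0 + K / 2 + 1) powr (r - 1))) * CH + 2 powr r * (wr + (D + 1))) * (t0 powr (s - r) * hn)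
      + sqrt 2 * Cq * sqrt (Ac * Bc + K * Bc\<^sup>2)) * l powr r"
proof -
  define g' where "g' x = (if x = 0 then 0 else g x)" for x
  define \<rho> where "\<rho> x = 1 - x * g' x" for x
  let ?k = "t0 powr (s - r)" and ?M = "3/2 * t0 + K / 2 + 1"
  have l\<mu>: "l \<le> \<mu>" unfolding \<mu>_eq using l K by simp
  have b0: "b v \<noteq> 0" if "v \<in> U" for v using b_pos[OF that] by simp
  have \<rho>b: "\<rho> (b v) = 1 - b v * g (b v)" and g'b: "g' (b v) = g (b v)" if "v \<in> U" for v
    using b0[OF that] by (simp_all add: \<rho>_def g'_def)
  have \<rho>0: "\<rho> 0 = 1" and g'0: "g' 0 = 0" by (simp_all add: \<rho>_def g'_def)
  have g: "bdd_on_spec g" unfolding bdd_on_spec_def using gB by blast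
  have g': "bdd_on_spec g'" unfolding bdd_on_spec_def using gB g'b by fastforce
  have \<rho>: "bdd_on_spec \<rho>" unfolding bdd_on_spec_def using gD \<rho>b by fastforce
  have sl: "(sqrt l)\<^sup>2 = l" using l by simp
  have pl: "l powr (1/2) = sqrt l" using l by (simp add: powr_half_sqrt)

  have var: "norm (spec_fun g' w) \<le> sqrt 2 * Cq * sqrt (Ac * Bc + K * Bc\<^sup>2) * l powr r"
  proof -
    \<comment> \<open>Origin: b g(b)^2 is at most \<open>Ac\<close> times \<open>Bc / l\<close>, and
      \<mu> g(b)^2 is at most \<open>K * l\<close> times the square of
      \<open>Bc / l\<close>.\<close>
    let ?c = "sqrt (Ac * Bc + K * Bc\<^sup>2) / sqrt l"
    have c0: "0 \<le> Ac * Bc + K * Bc\<^sup>2" using nn K by simp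
    have c2: "?c\<^sup>2 = (Ac * Bc + K * Bc\<^sup>2) / l" using c0 l by (simp add: power_divide)
    have "(b v + \<mu>) * (g' (b v))\<^sup>2 \<le> ?c\<^sup>2" if v: "v \<in> U" for v
    proof -
      have "b v * (g (b v))\<^sup>2 \<le> \<bar>b v * g (b v)\<bar> * \<bar>g (b v)\<bar>"
        using b_pos[OF v] by (simp add: abs_mult power2_eq_square mult.assoc flip: abs_mult)
      also have "\<dots> \<le> Ac * (Bc / l)" using gA[OF v] gB[OF v] nn by (intro mult_mono) auto
      finally have 1: "b v * (g (b v))\<^sup>2 \<le> Ac * Bc / l" by simp
      have "\<bar>g (b v)\<bar>\<^sup>2 \<le> (Bc / l)\<^sup>2" using gB[OF v] by (intro power_mono) auto
      then have "\<mu> * (g (b v))\<^sup>2 \<le> \<mu> * (Bc / l)\<^sup>2" using \<mu> by (intro mult_left_mono) auto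
      also have "\<dots> = K * Bc\<^sup>2 / l" using l by (simp add: \<mu>_eq power2_eq_square)
      finally show ?thesis unfolding c2 g'b[OF v] using 1 by (simp add: distrib_right add_divide_distrib)
    qed
    moreover have "\<mu> * (g' 0)\<^sup>2 \<le> ?c\<^sup>2" by (simp add: g'0)
    moreover have "?c \<ge> 0" using c0 l by simp
    moreover have "0 \<le> Cq * l powr (r + 1/2)" using Cq by simp
    ultimately have "norm (spec_fun g' w) \<le> sqrt 2 * (Cq * l powr (r + 1/2)) * ?c"
      by (intro variance_bound[OF wI l(1) l\<mu> _ Q g'])
    also have "l powr (r + 1/2) = l powr r * sqrt l" by (simp add: powr_add pl)
    finally show ?thesis using l by (simp add: mult_ac)
  qed

  have bias: "norm (spec_fun \<rho> f) \<le> (sqrt 2 * hn * ?k * sqrt (w1\<^sup>2 + K * (D + 1)\<^sup>2)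
      + ((D + 1) * (r * (1 + ?M powr (r - 1))) * CH + 2 powr r * (wr + (D + 1))) * (?k * hn)) * l powr r"
    (is "_ \<le> (?low + ?high) * _")
  proof (cases "r \<le> 1/2")
    case True
    \<comment> \<open>Origin: qualification 1/2 gives b \<rho>(b)^2 \<le> w1^2 l, and \<mu> = K l
      supplies the other summand. \<open>D + 1\<close> replaces \<open>D\<close> because
      \<open>\<rho> 0 = 1\<close> need not be below \<open>D\<close>.\<close>
    let ?c = "sqrt (w1\<^sup>2 + K * (D + 1)\<^sup>2) * sqrt l"
    have c0: "0 \<le> w1\<^sup>2 + K * (D + 1)\<^sup>2" using nn K by simp
    have c2: "?c\<^sup>2 = (w1\<^sup>2 + K * (D + 1)\<^sup>2) * l" using c0 l by (simp add: power_mult_distrib)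
    have "(b v + \<mu>) * (\<rho> (b v))\<^sup>2 \<le> ?c\<^sup>2" if v: "v \<in> U" for v
    proof -
      have "(\<bar>\<rho> (b v)\<bar> * b v powr (1/2))\<^sup>2 \<le> (w1 * l powr (1/2))\<^sup>2"
        using g1[OF v] \<rho>b[OF v] by (intro power_mono) auto
      then have 1: "b v * (\<rho> (b v))\<^sup>2 \<le> w1\<^sup>2 * l"
        using b_pos[OF v] l by (simp add: power_mult_distrib powr_half_sqrt less_imp_le mult.commute)
      have "\<bar>\<rho> (b v)\<bar>\<^sup>2 \<le> (D + 1)\<^sup>2" using gD[OF v] \<rho>b[OF v] by (intro power_mono) auto
      then have "\<mu> * (\<rho> (b v))\<^sup>2 \<le> \<mu> * (D + 1)\<^sup>2" using \<mu> by (intro mult_left_mono) auto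
      then show ?thesis unfolding c2 using 1 by (simp add: \<mu>_eq algebra_simps)
    qed
    moreover have "\<mu> * (\<rho> 0)\<^sup>2 \<le> ?c\<^sup>2"
    proof -
      have "K * l * 1 \<le> (K * l) * (D + 1)\<^sup>2" using K l nn by (intro mult_left_mono) (auto simp: one_le_power)
      then show ?thesis unfolding c2 \<rho>0 \<mu>_eq using l by (simp add: algebra_simps add_increasing)
    qed
    moreover have "?c \<ge> 0" using c0 l by simp
    ultimately have "norm (spec_fun \<rho> f) \<le> sqrt 2 * hn * ?k * l powr (r - 1/2) * ?c"
      using bias_bound_low[OF src h hn r l(1) l\<mu> \<rho> _ True, of ?c] by blast
    also have "\<dots> = ?low * (l powr (r - 1/2) * sqrt l)" by (simp add: mult_ac)
    also have "l powr (r - 1/2) * sqrt l = l powr r" unfolding pl[symmetric] powr_add[symmetric] by simp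
    also have "?low * l powr r \<le> (?low + ?high) * l powr r"
    proof (intro mult_right_mono)
      have "0 \<le> ?high" using nn CH r hn by (intro mult_nonneg_nonneg add_nonneg_nonneg) auto
      then show "?low \<le> ?low + ?high" by simp
    qed simp
    finally show ?thesis .
  next
    case False
    let ?L = "r * (l powr (r - 1) + ?M powr (r - 1))" and ?c = "2 powr r * (wr + (D + 1)) * l powr r"
    have MR: "x + l \<le> ?M" if "x \<le> 3/2 * t0 + \<mu> / 2" for x
    proof -
      have "K * l \<le> K * 1" using K l by (intro mult_left_mono) auto
      then show ?thesis using that l unfolding \<mu>_eq by simp
    qed
    have "norm (spec_fun \<rho> f) \<le> ((D + 1) * ?L * H + ?c) * (?k * hn)"
    proof (rule bias_bound_high[OF src h hn r l(1) l\<mu> \<rho>])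
      show "?L \<ge> 0" using r by simp
      show "\<bar>(x + l) powr r - (y + l) powr r\<bar> \<le> ?L * \<bar>x - y\<bar>"
        if "0 \<le> x" "x \<le> 3/2 * t0 + \<mu> / 2" "0 \<le> y" "y \<le> 3/2 * t0 + \<mu> / 2" for x y
        using powr_lipschitz[OF r(1) l(1) that(1) MR[OF that(2)] that(3) MR[OF that(4)]] .
      show "\<bar>\<rho> (b v)\<bar> \<le> D + 1" if v: "v \<in> U" for v using gD[OF v] \<rho>b[OF v] by simp
      show "\<bar>\<rho> 0\<bar> \<le> D + 1" using \<rho>0 nn by simp
      have two: "1 \<le> 2 powr r" using r by (simp add: ge_one_powr_ge_zero)
      show "\<bar>\<rho> 0\<bar> * l powr r \<le> ?c"
      proof (intro mult_right_mono)
        have "1 * 1 \<le> 2 powr r * (wr + (D + 1))" using two nn by (intro mult_mono) auto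
        then show "\<bar>\<rho> 0\<bar> \<le> 2 powr r * (wr + (D + 1))" by (simp add: \<rho>0)
      qed simp
      show "\<bar>\<rho> (b v)\<bar> * (b v + l) powr r \<le> ?c" if v: "v \<in> U" for v
      proof -
        have "(b v + l) powr r \<le> 2 powr r * (b v powr r + l powr r)"
        proof (cases "b v \<le> l")
          case True
          then have "(b v + l) powr r \<le> (2 * l) powr r" using b_pos[OF v] l r by (intro powr_mono2) auto
          also have "\<dots> = 2 powr r * l powr r" using l by (simp add: powr_mult)
          also have "\<dots> \<le> 2 powr r * (b v powr r + l powr r)" by (intro mult_left_mono) auto
          finally show ?thesis .
        next
          case False
          then have "(b v + l) powr r \<le> (2 * b v) powr r" using b_pos[OF v] l r by (intro powr_mono2) auto
          also have "\<dots> = 2 powr r * b v powr r" using b_pos[OF v] by (simp add: powr_mult)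
          also have "\<dots> \<le> 2 powr r * (b v powr r + l powr r)" by (intro mult_left_mono) auto
          finally show ?thesis .
        qed
        then have "\<bar>\<rho> (b v)\<bar> * (b v + l) powr r \<le> \<bar>\<rho> (b v)\<bar> * (2 powr r * (b v powr r + l powr r))"
          by (intro mult_left_mono) auto
        also have "\<dots> = 2 powr r * (\<bar>\<rho> (b v)\<bar> * b v powr r + \<bar>\<rho> (b v)\<bar> * l powr r)" by (simp add: algebra_simps)
        also have "\<dots> \<le> 2 powr r * (wr * l powr r + (D + 1) * l powr r)"
          using gr[OF v] gD[OF v] \<rho>b[OF v] by (intro mult_left_mono add_mono mult_right_mono) auto
        also have "\<dots> = ?c" by (simp add: algebra_simps)
        finally show ?thesis .
      qed
    qed
    also have "?L * H \<le> (r * (1 + ?M powr (r - 1))) * CH * l powr r"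
    proof -
      \<comment> \<open>The exponents add up to 2r - 1/2, which is at least r exactly for r \<ge>
        1/2; recall \<open>l \<le> 1\<close>.\<close>
      have 1: "l powr (r - 1) * l powr (r + 1/2) \<le> l powr r"
        unfolding powr_add[symmetric] using l False by (intro powr_mono') auto
      have 2: "l powr (r + 1/2) \<le> l powr r" using l by (intro powr_mono') auto
      have "l powr (r - 1) * l powr (r + 1/2) + ?M powr (r - 1) * l powr (r + 1/2)
          \<le> l powr r + ?M powr (r - 1) * l powr r"
        using 1 2 by (intro add_mono mult_left_mono) auto
      then have "(r * CH) * (l powr (r - 1) * l powr (r + 1/2) + ?M powr (r - 1) * l powr (r + 1/2))
          \<le> (r * CH) * (l powr r + ?M powr (r - 1) * l powr r)"
        using r CH by (intro mult_left_mono) auto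
      then show ?thesis unfolding H_eq by (simp add: algebra_simps)
    qed
    then have "((D + 1) * ?L * H + ?c) * (?k * hn)
        \<le> ((D + 1) * ((r * (1 + ?M powr (r - 1))) * CH * l powr r) + ?c) * (?k * hn)"
      unfolding mult.assoc[of "D + 1"] using nn hn
      by (intro mult_right_mono add_right_mono mult_left_mono) auto
    also have "\<dots> = ?high * l powr r" by (simp add: algebra_simps)
    also have "\<dots> \<le> (?low + ?high) * l powr r"
    proof (intro mult_right_mono)
      have "0 \<le> ?low" using nn hn K by (intro mult_nonneg_nonneg) auto
      then show "?high \<le> ?low + ?high" by simp
    qed simp
    finally show ?thesis .
  qed
  have "norm (f - op_fun g B (B f + w)) = norm (spec_fun \<rho> f - spec_fun g' w)"
    using error_decomposition[OF wU g, of f] by (simp add: \<rho>_def[abs_def] g'_def[abs_def])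
  also have "\<dots> \<le> norm (spec_fun \<rho> f) + norm (spec_fun g' w)" by (rule norm_triangle_ineq4)
  also have "\<dots> \<le> (?k * 0 + (sqrt 2 * hn * ?k * sqrt (w1\<^sup>2 + K * (D + 1)\<^sup>2)
      + ((D + 1) * (r * (1 + ?M powr (r - 1))) * CH + 2 powr r * (wr + (D + 1))) * (?k * hn))) * l powr r
      + sqrt 2 * Cq * sqrt (Ac * Bc + K * Bc\<^sup>2) * l powr r"
    using add_mono[OF bias var] by simp
  finally show ?thesis by (simp add: algebra_simps)
qed

end

section \<open>The regression sample\<close>

context prob_space
begin

text \<open>Markov's inequality, for extended values because the infinite sums it is applied to may
  be infinite at some outcomes.\<close>

lemma prob_le_ge_of_nn_integral:
  assumes u: "u \<in> borel_measurable M" and e: "(\<integral>\<^sup>+\<omega>. u \<omega> \<partial>M) \<le> ennreal e"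
    and t: "0 < t" and p: "e \<le> t * p" "0 \<le> p"
  shows "prob {\<omega>\<in>space M. u \<omega> \<le> ennreal t} \<ge> 1 - p"
proof -
  let ?B = "{\<omega>\<in>space M. \<not> u \<omega> \<le> ennreal t}"
  have B: "?B \<in> sets M" using u by measurable
  have "ennreal (t * prob ?B) = (\<integral>\<^sup>+\<omega>. ennreal t * indicator ?B \<omega> \<partial>M)"
    using B t by (simp add: nn_integral_cmult_indicator emeasure_eq_measure ennreal_mult)
  also have "\<dots> \<le> (\<integral>\<^sup>+\<omega>. u \<omega> \<partial>M)"
    by (intro nn_integral_mono) (auto simp: indicator_def)
  also have "\<dots> \<le> ennreal (t * p)" using e p(1) by (meson ennreal_leI order_trans)
  finally have "t * prob ?B \<le> t * p" using t p by (simp add: ennreal_le_iff)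
  then have "prob ?B \<le> p" using t by simp
  moreover have "prob {\<omega>\<in>space M. u \<omega> \<le> ennreal t} = 1 - prob ?B"
  proof -
    have "{\<omega>\<in>space M. u \<omega> \<le> ennreal t} = space M - ?B" by auto
    then show ?thesis using prob_compl[OF B] by simp
  qed
  ultimately show ?thesis by simp
qed

lemma integrable_mult_of_squares:
  fixes f g :: "'a \<Rightarrow> real"
  assumes [measurable]: "f \<in> borel_measurable M" "g \<in> borel_measurable M"
    and "integrable M (\<lambda>x. (f x)\<^sup>2)" "integrable M (\<lambda>x. (g x)\<^sup>2)"
  shows "integrable M (\<lambda>x. f x * g x)"
proof (rule Bochner_Integration.integrable_bound)
  show "integrable M (\<lambda>x. (f x)\<^sup>2 + (g x)\<^sup>2)" using assms by simp
  have "\<bar>u * v\<bar> \<le> u\<^sup>2 + v\<^sup>2" for u v :: real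
    using sum_squares_bound[of "\<bar>u\<bar>" "\<bar>v\<bar>"] mult_nonneg_nonneg[OF abs_ge_zero[of u] abs_ge_zero[of v]]
    unfolding abs_mult power2_abs by linarith
  then show "AE x in M. norm (f x * g x) \<le> norm ((f x)\<^sup>2 + (g x)\<^sup>2)" by simp
qed measurable

lemma indep_sum_square:
  fixes V :: "nat \<Rightarrow> 'a \<Rightarrow> real"
  assumes V: "indep_vars (\<lambda>_. borel) V {1..}"
    and sq: "\<And>k. k \<ge> 1 \<Longrightarrow> integrable M (\<lambda>\<omega>. (V k \<omega>)\<^sup>2)"
    and mean: "\<And>k. k \<ge> 1 \<Longrightarrow> expectation (V k) = 0"
    and var: "\<And>k. k \<ge> 1 \<Longrightarrow> expectation (\<lambda>\<omega>. (V k \<omega>)\<^sup>2) = v"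
  shows "integrable M (\<lambda>\<omega>. (\<Sum>k=1..n. V k \<omega>)\<^sup>2) \<and> expectation (\<lambda>\<omega>. (\<Sum>k=1..n. V k \<omega>)\<^sup>2) = real n * v"
proof (induction n)
  case 0
  then show ?case by simp
next
  case (Suc n)
  let ?S = "\<lambda>\<omega>. \<Sum>k=1..n. V k \<omega>"
  have Vm: "V k \<in> borel_measurable M" if "k \<ge> 1" for k
    using V that unfolding indep_vars_def by auto
  have Sm: "?S \<in> borel_measurable M" using Vm by (intro borel_measurable_sum) auto
  have Vi: "integrable M (V k)" if "k \<ge> 1" for k
    using square_integrable_imp_integrable[OF Vm[OF that] sq[OF that]] .
  have Si: "integrable M ?S" using Vi by (intro Bochner_Integration.integrable_sum) auto
  have "indep_var borel (V (Suc n)) borel ?S"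
    using V by (intro indep_vars_sum) (auto intro: indep_vars_subset)
  then have "expectation (\<lambda>\<omega>. V (Suc n) \<omega> * ?S \<omega>) = 0" "integrable M (\<lambda>\<omega>. V (Suc n) \<omega> * ?S \<omega>)"
    using indep_var_lebesgue_integral[of "V (Suc n)" ?S] indep_var_integrable[of "V (Suc n)" ?S] Vi[of "Suc n"] Si mean[of "Suc n"]
    by auto
  moreover have "(\<lambda>\<omega>. (\<Sum>k=1..Suc n. V k \<omega>)\<^sup>2) = (\<lambda>\<omega>. (?S \<omega>)\<^sup>2 + (V (Suc n) \<omega>)\<^sup>2 + 2 * (V (Suc n) \<omega> * ?S \<omega>))"
    by (simp add: fun_eq_iff power2_sum algebra_simps)
  ultimately show ?case
    using Suc.IH sq[of "Suc n"] var[of "Suc n"] by (simp add: algebra_simps)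
qed

end

locale regression_sample = prob_space M
  for M :: "'w measure" +
  fixes X :: "'w \<Rightarrow> 'h::{real_inner, banach, second_countable_topology}" and \<epsilon> :: "'w \<Rightarrow> real"
    and Xs :: "nat \<Rightarrow> 'w \<Rightarrow> 'h" and Ys :: "nat \<Rightarrow> 'w \<Rightarrow> real"
    and \<beta> :: 'h and \<sigma> d1 :: real
  assumes X [measurable]: "X \<in> borel_measurable M"
    and X_sq: "integrable M (\<lambda>\<omega>. (norm (X \<omega>))\<^sup>2)"
    and eps [measurable]: "\<epsilon> \<in> borel_measurable M"
    and eps_sq: "integrable M (\<lambda>\<omega>. (\<epsilon> \<omega>)\<^sup>2)"
    and eps_mean: "expectation \<epsilon> = 0" and eps_var: "variance \<epsilon> = \<sigma>\<^sup>2"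
    and X_eps: "indep_rv M X \<epsilon>"
    and sample_indep: "indep_vars (\<lambda>_. borel) (\<lambda>i \<omega>. (Xs i \<omega>, Ys i \<omega>)) {1..}"
    and sample_distr: "\<forall>i\<ge>1. distr M borel (\<lambda>\<omega>. (Xs i \<omega>, Ys i \<omega>)) = distr M borel (\<lambda>\<omega>. (X \<omega>, inner (X \<omega>) \<beta> + \<epsilon> \<omega>))"
    and d1: "d1 > 0"
    and fourth: "\<forall>f. integrable M (\<lambda>\<omega>. (inner (X \<omega>) f) ^ 4) \<and>
             expectation (\<lambda>\<omega>. (inner (X \<omega>) f) ^ 4) \<le> d1 * (expectation (\<lambda>\<omega>. (inner (X \<omega>) f)\<^sup>2))\<^sup>2"
begin

abbreviation C :: "'h \<Rightarrow> 'h" where "C \<equiv> cov_op M X"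

lemma inner_X_sq: "integrable M (\<lambda>\<omega>. (inner (X \<omega>) f)\<^sup>2)"
proof (rule Bochner_Integration.integrable_bound)
  show "integrable M (\<lambda>\<omega>. (norm (X \<omega>))\<^sup>2 * (norm f)\<^sup>2)" using X_sq by simp
  have "(inner x f)\<^sup>2 \<le> (norm x)\<^sup>2 * (norm f)\<^sup>2" for x
    unfolding power2_norm_eq_inner by (rule Cauchy_Schwarz_ineq)
  then show "AE \<omega> in M. norm ((inner (X \<omega>) f)\<^sup>2) \<le> norm ((norm (X \<omega>))\<^sup>2 * (norm f)\<^sup>2)" by simp
qed measurable

lemma tens_integrable: "integrable M (\<lambda>\<omega>. tens (X \<omega>) f)"
proof (rule Bochner_Integration.integrable_bound)
  show "integrable M (\<lambda>\<omega>. (norm (X \<omega>))\<^sup>2 * norm f)" using X_sq by simp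
  have *: "\<bar>inner x f\<bar> * norm x \<le> (norm x * norm f) * norm x" for x
    by (intro mult_right_mono Cauchy_Schwarz_ineq2) auto
  have "norm (tens (X \<omega>) f) \<le> norm ((norm (X \<omega>))\<^sup>2 * norm f)" for \<omega>
    using *[of "X \<omega>"] by (simp add: tens_def power2_eq_square mult_ac)
  then show "AE \<omega> in M. norm (tens (X \<omega>) f) \<le> norm ((norm (X \<omega>))\<^sup>2 * norm f)" by simp
qed (unfold tens_def, measurable)

lemma inner_cov: "inner (C f) v = expectation (\<lambda>\<omega>. inner (X \<omega>) f * inner (X \<omega>) v)"
proof -
  have "expectation (\<lambda>\<omega>. inner (tens (X \<omega>) f) v) = inner (C f) v"
    unfolding cov_op_def by (rule integral_inner_left) (rule tens_integrable)
  then show ?thesis by (simp add: tens_def)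
qed

lemma bounded_linear_cov: "bounded_linear C"
proof (rule bounded_linear_intro)
  show "C (x + y) = C x + C y" for x y
    unfolding cov_op_def Bochner_Integration.integral_add[OF tens_integrable tens_integrable, symmetric]
    by (simp add: tens_def inner_add_right scaleR_add_left)
  show "C (r *\<^sub>R x) = r *\<^sub>R C x" for r x
    unfolding cov_op_def integral_scaleR_right[symmetric] by (simp add: tens_def)
  show "norm (C x) \<le> norm x * expectation (\<lambda>\<omega>. (norm (X \<omega>))\<^sup>2)" for x
  proof -
    have "norm (C x) \<le> expectation (\<lambda>\<omega>. norm (tens (X \<omega>) x))"
      unfolding cov_op_def by (rule integral_norm_bound)
    also have "\<dots> \<le> expectation (\<lambda>\<omega>. norm x * (norm (X \<omega>))\<^sup>2)"
    proof (rule integral_mono)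
      show "norm (tens (X \<omega>) x) \<le> norm x * (norm (X \<omega>))\<^sup>2" for \<omega>
        using mult_right_mono[OF Cauchy_Schwarz_ineq2[of "X \<omega>" x], of "norm (X \<omega>)"]
        by (simp add: tens_def power2_eq_square mult_ac)
    qed (use tens_integrable X_sq in auto)
    finally show ?thesis by simp
  qed
qed

lemma cov_commute: "inner (C x) y = inner x (C y)"
  using inner_cov[of x y] inner_cov[of y x] by (simp add: inner_commute mult.commute)

lemma inner_cov_self: "inner (C x) x = expectation (\<lambda>\<omega>. (inner (X \<omega>) x)\<^sup>2)"
  by (simp add: inner_cov power2_eq_square)

lemma cov_pos: "0 \<le> inner (C x) x"
  by (simp add: inner_cov_self)

lemma cov_zero_AE:
  assumes "inner (C x) x = 0"
  shows "AE \<omega> in M. inner (X \<omega>) x = 0"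
  using integral_nonneg_eq_0_iff_AE[OF inner_X_sq[of x]] assms by (simp add: inner_cov_self)

text \<open>A vanishing form means that \<open>X\<close> is almost surely orthogonal to
  \<open>x\<close>, so the integrand of every pairing with \<open>C x\<close> vanishes.\<close>

lemma cov_kernel:
  assumes "inner (C x) x = 0"
  shows "C x = 0"
proof -
  have "inner (C x) (C x) = expectation (\<lambda>\<omega>. 0)"
    unfolding inner_cov[of x "C x"] by (intro integral_cong_AE) (use cov_zero_AE[OF assms] in auto)
  then show ?thesis by simp
qed

lemma sample_measurable: "i \<ge> 1 \<Longrightarrow> (\<lambda>\<omega>. (Xs i \<omega>, Ys i \<omega>)) \<in> borel_measurable M"
  using sample_indep unfolding indep_vars_def by auto

lemma population_measurable [measurable]: "(\<lambda>\<omega>. (X \<omega>, inner (X \<omega>) \<beta> + \<epsilon> \<omega>)) \<in> borel_measurable M"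
  by measurable

lemma sample_expectation:
  fixes \<psi> :: "'h \<times> real \<Rightarrow> real"
  assumes [measurable]: "\<psi> \<in> borel_measurable borel" and i: "i \<ge> 1"
  shows "integrable M (\<lambda>\<omega>. \<psi> (Xs i \<omega>, Ys i \<omega>)) \<longleftrightarrow> integrable M (\<lambda>\<omega>. \<psi> (X \<omega>, inner (X \<omega>) \<beta> + \<epsilon> \<omega>))"
    "expectation (\<lambda>\<omega>. \<psi> (Xs i \<omega>, Ys i \<omega>)) = expectation (\<lambda>\<omega>. \<psi> (X \<omega>, inner (X \<omega>) \<beta> + \<epsilon> \<omega>))"
proof -
  have eq: "distr M borel (\<lambda>\<omega>. (Xs i \<omega>, Ys i \<omega>)) = distr M borel (\<lambda>\<omega>. (X \<omega>, inner (X \<omega>) \<beta> + \<epsilon> \<omega>))"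
    using sample_distr i by blast
  show "integrable M (\<lambda>\<omega>. \<psi> (Xs i \<omega>, Ys i \<omega>)) \<longleftrightarrow> integrable M (\<lambda>\<omega>. \<psi> (X \<omega>, inner (X \<omega>) \<beta> + \<epsilon> \<omega>))"
    using integrable_distr_eq[OF sample_measurable[OF i] assms(1)]
      integrable_distr_eq[OF population_measurable assms(1)] eq by simp
  show "expectation (\<lambda>\<omega>. \<psi> (Xs i \<omega>, Ys i \<omega>)) = expectation (\<lambda>\<omega>. \<psi> (X \<omega>, inner (X \<omega>) \<beta> + \<epsilon> \<omega>))"
    using integral_distr[OF sample_measurable[OF i] assms(1)]
      integral_distr[OF population_measurable assms(1)] eq by simp
qed

definition sample_mean :: "('h \<times> real \<Rightarrow> real) \<Rightarrow> nat \<Rightarrow> 'w \<Rightarrow> real" where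
  "sample_mean \<psi> n \<omega> = (1 / real n) * (\<Sum>k=1..n. \<psi> (Xs k \<omega>, Ys k \<omega>))"

lemma sample_mean_measurable:
  assumes "\<psi> \<in> borel_measurable borel"
  shows "sample_mean \<psi> n \<in> borel_measurable M"
  unfolding sample_mean_def[abs_def]
  using measurable_compose[OF sample_measurable assms]
  by (intro borel_measurable_times borel_measurable_sum) auto

lemma sample_mean_square:
  assumes \<psi> [measurable]: "\<psi> \<in> borel_measurable borel"
    and sq: "integrable M (\<lambda>\<omega>. (\<psi> (X \<omega>, inner (X \<omega>) \<beta> + \<epsilon> \<omega>))\<^sup>2)"
    and mean: "expectation (\<lambda>\<omega>. \<psi> (X \<omega>, inner (X \<omega>) \<beta> + \<epsilon> \<omega>)) = 0"
    and v: "expectation (\<lambda>\<omega>. (\<psi> (X \<omega>, inner (X \<omega>) \<beta> + \<epsilon> \<omega>))\<^sup>2) \<le> v"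
    and q: "q \<ge> 0" and n: "n \<ge> 1"
  shows "(\<integral>\<^sup>+\<omega>. ennreal (q * (sample_mean \<psi> n \<omega>)\<^sup>2) \<partial>M) \<le> ennreal (q * (v / real n))"
proof -
  have \<psi>2: "(\<lambda>p. (\<psi> p)\<^sup>2) \<in> borel_measurable borel" by measurable
  let ?E = "expectation (\<lambda>\<omega>. (\<psi> (X \<omega>, inner (X \<omega>) \<beta> + \<epsilon> \<omega>))\<^sup>2)"
  have *: "integrable M (\<lambda>\<omega>. (\<Sum>k=1..n. \<psi> (Xs k \<omega>, Ys k \<omega>))\<^sup>2) \<and>
      expectation (\<lambda>\<omega>. (\<Sum>k=1..n. \<psi> (Xs k \<omega>, Ys k \<omega>))\<^sup>2) = real n * ?E"
  proof (rule indep_sum_square)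
    show "indep_vars (\<lambda>_. borel) (\<lambda>k \<omega>. \<psi> (Xs k \<omega>, Ys k \<omega>)) {1..}"
      by (rule indep_vars_compose2[OF sample_indep]) (rule \<psi>)
  qed (simp_all only: sample_expectation[OF \<psi>] sample_expectation[OF \<psi>2] sq mean)
  have eq: "q * (sample_mean \<psi> n \<omega>)\<^sup>2 = (q / (real n)\<^sup>2) * (\<Sum>k=1..n. \<psi> (Xs k \<omega>, Ys k \<omega>))\<^sup>2" for \<omega>
    by (simp add: sample_mean_def power_mult_distrib power_divide)
  have "(\<integral>\<^sup>+\<omega>. ennreal (q * (sample_mean \<psi> n \<omega>)\<^sup>2) \<partial>M) = ennreal (expectation (\<lambda>\<omega>. q * (sample_mean \<psi> n \<omega>)\<^sup>2))"
    unfolding eq using * q by (intro nn_integral_eq_integral) auto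
  also have "expectation (\<lambda>\<omega>. q * (sample_mean \<psi> n \<omega>)\<^sup>2) = (q / (real n)\<^sup>2) * (real n * ?E)"
    unfolding eq using * by simp
  also have "\<dots> = q * (?E / real n)" using n by (simp add: power2_eq_square)
  also have "ennreal \<dots> \<le> ennreal (q * (v / real n))"
    using v q n by (intro ennreal_leI mult_left_mono divide_right_mono) auto
  finally show ?thesis .
qed

text \<open>\<open>indep_rv\<close> speaks of families of preimages. They are stable under
  intersection, so independence passes to the generated sigma-algebras, which contain those of the
  real-valued functions of \<open>X\<close> and \<open>\<epsilon>\<close>.\<close>

lemma indep_X_eps:
  assumes F: "F \<in> borel_measurable borel" and G: "G \<in> borel_measurable borel"
  shows "indep_var borel (\<lambda>\<omega>. F (X \<omega>) :: real) borel (\<lambda>\<omega>. G (\<epsilon> \<omega>) :: real)"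
proof -
  let ?SX = "{X -` A \<inter> space M |A. A \<in> sets borel}" and ?SE = "{\<epsilon> -` A \<inter> space M |A. A \<in> sets borel}"
  have ind: "indep_set ?SX ?SE" using X_eps by (simp add: indep_rv_def)
  have stable: "Int_stable {Z -` A \<inter> space M |A. A \<in> sets borel}" for Z :: "'w \<Rightarrow> 'x::topological_space"
    by (rule Int_stableI) (auto, metis sets.Int vimage_Int Int_assoc Int_left_commute inf.idem)
  have sig: "indep_set (sigma_sets (space M) ?SX) (sigma_sets (space M) ?SE)"
    by (rule indep_set_sigma_sets[OF ind stable stable])
  have sub: "sigma_sets (space M) {(\<lambda>\<omega>. F (Z \<omega>)) -` A \<inter> space M |A. A \<in> sets borel}
      \<subseteq> sigma_sets (space M) {Z -` A \<inter> space M |A. A \<in> sets borel}"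
    if F: "F \<in> borel_measurable borel" for F :: "'x::topological_space \<Rightarrow> real" and Z
  proof (rule sigma_sets_mono, safe)
    fix A :: "real set" assume "A \<in> sets borel"
    then have "F -` A \<in> sets borel" using measurable_sets_borel[OF F] by simp
    moreover have "(\<lambda>\<omega>. F (Z \<omega>)) -` A \<inter> space M = Z -` (F -` A) \<inter> space M" by auto
    ultimately show "(\<lambda>\<omega>. F (Z \<omega>)) -` A \<inter> space M \<in> sigma_sets (space M) {Z -` A \<inter> space M |A. A \<in> sets borel}"
      by (intro sigma_sets.Basic) auto
  qed
  have "indep_set (sigma_sets (space M) {(\<lambda>\<omega>. F (X \<omega>)) -` A \<inter> space M |A. A \<in> sets borel})
     (sigma_sets (space M) {(\<lambda>\<omega>. G (\<epsilon> \<omega>)) -` A \<inter> space M |A. A \<in> sets borel})"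
    using sig sub[OF F, of X] sub[OF G, of \<epsilon>] unfolding indep_sets2_eq by blast
  then show ?thesis
    unfolding indep_var_eq using measurable_compose[OF X F] measurable_compose[OF eps G] by simp
qed

end

section \<open>Second moments of the sample in the eigenbasis\<close>

locale regression_rkhs = regression_sample M X \<epsilon> Xs Ys \<beta> \<sigma> d1 +
    preconditioned_covariance J Kc "cov_op M X" \<tau> e
  for M :: "'w measure" and X :: "'w \<Rightarrow> 'h::{real_inner, banach, second_countable_topology}"
    and \<epsilon> Xs Ys \<beta> \<sigma> d1 and J :: "'k::{real_inner, banach} \<Rightarrow> 'h" and Kc \<tau> e
begin

lemma X_\<phi>_cov: "i \<ge> 1 \<Longrightarrow> j \<ge> 1 \<Longrightarrow>
    expectation (\<lambda>\<omega>. inner (X \<omega>) (J (\<phi> i)) * inner (X \<omega>) (J (\<phi> j))) = (if i = j then \<tau> i else 0)"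
  unfolding inner_cov[symmetric]
  unfolding inner_adjoint'[symmetric]
  using orthonormal_onD[OF \<phi>_on, of i j] by (simp add: A_\<phi>[unfolded One_nat_def])

lemma X_\<phi>_sq: "i \<ge> 1 \<Longrightarrow> expectation (\<lambda>\<omega>. (inner (X \<omega>) (J (\<phi> i)))\<^sup>2) = \<tau> i"
  using X_\<phi>_cov[of i i] by (simp add: power2_eq_square)

text \<open>Its sample mean is entry (i, j) of B - A in the basis \<open>\<phi>\<close>; centring
  uses that A is diagonal there.\<close>

definition cov_fun :: "nat \<Rightarrow> nat \<Rightarrow> 'h \<times> real \<Rightarrow> real" where
  "cov_fun i j p = inner (fst p) (J (\<phi> i)) * inner (fst p) (J (\<phi> j)) - (if i = j then \<tau> i else 0)"

text \<open>The sample comes as pairs with the right law, without noise variables of its own; the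
  noise of an observation is recovered as the response minus its regression value.\<close>

definition noise_fun :: "nat \<Rightarrow> 'h \<times> real \<Rightarrow> real" where
  "noise_fun i p = (snd p - inner (fst p) \<beta>) * inner (fst p) (J (\<phi> i))"

lemma cov_fun_measurable: "cov_fun i j \<in> borel_measurable borel"
  unfolding cov_fun_def[abs_def] by (intro borel_measurable_continuous_onI continuous_intros)

lemma noise_fun_measurable: "noise_fun i \<in> borel_measurable borel"
  unfolding noise_fun_def[abs_def] by (intro borel_measurable_continuous_onI continuous_intros)

lemma cov_fun_mean_square:
  assumes i: "i \<ge> 1" and j: "j \<ge> 1" and q: "q \<ge> 0" and n: "n \<ge> 1"
  shows "(\<integral>\<^sup>+\<omega>. ennreal (q * (sample_mean (cov_fun i j) n \<omega>)\<^sup>2) \<partial>M) \<le> ennreal (q * (d1 * \<tau> i * \<tau> j / real n))"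
proof (rule sample_mean_square[OF cov_fun_measurable _ _ _ q n])
  let ?z = "\<lambda>i \<omega>. inner (X \<omega>) (J (\<phi> i))"
  have int4: "integrable M (\<lambda>\<omega>. ((?z i \<omega>)\<^sup>2)\<^sup>2)" for i
    using fourth by (simp add: power_mult[symmetric])
  have prod_int: "integrable M (\<lambda>\<omega>. (?z i \<omega>)\<^sup>2 * (?z j \<omega>)\<^sup>2)"
    by (rule integrable_mult_of_squares) (use int4 in measurable)
  have zz: "integrable M (\<lambda>\<omega>. ?z i \<omega> * ?z j \<omega>)"
    by (rule integrable_mult_of_squares) (use inner_X_sq in measurable)
  have \<tau>: "\<tau> i > 0" "\<tau> j > 0" using \<tau>_pos i j by auto
  have f4: "expectation (\<lambda>\<omega>. ((?z m \<omega>)\<^sup>2)\<^sup>2) \<le> d1 * (\<tau> m)\<^sup>2" if "m \<ge> 1" for m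
    using fourth[rule_format, of "J (\<phi> m)"] X_\<phi>_sq[OF that] by (simp add: power_mult[symmetric])
  \<comment> \<open>Fourth moments are bounded for single coordinates only. Arithmetic-geometric
    mean with these weights lets both coordinates contribute
    \<open>d1 * \<tau> i * \<tau> j / 2\<close>, which keeps the bound a product.\<close>
  have "expectation (\<lambda>\<omega>. (?z i \<omega>)\<^sup>2 * (?z j \<omega>)\<^sup>2)
      \<le> expectation (\<lambda>\<omega>. (\<tau> j / \<tau> i / 2) * ((?z i \<omega>)\<^sup>2)\<^sup>2 + (\<tau> i / \<tau> j / 2) * ((?z j \<omega>)\<^sup>2)\<^sup>2)"
  proof (rule integral_mono)
    fix \<omega>
    have "0 \<le> (\<tau> j * (?z i \<omega>)\<^sup>2 - \<tau> i * (?z j \<omega>)\<^sup>2)\<^sup>2 / (2 * \<tau> i * \<tau> j)" using \<tau> by simp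
    also have "\<dots> = (\<tau> j / \<tau> i / 2) * ((?z i \<omega>)\<^sup>2)\<^sup>2 + (\<tau> i / \<tau> j / 2) * ((?z j \<omega>)\<^sup>2)\<^sup>2 - (?z i \<omega>)\<^sup>2 * (?z j \<omega>)\<^sup>2"
      using \<tau> by (simp add: power2_diff field_simps power2_eq_square)
    finally show "(?z i \<omega>)\<^sup>2 * (?z j \<omega>)\<^sup>2 \<le> (\<tau> j / \<tau> i / 2) * ((?z i \<omega>)\<^sup>2)\<^sup>2 + (\<tau> i / \<tau> j / 2) * ((?z j \<omega>)\<^sup>2)\<^sup>2"
      by simp
  qed (use prod_int int4 in auto)
  also have "\<dots> = (\<tau> j / \<tau> i / 2) * expectation (\<lambda>\<omega>. ((?z i \<omega>)\<^sup>2)\<^sup>2) + (\<tau> i / \<tau> j / 2) * expectation (\<lambda>\<omega>. ((?z j \<omega>)\<^sup>2)\<^sup>2)"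
    using int4 by simp
  also have "\<dots> \<le> (\<tau> j / \<tau> i / 2) * (d1 * (\<tau> i)\<^sup>2) + (\<tau> i / \<tau> j / 2) * (d1 * (\<tau> j)\<^sup>2)"
    using f4[OF i] f4[OF j] \<tau> by (intro add_mono mult_left_mono) auto
  also have "\<dots> = d1 * \<tau> i * \<tau> j" using \<tau> by (simp add: power2_eq_square)
  finally have bound: "expectation (\<lambda>\<omega>. (?z i \<omega>)\<^sup>2 * (?z j \<omega>)\<^sup>2) \<le> d1 * \<tau> i * \<tau> j" .
  let ?c = "if i = j then \<tau> i else 0"
  have sq: "(cov_fun i j (X \<omega>, inner (X \<omega>) \<beta> + \<epsilon> \<omega>))\<^sup>2
      = (?z i \<omega>)\<^sup>2 * (?z j \<omega>)\<^sup>2 - (2 * ?c) * (?z i \<omega> * ?z j \<omega>) + ?c\<^sup>2" for \<omega>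
    by (simp add: cov_fun_def power2_diff power_mult_distrib)
  show "integrable M (\<lambda>\<omega>. (cov_fun i j (X \<omega>, inner (X \<omega>) \<beta> + \<epsilon> \<omega>))\<^sup>2)"
    unfolding sq using prod_int zz by (intro Bochner_Integration.integrable_add Bochner_Integration.integrable_diff integrable_mult_right integrable_const)
  have ez: "expectation (\<lambda>\<omega>. ?z i \<omega> * ?z j \<omega>) = ?c" by (rule X_\<phi>_cov[OF i j])
  show "expectation (\<lambda>\<omega>. cov_fun i j (X \<omega>, inner (X \<omega>) \<beta> + \<epsilon> \<omega>)) = 0"
    unfolding cov_fun_def fst_conv using zz ez by (subst Bochner_Integration.integral_diff) (auto simp: prob_space)
  have "expectation (\<lambda>\<omega>. (cov_fun i j (X \<omega>, inner (X \<omega>) \<beta> + \<epsilon> \<omega>))\<^sup>2)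
      = expectation (\<lambda>\<omega>. (?z i \<omega>)\<^sup>2 * (?z j \<omega>)\<^sup>2) - (2 * ?c) * expectation (\<lambda>\<omega>. ?z i \<omega> * ?z j \<omega>) + ?c\<^sup>2"
    unfolding sq using prod_int zz
    by (subst Bochner_Integration.integral_add, simp, simp, subst Bochner_Integration.integral_diff) (simp_all add: prob_space)
  also have "\<dots> = expectation (\<lambda>\<omega>. (?z i \<omega>)\<^sup>2 * (?z j \<omega>)\<^sup>2) - ?c\<^sup>2"
    unfolding ez by (simp add: power2_eq_square)
  also have "\<dots> \<le> d1 * \<tau> i * \<tau> j" using bound zero_le_power2[of ?c] by linarith
  finally show "expectation (\<lambda>\<omega>. (cov_fun i j (X \<omega>, inner (X \<omega>) \<beta> + \<epsilon> \<omega>))\<^sup>2) \<le> d1 * \<tau> i * \<tau> j" .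
qed

lemma noise_fun_mean_square:
  assumes i: "i \<ge> 1" and q: "q \<ge> 0" and n: "n \<ge> 1"
  shows "(\<integral>\<^sup>+\<omega>. ennreal (q * (sample_mean (noise_fun i) n \<omega>)\<^sup>2) \<partial>M) \<le> ennreal (q * (\<sigma>\<^sup>2 * \<tau> i / real n))"
proof (rule sample_mean_square[OF noise_fun_measurable _ _ _ q n])
  let ?v = "J (\<phi> i)"
  have z: "(\<lambda>x. inner x ?v) \<in> borel_measurable borel" "(\<lambda>x. (inner x ?v)\<^sup>2) \<in> borel_measurable borel"
    by (intro borel_measurable_continuous_onI continuous_intros)+
  have s: "(\<lambda>x::real. x) \<in> borel_measurable borel" "(\<lambda>x::real. x\<^sup>2) \<in> borel_measurable borel" by simp_all
  have eq: "noise_fun i (X \<omega>, inner (X \<omega>) \<beta> + \<epsilon> \<omega>) = inner (X \<omega>) ?v * \<epsilon> \<omega>" for \<omega>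
    by (simp add: noise_fun_def)
  have zi: "integrable M (\<lambda>\<omega>. inner (X \<omega>) ?v)"
    by (rule square_integrable_imp_integrable[OF _ inner_X_sq]) measurable
  have ei: "integrable M \<epsilon>" by (rule square_integrable_imp_integrable[OF eps eps_sq])
  have ev: "expectation (\<lambda>\<omega>. (\<epsilon> \<omega>)\<^sup>2) = \<sigma>\<^sup>2" using eps_var by (simp add: eps_mean)
  show "integrable M (\<lambda>\<omega>. (noise_fun i (X \<omega>, inner (X \<omega>) \<beta> + \<epsilon> \<omega>))\<^sup>2)"
    unfolding eq power_mult_distrib
    by (rule indep_var_integrable[OF indep_X_eps[OF z(2) s(2)] inner_X_sq eps_sq])
  show "expectation (\<lambda>\<omega>. noise_fun i (X \<omega>, inner (X \<omega>) \<beta> + \<epsilon> \<omega>)) = 0"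
    unfolding eq using indep_var_lebesgue_integral[OF indep_X_eps[OF z(1) s(1)] zi ei] eps_mean by simp
  show "expectation (\<lambda>\<omega>. (noise_fun i (X \<omega>, inner (X \<omega>) \<beta> + \<epsilon> \<omega>))\<^sup>2) \<le> \<sigma>\<^sup>2 * \<tau> i"
    unfolding eq power_mult_distrib
    using indep_var_lebesgue_integral[OF indep_X_eps[OF z(2) s(2)] inner_X_sq eps_sq] ev X_\<phi>_sq[OF i] by simp
qed

text \<open>Eigenpairs are indexed from 1 and nothing is known of \<open>\<tau> 0\<close>, whereas
  the series starts at 0; \<open>q 0 = 0\<close> removes that term.\<close>

lemma suminf_weighted_le:
  assumes q: "q 0 = 0" "\<And>i. q i \<ge> 0" and S: "\<And>N. (\<Sum>i=1..N. q i * \<tau> i) \<le> S"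
  shows "(\<Sum>i. ennreal (q i * \<tau> i)) \<le> ennreal S"
  unfolding suminf_eq_SUP
proof (rule SUP_least)
  fix N
  have nn: "q i * \<tau> i \<ge> 0" for i using q \<tau>_pos[of i] by (cases "i = 0") (auto simp: less_imp_le)
  have "(\<Sum>i<N. q i * \<tau> i) \<le> (\<Sum>i=0..N. q i * \<tau> i)" using nn by (intro sum_mono2) auto
  also have "\<dots> = (\<Sum>i=1..N. q i * \<tau> i)" using q by (subst sum.atLeast_Suc_atMost) auto
  finally have "(\<Sum>i<N. q i * \<tau> i) \<le> S" using S[of N] by linarith
  then show "(\<Sum>i<N. ennreal (q i * \<tau> i)) \<le> ennreal S" using nn by (simp add: ennreal_leI sum_ennreal)
qed

text \<open>Expected squared entries are bounded by products in i and j, so the weighted double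
  series factorises into the square of one series: the trace for weight 1, the effective dimension
  for weight \<open>1 / (\<tau> i + \<mu>)\<close>.\<close>

lemma weighted_cov_deviation:
  assumes q: "q 0 = 0" "\<And>i. q i \<ge> 0" and S: "\<And>N. (\<Sum>i=1..N. q i * \<tau> i) \<le> S" and n: "n \<ge> 1"
  shows "(\<integral>\<^sup>+\<omega>. (\<Sum>i. \<Sum>j. ennreal (q i * q j * (sample_mean (cov_fun i j) n \<omega>)\<^sup>2)) \<partial>M) \<le> ennreal (d1 * S\<^sup>2 / real n)"
proof -
  note [measurable] = sample_mean_measurable[OF cov_fun_measurable]
  have S0: "S \<ge> 0" using S[of 0] by simp
  have nn: "q i * \<tau> i \<ge> 0" for i using q \<tau>_pos[of i] by (cases "i = 0") (auto simp: less_imp_le)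
  have "(\<integral>\<^sup>+\<omega>. (\<Sum>i. \<Sum>j. ennreal (q i * q j * (sample_mean (cov_fun i j) n \<omega>)\<^sup>2)) \<partial>M)
      = (\<Sum>i. \<Sum>j. \<integral>\<^sup>+\<omega>. ennreal (q i * q j * (sample_mean (cov_fun i j) n \<omega>)\<^sup>2) \<partial>M)"
    by (subst nn_integral_suminf, measurable, subst nn_integral_suminf, measurable)
  also have "\<dots> \<le> (\<Sum>i. \<Sum>j. ennreal (d1 / real n) * ennreal (q i * \<tau> i) * ennreal (q j * \<tau> j))"
  proof (intro suminf_le summableI)
    fix i j
    show "(\<integral>\<^sup>+\<omega>. ennreal (q i * q j * (sample_mean (cov_fun i j) n \<omega>)\<^sup>2) \<partial>M)
        \<le> ennreal (d1 / real n) * ennreal (q i * \<tau> i) * ennreal (q j * \<tau> j)"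
    proof (cases "i = 0 \<or> j = 0")
      case True
      then show ?thesis using q by auto
    next
      case False
      then have "(\<integral>\<^sup>+\<omega>. ennreal (q i * q j * (sample_mean (cov_fun i j) n \<omega>)\<^sup>2) \<partial>M)
          \<le> ennreal (q i * q j * (d1 * \<tau> i * \<tau> j / real n))"
        using q n by (intro cov_fun_mean_square) auto
      also have "q i * q j * (d1 * \<tau> i * \<tau> j / real n) = (d1 / real n) * (q i * \<tau> i) * (q j * \<tau> j)" by simp
      also have "ennreal \<dots> = ennreal (d1 / real n) * ennreal (q i * \<tau> i) * ennreal (q j * \<tau> j)"
        using nn d1 by (simp only: ennreal_mult divide_nonneg_nonneg less_imp_le of_nat_0_le_iff mult_nonneg_nonneg)
      finally show ?thesis .
    qed
  qed
  also have "\<dots> = ennreal (d1 / real n) * (\<Sum>i. ennreal (q i * \<tau> i)) * (\<Sum>i. ennreal (q i * \<tau> i))" by simp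
  also have "\<dots> \<le> ennreal (d1 / real n) * ennreal S * ennreal S"
    by (intro mult_mono suminf_weighted_le q S) auto
  also have "\<dots> = ennreal (d1 * S\<^sup>2 / real n)"
    using d1 S0 by (simp add: ennreal_mult[symmetric] power2_eq_square)
  finally show ?thesis .
qed

lemma weighted_noise:
  assumes q: "q 0 = 0" "\<And>i. q i \<ge> 0" and S: "\<And>N. (\<Sum>i=1..N. q i * \<tau> i) \<le> S" and n: "n \<ge> 1"
  shows "(\<integral>\<^sup>+\<omega>. (\<Sum>i. ennreal (q i * (sample_mean (noise_fun i) n \<omega>)\<^sup>2)) \<partial>M) \<le> ennreal (\<sigma>\<^sup>2 * S / real n)"
proof -
  note [measurable] = sample_mean_measurable[OF noise_fun_measurable]
  have S0: "S \<ge> 0" using S[of 0] by simp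
  have nn: "q i * \<tau> i \<ge> 0" for i using q \<tau>_pos[of i] by (cases "i = 0") (auto simp: less_imp_le)
  have "(\<integral>\<^sup>+\<omega>. (\<Sum>i. ennreal (q i * (sample_mean (noise_fun i) n \<omega>)\<^sup>2)) \<partial>M)
      = (\<Sum>i. \<integral>\<^sup>+\<omega>. ennreal (q i * (sample_mean (noise_fun i) n \<omega>)\<^sup>2) \<partial>M)"
    by (subst nn_integral_suminf) measurable
  also have "\<dots> \<le> (\<Sum>i. ennreal (\<sigma>\<^sup>2 / real n) * ennreal (q i * \<tau> i))"
  proof (intro suminf_le summableI)
    fix i
    show "(\<integral>\<^sup>+\<omega>. ennreal (q i * (sample_mean (noise_fun i) n \<omega>)\<^sup>2) \<partial>M) \<le> ennreal (\<sigma>\<^sup>2 / real n) * ennreal (q i * \<tau> i)"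
    proof (cases "i = 0")
      case True
      then show ?thesis using q by auto
    next
      case False
      then have "(\<integral>\<^sup>+\<omega>. ennreal (q i * (sample_mean (noise_fun i) n \<omega>)\<^sup>2) \<partial>M) \<le> ennreal (q i * (\<sigma>\<^sup>2 * \<tau> i / real n))"
        using q n by (intro noise_fun_mean_square) auto
      also have "q i * (\<sigma>\<^sup>2 * \<tau> i / real n) = (\<sigma>\<^sup>2 / real n) * (q i * \<tau> i)" by simp
      also have "ennreal \<dots> = ennreal (\<sigma>\<^sup>2 / real n) * ennreal (q i * \<tau> i)"
        by (rule ennreal_mult) (use nn in auto)
      finally show ?thesis .
    qed
  qed
  also have "\<dots> = ennreal (\<sigma>\<^sup>2 / real n) * (\<Sum>i. ennreal (q i * \<tau> i))" by simp
  also have "\<dots> \<le> ennreal (\<sigma>\<^sup>2 / real n) * ennreal S" by (intro mult_left_mono suminf_weighted_le q S) auto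
  also have "\<dots> = ennreal (\<sigma>\<^sup>2 * S / real n)" using S0 by (simp add: ennreal_mult[symmetric])
  finally show ?thesis .
qed

text \<open>Separability of \<open>L\<^sup>2\<close> lets one null set serve for all \<open>x\<close> at once.\<close>

lemma sample_in_range_AE:
  "AE \<omega> in M. \<forall>k\<ge>1. \<forall>x. (\<forall>i\<in>{1..}. inner x (\<phi> i) = 0) \<longrightarrow> inner (Xs k \<omega>) (J x) = 0"
proof -
  define V where "V = J ` {x. \<forall>i\<in>{1..}. inner x (\<phi> i) = 0}"
  obtain \<B> :: "'h set set" where \<B>: "countable \<B>" "topological_basis \<B>"
    using ex_countable_basis by blast
  define pick where "pick G = (SOME v. v \<in> V \<inter> G)" for G
  \<comment> \<open>\<open>D\<close> is a countable dense subset of \<open>V\<close>. Having a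
    nonzero inner product with \<open>Xs k \<omega>\<close> is an open condition, so a failure at
    some \<open>J x\<close> would already show at a point of \<open>D\<close>.\<close>
  define D where "D = pick ` {G\<in>\<B>. V \<inter> G \<noteq> {}}"
  have pick: "pick G \<in> V \<inter> G" if "V \<inter> G \<noteq> {}" for G
    unfolding pick_def using that by (meson ex_in_conv someI_ex)
  have "countable D" unfolding D_def using \<B>(1) by (intro countable_image countable_subset[OF _ \<B>(1)]) auto
  have DV: "D \<subseteq> V" unfolding D_def using pick by auto
  have "AE \<omega> in M. inner (Xs k \<omega>) d = 0" if k: "k \<ge> 1" and d: "d \<in> D" for k d
  proof -
    obtain x where x: "\<forall>i\<in>{1..}. inner x (\<phi> i) = 0" "d = J x" using d DV unfolding V_def by auto
    have "inner (C d) d = 0" unfolding x(2) A_kernel[OF x(1)] by simp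
    then have "expectation (\<lambda>\<omega>. (inner (X \<omega>) d)\<^sup>2) = 0" by (simp add: inner_cov_self)
    moreover have m: "(\<lambda>p::'h \<times> real. (inner (fst p) d)\<^sup>2) \<in> borel_measurable borel"
      by (intro borel_measurable_continuous_onI continuous_intros)
    ultimately have "integrable M (\<lambda>\<omega>. (inner (Xs k \<omega>) d)\<^sup>2)" "expectation (\<lambda>\<omega>. (inner (Xs k \<omega>) d)\<^sup>2) = 0"
      using sample_expectation[OF m k] inner_X_sq by simp_all
    then show ?thesis using integral_nonneg_eq_0_iff_AE[of M "\<lambda>\<omega>. (inner (Xs k \<omega>) d)\<^sup>2"] by simp
  qed
  then have "AE \<omega> in M. \<forall>k\<in>{1..}. \<forall>d\<in>D. inner (Xs k \<omega>) d = 0"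
    using \<open>countable D\<close> by (simp add: AE_ball_countable)
  then show ?thesis
  proof eventually_elim
    case (elim \<omega>)
    show ?case
    proof safe
      fix k :: nat and x assume k: "1 \<le> k" and x: "\<forall>i\<in>{1..}. inner x (\<phi> i) = 0"
      show "inner (Xs k \<omega>) (J x) = 0"
      proof (rule ccontr)
        assume nz: "inner (Xs k \<omega>) (J x) \<noteq> 0"
        have "open {y. inner (Xs k \<omega>) y \<noteq> 0}" by (intro open_Collect_neq continuous_intros)
        then obtain O' where O': "O' \<in> \<B>" "J x \<in> O'" "O' \<subseteq> {y. inner (Xs k \<omega>) y \<noteq> 0}"
          using topological_basisE[OF \<B>(2), of "{y. inner (Xs k \<omega>) y \<noteq> 0}" "J x"] nz by auto
        have ne: "V \<inter> O' \<noteq> {}" using O'(2) x unfolding V_def by auto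
        then have "pick O' \<in> D" using O'(1) unfolding D_def by auto
        then have "inner (Xs k \<omega>) (pick O') = 0" using elim k by auto
        then show False using pick[OF ne] O'(3) by auto
      qed
    qed
  qed
qed

end

section \<open>The convergence rate\<close>

text \<open>Events are described by one infinite series each, which makes them measurable at once;
  this recovers the bounds for all finite index sets.\<close>

lemma finite_sum_le_of_suminf:
  fixes a :: "nat \<Rightarrow> real"
  assumes "(\<Sum>i. ennreal (a i)) \<le> ennreal t" "0 \<le> t" "\<And>i. 0 \<le> a i" "finite F"
  shows "(\<Sum>i\<in>F. a i) \<le> t"
proof -
  have "ennreal (\<Sum>i\<in>F. a i) = (\<Sum>i\<in>F. ennreal (a i))" using assms(3) by (simp add: sum_ennreal)
  also have "\<dots> \<le> (\<Sum>i. ennreal (a i))" using assms(4) by (intro sum_le_suminf summableI) auto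
  also have "\<dots> \<le> ennreal t" by (rule assms(1))
  finally show ?thesis using assms(2) by (simp add: ennreal_le_iff)
qed

lemma finite_sum_le_of_suminf2:
  fixes a :: "nat \<Rightarrow> nat \<Rightarrow> real"
  assumes "(\<Sum>i. \<Sum>j. ennreal (a i j)) \<le> ennreal t" "0 \<le> t" "\<And>i j. 0 \<le> a i j" "finite F" "finite G"
  shows "(\<Sum>i\<in>F. \<Sum>j\<in>G. a i j) \<le> t"
proof -
  have "(\<Sum>i. ennreal (\<Sum>j\<in>G. a i j)) \<le> (\<Sum>i. \<Sum>j. ennreal (a i j))"
  proof (intro suminf_le summableI)
    fix i
    have "ennreal (\<Sum>j\<in>G. a i j) = (\<Sum>j\<in>G. ennreal (a i j))" using assms(3) by (simp add: sum_ennreal)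
    also have "\<dots> \<le> (\<Sum>j. ennreal (a i j))" using assms(5) by (intro sum_le_suminf summableI) auto
    finally show "ennreal (\<Sum>j\<in>G. a i j) \<le> (\<Sum>j. ennreal (a i j))" .
  qed
  then show ?thesis
    using assms by (intro finite_sum_le_of_suminf) (auto intro: sum_nonneg order_trans)
qed

lemma eigenvalue_in_real_spectrum:
  assumes "A v = \<mu> *\<^sub>R v" "v \<noteq> 0"
  shows "\<mu> \<in> real_spectrum A"
proof (rule ccontr)
  assume "\<mu> \<notin> real_spectrum A"
  then obtain R where R: "bounded_linear R" "\<forall>x. R (A x - \<mu> *\<^sub>R x) = x"
    unfolding real_spectrum_def by blast
  have "R 0 = v" using R(2)[rule_format, of v] assms(1) by simp
  then show False using assms(2) linear_0[OF bounded_linear.linear[OF R(1)]] by simp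
qed

section \<open>The error at a fixed outcome and the choice of the good event\<close>

context regression_rkhs
begin

lemma adjoint_lin: "linear (adjoint J)"
  using bounded_linear.linear[OF bounded_linear_adjoint[OF J]] .

lemma JCJ_emp_eq:
  "JCJ_emp J Xs n \<omega> x = (1 / real n) *\<^sub>R (\<Sum>k=1..n. inner (Xs k \<omega>) (J x) *\<^sub>R adjoint J (Xs k \<omega>))"
  by (simp add: JCJ_emp_def emp_cov_def tens_def linear_cmul[OF adjoint_lin] linear_sum[OF adjoint_lin])

lemma inner_JCJ_emp:
  "inner (JCJ_emp J Xs n \<omega> x) y = (1 / real n) * (\<Sum>k=1..n. inner (Xs k \<omega>) (J x) * inner (Xs k \<omega>) (J y))"
  by (simp add: JCJ_emp_eq inner_sum_left inner_adjoint')

lemma positive_trace_class_JCJ_emp: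
  "positive_trace_class (JCJ_emp J Xs n \<omega>) ((1 / real n) * (\<Sum>k=1..n. (norm (adjoint J (Xs k \<omega>)))\<^sup>2) + 1)"
proof (rule positive_trace_class.intro)
  show "bounded_linear (JCJ_emp J Xs n \<omega>)"
    unfolding JCJ_emp_eq[abs_def]
    by (intro bounded_linear_const_scaleR bounded_linear_sum bounded_linear_scaleR_const
        bounded_linear_inner_right_comp J)
  show "inner (JCJ_emp J Xs n \<omega> x) y = inner x (JCJ_emp J Xs n \<omega> y)" for x y
    unfolding inner_commute[of x] inner_JCJ_emp by (simp add: mult.commute)
  show "0 \<le> inner (JCJ_emp J Xs n \<omega> x) x" for x
    unfolding inner_JCJ_emp by (simp add: sum_nonneg)
  show "(\<Sum>u\<in>F. inner (JCJ_emp J Xs n \<omega> u) u) \<le> (1 / real n) * (\<Sum>k=1..n. (norm (adjoint J (Xs k \<omega>)))\<^sup>2) + 1"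
    if F: "finite F" "orthonormal_on F (\<lambda>u. u)" for F
  proof -
    have "(\<Sum>u\<in>F. inner (JCJ_emp J Xs n \<omega> u) u)
        = (1 / real n) * (\<Sum>k=1..n. \<Sum>u\<in>F. (inner (adjoint J (Xs k \<omega>)) u)\<^sup>2)"
      unfolding inner_JCJ_emp inner_adjoint' sum_distrib_left[symmetric]
      by (subst sum.swap) (simp add: power2_eq_square)
    also have "\<dots> \<le> (1 / real n) * (\<Sum>k=1..n. (norm (adjoint J (Xs k \<omega>)))\<^sup>2)"
      using bessel_finite[OF F(2,1)] by (intro mult_left_mono sum_mono) auto
    finally show ?thesis by simp
  qed
  show "0 < (1 / real n) * (\<Sum>k=1..n. (norm (adjoint J (Xs k \<omega>)))\<^sup>2) + 1"
    by (intro add_nonneg_pos mult_nonneg_nonneg sum_nonneg) auto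
qed

definition noise_vec :: "nat \<Rightarrow> 'w \<Rightarrow> 'k" where
  "noise_vec n \<omega> = (1 / real n) *\<^sub>R (\<Sum>k=1..n. (Ys k \<omega> - inner (Xs k \<omega>) \<beta>) *\<^sub>R adjoint J (Xs k \<omega>))"

lemma inner_noise_vec:
  "inner (noise_vec n \<omega>) x = (1 / real n) * (\<Sum>k=1..n. (Ys k \<omega> - inner (Xs k \<omega>) \<beta>) * inner (Xs k \<omega>) (J x))"
  by (simp add: noise_vec_def inner_sum_left inner_adjoint')

lemma adjoint_emp_R:
  assumes "\<beta> = J f"
  shows "adjoint J (emp_R Xs Ys n \<omega>) = JCJ_emp J Xs n \<omega> f + noise_vec n \<omega>"
  unfolding JCJ_emp_eq noise_vec_def emp_R_def
  unfolding assms
  by (simp add: linear_cmul[OF adjoint_lin] linear_sum[OF adjoint_lin] scaleR_diff_left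
      scaleR_add_right[symmetric] sum.distrib[symmetric] del: scaleR_add_right)

text \<open>Stated for squares because the sample mean of \<open>cov_fun\<close> has the opposite
  sign, that of B - A.\<close>

lemma deviation_eq:
  assumes "i \<ge> 1" "j \<ge> 1" "n \<ge> 1"
  shows "(inner (adjoint J (C (J (\<phi> i))) - JCJ_emp J Xs n \<omega> (\<phi> i)) (\<phi> j))\<^sup>2 = (sample_mean (cov_fun i j) n \<omega>)\<^sup>2"
proof -
  have "inner (adjoint J (C (J (\<phi> i)))) (\<phi> j) = (if i = j then \<tau> i else 0)"
    unfolding A_\<phi>[OF assms(1)] using orthonormal_onD[OF \<phi>_on, of i j] assms by simp
  moreover have "sample_mean (cov_fun i j) n \<omega> = inner (JCJ_emp J Xs n \<omega> (\<phi> i)) (\<phi> j) - (if i = j then \<tau> i else 0)"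
    unfolding inner_JCJ_emp sample_mean_def cov_fun_def sum_subtractf
    using assms(3) by (simp add: right_diff_distrib)
  ultimately show ?thesis by (simp add: inner_diff_left power2_commute)
qed

text \<open>The outcome is fixed; all randomness enters through \<open>range\<close>,
  \<open>spec\<close> and the bounds \<open>ev1\<close> to \<open>ev3\<close>, which become the
  hypotheses of \<open>perturbed_calculus\<close> and \<open>error_rate\<close>.\<close>

lemma error_on_event:
  fixes h :: 'h and f :: 'k and g :: "real \<Rightarrow> real"
  assumes n: "n \<ge> 1" and f: "\<beta> = J f"
    and src: "((\<lambda>i. (\<tau> i powr s * inner h (e i)) *\<^sub>R \<phi> i) has_sum f) {1..}"
    and range: "\<forall>k\<ge>1. \<forall>x. (\<forall>i\<in>{1..}. inner x (\<phi> i) = 0) \<longrightarrow> inner (Xs k \<omega>) (J x) = 0"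
    and spec: "real_spectrum (JCJ_emp J Xs n \<omega>) \<subseteq> {x. 0 \<le> x \<and> ereal x \<le> \<eta>}"
    and r: "0 < r" "r \<le> s" and l: "0 < l" "l \<le> 1" and K: "K \<ge> 1"
    and t0: "t0 > 0" "\<And>i. i \<ge> 1 \<Longrightarrow> \<tau> i \<le> t0"
    and CH: "CH \<ge> 0" and Cq: "Cq \<ge> 0" and nn: "Ac \<ge> 0" "Bc \<ge> 0" "D \<ge> 0" "w1 \<ge> 0" "wr \<ge> 0"
    and g: "\<And>x. 0 < x \<Longrightarrow> ereal x \<le> \<eta> \<Longrightarrow> \<bar>x * g x\<bar> \<le> Ac \<and> \<bar>g x\<bar> \<le> Bc / l \<and> \<bar>1 - x * g x\<bar> \<le> D"
    and g1: "\<And>x. 0 < x \<Longrightarrow> ereal x \<le> \<eta> \<Longrightarrow> \<bar>1 - x * g x\<bar> * x powr (1/2) \<le> w1 * l powr (1/2)"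
    and gr: "\<And>x. 0 < x \<Longrightarrow> ereal x \<le> \<eta> \<Longrightarrow> \<bar>1 - x * g x\<bar> * x powr r \<le> wr * l powr r"
    and ev1: "(\<Sum>i. \<Sum>j. ennreal ((if i = 0 then 0 else 1 / (\<tau> i + K * l)) * (if j = 0 then 0 else 1 / (\<tau> j + K * l))
        * (sample_mean (cov_fun i j) n \<omega>)\<^sup>2)) \<le> ennreal (1/4)"
    and ev2: "(\<Sum>i. \<Sum>j. ennreal ((if i = 0 then 0 else 1) * (if j = 0 then 0 else 1)
        * (sample_mean (cov_fun i j) n \<omega>)\<^sup>2)) \<le> ennreal ((CH * l powr (r + 1/2))\<^sup>2)"
    and ev3: "(\<Sum>i. ennreal ((if i = 0 then 0 else 1 / (\<tau> i + l))
        * (sample_mean (noise_fun i) n \<omega>)\<^sup>2)) \<le> ennreal ((Cq * l powr (r + 1/2))\<^sup>2)"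
  shows "norm (f - op_fun g (JCJ_emp J Xs n \<omega>) (adjoint J (emp_R Xs Ys n \<omega>))) \<le>
     (sqrt 2 * norm h * t0 powr (s - r) * sqrt (w1\<^sup>2 + K * (D + 1)\<^sup>2)
      + ((D + 1) * (r * (1 + (3/2 * t0 + K / 2 + 1) powr (r - 1))) * CH + 2 powr r * (wr + (D + 1))) * (t0 powr (s - r) * norm h)
      + sqrt 2 * Cq * sqrt (Ac * Bc + K * Bc\<^sup>2)) * l powr r"
proof -
  let ?B = "JCJ_emp J Xs n \<omega>" and ?A = "\<lambda>x. adjoint J (C (J x))"
  have \<mu>: "K * l > 0" using K l by simp
  have \<tau>K: "\<tau> i + K * l > 0" "\<tau> i + l > 0" if "i \<ge> 1" for i using \<tau>_pos[OF that] \<mu> l by auto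
  interpret B: positive_trace_class ?B "(1 / real n) * (\<Sum>k=1..n. (norm (adjoint J (Xs k \<omega>)))\<^sup>2) + 1"
    by (rule positive_trace_class_JCJ_emp)
  obtain U where U: "eigensystem ?B U (\<lambda>u. u) (\<lambda>u. inner (?B u) u)" and pos: "\<And>u. u \<in> U \<Longrightarrow> inner (?B u) u > 0"
    using B.exists_eigensystem by blast
  have bA: "bounded_linear ?A"
    by (rule bounded_linear_compose[OF bounded_linear_adjoint[OF J] bounded_linear_compose[OF C J]])
  interpret perturbed_calculus ?B U "\<lambda>u. u" "\<lambda>u. inner (?B u) u" ?A "{1..}" \<phi> \<tau> "K * l" "CH * l powr (r + 1/2)" t0
  proof (intro perturbed_calculus.intro spectral_calculus.intro perturbed_calculus_axioms.intro)
    show "bounded_linear ?B" by (rule B.A)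
    show "eigensystem ?B U (\<lambda>u. u) (\<lambda>u. inner (?B u) u)" by (rule U)
    show "0 < inner (?B v) v" if "v \<in> U" for v by (rule pos[OF that])
    show "bounded_linear ?A" by (rule bA)
    show "eigensystem ?A {1..} \<phi> \<tau>" by (rule eigensystem_A)
    show "\<tau> i > 0" if "i \<in> {1..}" for i using \<tau>_pos[of i] that by simp
    show "\<tau> i \<le> t0" if "i \<in> {1..}" for i using t0(2)[of i] that by simp
    show "?B x = 0" if "\<And>i. i \<in> {1..} \<Longrightarrow> inner x (\<phi> i) = 0" for x
    proof -
      have "inner (Xs k \<omega>) (J x) = 0" if "k \<in> {1..n}" for k
        using range \<open>\<And>i. i \<in> {1..} \<Longrightarrow> inner x (\<phi> i) = 0\<close> that by simp
      then show ?thesis unfolding JCJ_emp_eq by simp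
    qed
    show "0 < K * l" by (rule \<mu>)
    show "0 \<le> CH * l powr (r + 1/2)" using CH by simp
    show "0 < t0" by (rule t0)
    fix F G :: "nat set" assume F: "finite F" "F \<subseteq> {1..}"
    show "(\<Sum>i\<in>F. \<Sum>j\<in>F. (inner (?A (\<phi> i) - ?B (\<phi> i)) (\<phi> j))\<^sup>2 / ((\<tau> i + K * l) * (\<tau> j + K * l))) \<le> 1/4"
    proof -
      let ?q = "\<lambda>i. if i = 0 then 0 else 1 / (\<tau> i + K * l)"
      have "?q i \<ge> 0" for i using \<tau>K(1)[of i] by auto
      then have "(\<Sum>i\<in>F. \<Sum>j\<in>F. ?q i * ?q j * (sample_mean (cov_fun i j) n \<omega>)\<^sup>2) \<le> 1/4"
        by (intro finite_sum_le_of_suminf2[OF ev1] F mult_nonneg_nonneg) simp_all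
      moreover have "?q i * ?q j * (sample_mean (cov_fun i j) n \<omega>)\<^sup>2
          = (inner (?A (\<phi> i) - ?B (\<phi> i)) (\<phi> j))\<^sup>2 / ((\<tau> i + K * l) * (\<tau> j + K * l))" if "i \<in> F" "j \<in> F" for i j
      proof -
        have "i \<ge> 1" "j \<ge> 1" using F that by auto
        then show ?thesis using deviation_eq[OF _ _ n, of i j] by simp
      qed
      ultimately show ?thesis by simp
    qed
    assume G: "finite G" "G \<subseteq> {1..}"
    show "(\<Sum>i\<in>F. \<Sum>j\<in>G. (inner (?A (\<phi> i) - ?B (\<phi> i)) (\<phi> j))\<^sup>2) \<le> (CH * l powr (r + 1/2))\<^sup>2"
    proof -
      let ?q = "\<lambda>i::nat. if i = 0 then 0 else 1::real"
      have "(\<Sum>i\<in>F. \<Sum>j\<in>G. ?q i * ?q j * (sample_mean (cov_fun i j) n \<omega>)\<^sup>2) \<le> (CH * l powr (r + 1/2))\<^sup>2"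
        by (intro finite_sum_le_of_suminf2[OF ev2] F G mult_nonneg_nonneg) simp_all
      moreover have "?q i * ?q j * (sample_mean (cov_fun i j) n \<omega>)\<^sup>2
          = (inner (?A (\<phi> i) - ?B (\<phi> i)) (\<phi> j))\<^sup>2" if "i \<in> F" "j \<in> G" for i j
      proof -
        have "i \<ge> 1" "j \<ge> 1" using F G that by auto
        then show ?thesis using deviation_eq[OF _ _ n, of i j] by simp
      qed
      ultimately show ?thesis by simp
    qed
  qed
  \<comment> \<open>The bounds on the regularization family hold up to \<open>\<eta>\<close> only,
    so the eigenvalues have to be located in the spectrum.\<close>
  have b_le_\<eta>: "ereal (inner (?B v) v) \<le> \<eta>" if v: "v \<in> U" for v
  proof -
    have "inner v v = 1" using orthonormal_onD[OF u_on v v] by simp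
    then have "v \<noteq> 0" by auto
    moreover have "?B v = inner (?B v) v *\<^sub>R v" using U v unfolding eigensystem_def by blast
    ultimately show ?thesis using eigenvalue_in_real_spectrum spec by blast
  qed
  \<comment> \<open>On the kernel of B the form, a mean of squares, vanishes; so each
    \<open>inner (Xs k \<omega>) (J x)\<close> does.\<close>
  have wU: "inner (noise_vec n \<omega>) x = 0" if x: "\<And>v. v \<in> U \<Longrightarrow> inner x v = 0" for x
  proof -
    have "?B x = 0" using U x unfolding eigensystem_def by blast
    then have "(1 / real n) * (\<Sum>k=1..n. inner (Xs k \<omega>) (J x) * inner (Xs k \<omega>) (J x)) = 0"
      unfolding inner_JCJ_emp[symmetric] by simp
    then have "(\<Sum>k=1..n. inner (Xs k \<omega>) (J x) * inner (Xs k \<omega>) (J x)) = 0" using n by simp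
    then have "inner (Xs k \<omega>) (J x) = 0" if "k \<in> {1..n}" for k
      using that by (subst (asm) sum_nonneg_eq_0_iff) auto
    then show ?thesis unfolding inner_noise_vec by simp
  qed
  have wI: "inner (noise_vec n \<omega>) x = 0" if x: "\<And>i. i \<in> {1..} \<Longrightarrow> inner x (\<phi> i) = 0" for x
  proof -
    have "inner (Xs k \<omega>) (J x) = 0" if "k \<in> {1..n}" for k
      using range x that by simp
    then show ?thesis unfolding inner_noise_vec by simp
  qed
  have Q: "(\<Sum>i\<in>F. (inner (noise_vec n \<omega>) (\<phi> i))\<^sup>2 / (\<tau> i + l)) \<le> (Cq * l powr (r + 1/2))\<^sup>2"
    if F: "finite F" "F \<subseteq> {1..}" for F
  proof -
    let ?q = "\<lambda>i. if i = 0 then 0 else 1 / (\<tau> i + l)"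
    have "?q i \<ge> 0" for i using \<tau>K(2)[of i] by auto
    then have "(\<Sum>i\<in>F. ?q i * (sample_mean (noise_fun i) n \<omega>)\<^sup>2) \<le> (Cq * l powr (r + 1/2))\<^sup>2"
      by (intro finite_sum_le_of_suminf[OF ev3] F mult_nonneg_nonneg) simp_all
    moreover have "?q i * (sample_mean (noise_fun i) n \<omega>)\<^sup>2 = (inner (noise_vec n \<omega>) (\<phi> i))\<^sup>2 / (\<tau> i + l)"
      if "i \<in> F" for i
      using F that by (auto simp: inner_noise_vec sample_mean_def noise_fun_def)
    ultimately show ?thesis by simp
  qed
  have hb: "(\<Sum>i\<in>F. (inner h (e i))\<^sup>2) \<le> (norm h)\<^sup>2" if "finite F" "F \<subseteq> {1..}" for F
    by (rule bessel_finite[OF e_on that])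
  show ?thesis
    unfolding adjoint_emp_R[OF f]
    by (rule error_rate[OF src hb norm_ge_zero r l refl K wU wI Q refl CH Cq])
       (use g g1 gr pos b_le_\<eta> nn in auto)
qed

lemma convergence_rate:
  fixes h :: 'h and f :: 'k and g :: "real \<Rightarrow> real \<Rightarrow> real"
  assumes f: "\<beta> = J f"
    and src: "((\<lambda>i. (\<tau> i powr s * inner h (e i)) *\<^sub>R \<phi> i) has_sum f) {1..}"
    and spec: "\<And>n. n \<ge> 1 \<Longrightarrow> AE \<omega> in M. real_spectrum (JCJ_emp J Xs n \<omega>) \<subseteq> {x. 0 \<le> x \<and> ereal x \<le> \<eta>}"
    and r: "0 < r" "r \<le> s" and b: "b > 1" and c: "c > 0"
    and \<tau>_le: "\<And>i. i \<ge> 1 \<Longrightarrow> \<tau> i \<le> c * real i powr (- b)"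
    and reg: "reg_family \<eta> g Ac Bc D" and qr: "qualifies \<eta> g r" and q1: "qualifies \<eta> g (1/2)"
  defines "l \<equiv> \<lambda>n. real n powr (- (b / (1 + b + 2 * r * b)))"
  shows "lesssim_p M {n. n \<ge> 1 \<and> ereal (l n) \<le> \<eta>}
           (\<lambda>n \<omega>. norm (f - beta_hat g (l n) J Xs Ys n \<omega>))
           (\<lambda>n. real n powr (- (b * r / (1 + b + 2 * r * b))))"
  unfolding lesssim_p_def
proof (intro allI impI)
  fix \<delta> :: real assume \<delta>: "0 < \<delta> \<and> \<delta> < 1"
  \<comment> \<open>Three events, each of which may fail with probability at most
    \<open>p\<close>.\<close>
  define p where "p = (1 - \<delta>) / 3"
  have p: "p > 0" using \<delta> by (simp add: p_def)
  obtain w1' where w1': "\<And>l x. 0 < l \<Longrightarrow> ereal l \<le> \<eta> \<Longrightarrow> 0 < x \<Longrightarrow> ereal x \<le> \<eta> \<Longrightarrow>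
      \<bar>1 - x * g l x\<bar> * x powr (1/2) \<le> w1' * l powr (1/2)" using q1 unfolding qualifies_def by blast
  obtain wr' where wr': "\<And>l x. 0 < l \<Longrightarrow> ereal l \<le> \<eta> \<Longrightarrow> 0 < x \<Longrightarrow> ereal x \<le> \<eta> \<Longrightarrow>
      \<bar>1 - x * g l x\<bar> * x powr r \<le> wr' * l powr r" using qr unfolding qualifies_def by blast
  \<comment> \<open>\<open>qualifies\<close> does not fix the sign of its constant.\<close>
  define w1 wr where "w1 = \<bar>w1'\<bar>" and "wr = \<bar>wr'\<bar>"
  have w1: "\<bar>1 - x * g l x\<bar> * x powr (1/2) \<le> w1 * l powr (1/2)"
    if "0 < l" "ereal l \<le> \<eta>" "0 < x" "ereal x \<le> \<eta>" for l x
    unfolding w1_def by (rule order_trans[OF w1'[OF that] mult_right_mono[OF abs_ge_self]]) simp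
  have wr: "\<bar>1 - x * g l x\<bar> * x powr r \<le> wr * l powr r"
    if "0 < l" "ereal l \<le> \<eta>" "0 < x" "ereal x \<le> \<eta>" for l x
    unfolding wr_def by (rule order_trans[OF wr'[OF that] mult_right_mono[OF abs_ge_self]]) simp
  define \<theta> where "\<theta> = (1 + 1 / b) / 2"
  define S1 S2 S3 where "S1 = c powr \<theta> * (1 + 2 / (b - 1))" and "S2 = c * (1 + 1 / (b - 1))"
    and "S3 = 2 + c / (b - 1)"
  have S: "S1 > 0" "S2 > 0" "S3 > 0" unfolding S1_def S2_def S3_def using b c by (auto intro!: mult_pos_pos add_pos_pos)
  \<comment> \<open>The expected squared relative deviation turns out to be at most
    \<open>d1 * S1\<^sup>2 / K\<close>; this \<open>K\<close> makes it at most p/4, for every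
    \<open>n\<close>.\<close>
  define K where "K = 1 + 4 * d1 * S1\<^sup>2 / p"
  \<comment> \<open>Thresholds dictated by Markov's inequality at level \<open>p\<close>; the added
    1 keeps \<open>Cq\<close> positive when \<open>\<sigma> = 0\<close>.\<close>
  define CH Cq where "CH = sqrt (d1 * S2\<^sup>2 / p)" and "Cq = sqrt ((\<sigma>\<^sup>2 * S3 + 1) / p)"
  have K1: "K \<ge> 1" and CH: "CH > 0" and Cq: "Cq > 0"
    unfolding K_def CH_def Cq_def using d1 p S by (auto intro!: divide_pos_pos add_nonneg_pos)
  have CH2: "CH\<^sup>2 = d1 * S2\<^sup>2 / p" and Cq2: "Cq\<^sup>2 = (\<sigma>\<^sup>2 * S3 + 1) / p"
    unfolding CH_def Cq_def using d1 p S by (auto intro!: divide_nonneg_pos add_nonneg_nonneg)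
  have nn: "Ac \<ge> 0" "Bc \<ge> 0" "D \<ge> 0" "w1 \<ge> 0" "wr \<ge> 0"
    using reg by (auto simp: reg_family_def w1_def wr_def less_imp_le)
  have regD: "\<bar>x * g l x\<bar> \<le> Ac \<and> \<bar>g l x\<bar> \<le> Bc / l \<and> \<bar>1 - x * g l x\<bar> \<le> D"
    if "0 < l" "ereal l \<le> \<eta>" "0 < x" "ereal x \<le> \<eta>" for l x
    using reg that unfolding reg_family_def by blast
  have \<tau>c: "\<tau> i \<le> c" if "i \<ge> 1" for i
  proof -
    have "real i powr (- b) \<le> real i powr 0" using that b by (intro powr_mono) auto
    then have "c * real i powr (- b) \<le> c * 1" using c that by (intro mult_left_mono) auto
    then show ?thesis using \<tau>_le[OF that] by simp
  qed
  define c0 where "c0 = sqrt 2 * norm h * c powr (s - r) * sqrt (w1\<^sup>2 + K * (D + 1)\<^sup>2)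
      + ((D + 1) * (r * (1 + (3/2 * c + K / 2 + 1) powr (r - 1))) * CH + 2 powr r * (wr + (D + 1))) * (c powr (s - r) * norm h)
      + sqrt 2 * Cq * sqrt (Ac * Bc + K * Bc\<^sup>2)"
  show "\<exists>c>0. \<forall>n\<in>{n. n \<ge> 1 \<and> ereal (l n) \<le> \<eta>}. \<exists>E\<in>sets M.
      E \<subseteq> {\<omega>\<in>space M. norm (f - beta_hat g (l n) J Xs Ys n \<omega>) \<le> c * real n powr (- (b * r / (1 + b + 2 * r * b)))}
      \<and> \<delta> \<le> prob E"
  proof (intro exI[of _ "\<bar>c0\<bar> + 1"] conjI ballI)
    fix n assume "n \<in> {n. n \<ge> 1 \<and> ereal (l n) \<le> \<eta>}"
    then have n: "n \<ge> 1" and l\<eta>: "ereal (l n) \<le> \<eta>" by auto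
    define L where "L = l n"
    have L0: "L > 0" using n by (simp add: L_def l_def)
    have den: "1 + b + 2 * r * b > 0" using b r by (simp add: add_pos_pos)
    have "real n powr (- (b / (1 + b + 2 * r * b))) \<le> real n powr 0"
      using n b den by (intro powr_mono) auto
    then have L1: "L \<le> 1" using n by (simp add: L_def l_def)
    \<comment> \<open>The choice of \<lambda> in the form in which it is used: every power of
      \<open>n\<close> becomes a power of \<open>L\<close>.\<close>
    have inv_n: "1 / real n = L powr (2 * r + 1 + 1 / b)"
    proof -
      have eq: "b * (2 * r + 1 + 1 / b) = 1 + b + 2 * r * b" using b by (simp add: algebra_simps)
      have "- (b / (1 + b + 2 * r * b)) * (2 * r + 1 + 1 / b)
          = - ((b * (2 * r + 1 + 1 / b)) / (1 + b + 2 * r * b))" by simp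
      also have "\<dots> = - 1" unfolding eq using den by simp
      finally have ex: "- (b / (1 + b + 2 * r * b)) * (2 * r + 1 + 1 / b) = - 1" .
      show ?thesis unfolding L_def l_def powr_powr ex using n by (simp add: powr_minus_divide)
    qed
    have rate: "real n powr (- (b * r / (1 + b + 2 * r * b))) = L powr r"
      unfolding L_def l_def powr_powr by simp
    have L_sq: "(L powr (r + 1/2))\<^sup>2 = L powr (2 * r + 1)"
      unfolding power2_eq_square powr_add[symmetric] by (simp add: algebra_simps)
    let ?q1 = "\<lambda>i. if i = 0 then 0 else 1 / (\<tau> i + K * L)" and ?q2 = "\<lambda>i::nat. if i = 0 then 0 else 1::real"
      and ?q3 = "\<lambda>i. if i = 0 then 0 else 1 / (\<tau> i + L)"
    have KL: "K * L > 0" using K1 L0 by simp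
    have q0: "?q1 i \<ge> 0" "?q2 i \<ge> 0" "?q3 i \<ge> 0" for i
      using \<tau>_pos[of i] KL L0 by auto
    have sums: "(\<Sum>i=1..N. ?q1 i * \<tau> i) \<le> S1 * (K * L) powr (- \<theta>)"
      "(\<Sum>i=1..N. ?q2 i * \<tau> i) \<le> S2" "(\<Sum>i=1..N. ?q3 i * \<tau> i) \<le> S3 * L powr (- (1 / b))" for N
    proof -
      have "(\<Sum>i=1..N. ?q1 i * \<tau> i) = (\<Sum>i=1..N. \<tau> i / (\<tau> i + K * L))" by (intro sum.cong) auto
      also have "\<dots> \<le> S1 * (K * L) powr (- \<theta>)"
        unfolding S1_def \<theta>_def by (rule effective_dimension_le'[OF \<tau>_pos \<tau>_le b c KL])
      finally show "(\<Sum>i=1..N. ?q1 i * \<tau> i) \<le> S1 * (K * L) powr (- \<theta>)" .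
      have "(\<Sum>i=1..N. ?q2 i * \<tau> i) = (\<Sum>i=1..N. \<tau> i)" by (intro sum.cong) auto
      also have "\<dots> \<le> S2" unfolding S2_def by (rule trace_le[OF \<tau>_pos \<tau>_le b c])
      finally show "(\<Sum>i=1..N. ?q2 i * \<tau> i) \<le> S2" .
      have "(\<Sum>i=1..N. ?q3 i * \<tau> i) = (\<Sum>i=1..N. \<tau> i / (\<tau> i + L))" by (intro sum.cong) auto
      also have "\<dots> \<le> S3 * L powr (- (1 / b))"
        unfolding S3_def by (rule effective_dimension_le[OF \<tau>_pos \<tau>_le b c L0 L1])
      finally show "(\<Sum>i=1..N. ?q3 i * \<tau> i) \<le> S3 * L powr (- (1 / b))" .
    qed
    define u1 u2 u3 where
      "u1 \<omega> = (\<Sum>i. \<Sum>j. ennreal (?q1 i * ?q1 j * (sample_mean (cov_fun i j) n \<omega>)\<^sup>2))" and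
      "u2 \<omega> = (\<Sum>i. \<Sum>j. ennreal (?q2 i * ?q2 j * (sample_mean (cov_fun i j) n \<omega>)\<^sup>2))" and
      "u3 \<omega> = (\<Sum>i. ennreal (?q3 i * (sample_mean (noise_fun i) n \<omega>)\<^sup>2))" for \<omega>
    note [measurable] = sample_mean_measurable[OF cov_fun_measurable] sample_mean_measurable[OF noise_fun_measurable]
    have um: "u1 \<in> borel_measurable M" "u2 \<in> borel_measurable M" "u3 \<in> borel_measurable M"
      unfolding u1_def[abs_def] u2_def[abs_def] u3_def[abs_def] by measurable
    define E1 E2 E3 where "E1 = {\<omega>\<in>space M. u1 \<omega> \<le> ennreal (1/4)}"
      and "E2 = {\<omega>\<in>space M. u2 \<omega> \<le> ennreal ((CH * L powr (r + 1/2))\<^sup>2)}"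
      and "E3 = {\<omega>\<in>space M. u3 \<omega> \<le> ennreal ((Cq * L powr (r + 1/2))\<^sup>2)}"
    have ev: "E1 \<in> sets M" "E2 \<in> sets M" "E3 \<in> sets M"
      unfolding E1_def E2_def E3_def using um by measurable
    have P1: "prob E1 \<ge> 1 - p"
      unfolding E1_def
    proof (rule prob_le_ge_of_nn_integral[OF um(1)])
      show "(\<integral>\<^sup>+\<omega>. u1 \<omega> \<partial>M) \<le> ennreal (d1 * (S1 * (K * L) powr (- \<theta>))\<^sup>2 / real n)"
        unfolding u1_def by (rule weighted_cov_deviation[OF _ q0(1) sums(1) n]) simp
      have "((K * L) powr (- \<theta>))\<^sup>2 = K powr (- (2 * \<theta>)) * L powr (- (2 * \<theta>))"
        using K1 L0 unfolding power2_eq_square powr_add[symmetric] by (simp add: powr_mult)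
      \<comment> \<open>Since 2\<theta> \<ge> 1 and \<open>K \<ge> 1\<close>, a full factor 1/K is
        gained, which is what the definition of \<open>K\<close> relies on.\<close>
      also have "\<dots> \<le> K powr (- 1) * L powr (- (2 * \<theta>))"
        using K1 b by (intro mult_right_mono powr_mono) (auto simp: \<theta>_def)
      finally have sqb: "((K * L) powr (- \<theta>))\<^sup>2 \<le> K powr (- 1) * L powr (- (2 * \<theta>))" .
      have "d1 * (S1 * (K * L) powr (- \<theta>))\<^sup>2 / real n = d1 * S1\<^sup>2 * ((K * L) powr (- \<theta>))\<^sup>2 * (1 / real n)"
        by (simp add: power_mult_distrib)
      also have "\<dots> \<le> d1 * S1\<^sup>2 * (K powr (- 1) * L powr (- (2 * \<theta>))) * (1 / real n)"
        using d1 by (intro mult_right_mono mult_left_mono sqb) auto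
      also have "\<dots> = d1 * S1\<^sup>2 / K * (L powr (- (2 * \<theta>)) * L powr (2 * r + 1 + 1 / b))"
        unfolding inv_n using K1 by (simp add: powr_minus_divide)
      also have "L powr (- (2 * \<theta>)) * L powr (2 * r + 1 + 1 / b) = L powr (2 * r)"
      proof -
        have "- (2 * \<theta>) + (2 * r + 1 + 1 / b) = 2 * r" unfolding \<theta>_def by (simp add: field_simps)
        then show ?thesis unfolding powr_add[symmetric] by (simp only:)
      qed
      also have "d1 * S1\<^sup>2 / K * L powr (2 * r) \<le> d1 * S1\<^sup>2 / K * 1"
        using d1 K1 L0 L1 r by (intro mult_left_mono powr_le1) auto
      also have "\<dots> \<le> 1/4 * p"
      proof -
        have "4 * d1 * S1\<^sup>2 \<le> p * K" unfolding K_def using p by (simp add: distrib_left)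
        then show ?thesis using K1 by (simp add: field_simps)
      qed
      finally show "d1 * (S1 * (K * L) powr (- \<theta>))\<^sup>2 / real n \<le> 1/4 * p" .
    qed (use p in auto)
    have P2: "prob E2 \<ge> 1 - p"
      unfolding E2_def
    proof (rule prob_le_ge_of_nn_integral[OF um(2)])
      show "(\<integral>\<^sup>+\<omega>. u2 \<omega> \<partial>M) \<le> ennreal (d1 * S2\<^sup>2 / real n)"
        unfolding u2_def by (rule weighted_cov_deviation[OF _ q0(2) sums(2) n]) simp
      have "d1 * S2\<^sup>2 / real n = d1 * S2\<^sup>2 * L powr (2 * r + 1 + 1 / b)" unfolding inv_n[symmetric] by simp
      also have "\<dots> \<le> d1 * S2\<^sup>2 * L powr (2 * r + 1)"
        using d1 L0 L1 b by (intro mult_left_mono powr_mono') auto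
      also have "\<dots> = (CH * L powr (r + 1/2))\<^sup>2 * p"
        unfolding power_mult_distrib CH2 L_sq using p by simp
      finally show "d1 * S2\<^sup>2 / real n \<le> (CH * L powr (r + 1/2))\<^sup>2 * p" .
      show "0 < (CH * L powr (r + 1/2))\<^sup>2" using CH L0 by simp
    qed (use p in auto)
    have P3: "prob E3 \<ge> 1 - p"
      unfolding E3_def
    proof (rule prob_le_ge_of_nn_integral[OF um(3)])
      show "(\<integral>\<^sup>+\<omega>. u3 \<omega> \<partial>M) \<le> ennreal (\<sigma>\<^sup>2 * (S3 * L powr (- (1 / b))) / real n)"
        unfolding u3_def by (rule weighted_noise[OF _ q0(3) sums(3) n]) simp
      have "\<sigma>\<^sup>2 * (S3 * L powr (- (1 / b))) / real n = \<sigma>\<^sup>2 * S3 * (L powr (- (1 / b)) * L powr (2 * r + 1 + 1 / b))"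
        unfolding inv_n[symmetric] by simp
      also have "L powr (- (1 / b)) * L powr (2 * r + 1 + 1 / b) = L powr (2 * r + 1)"
        unfolding powr_add[symmetric] by simp
      also have "\<sigma>\<^sup>2 * S3 * L powr (2 * r + 1) \<le> (\<sigma>\<^sup>2 * S3 + 1) * L powr (2 * r + 1)"
        by (intro mult_right_mono) auto
      also have "\<dots> = (Cq * L powr (r + 1/2))\<^sup>2 * p"
        unfolding power_mult_distrib Cq2 L_sq using p by simp
      finally show "\<sigma>\<^sup>2 * (S3 * L powr (- (1 / b))) / real n \<le> (Cq * L powr (r + 1/2))\<^sup>2 * p" .
      show "0 < (Cq * L powr (r + 1/2))\<^sup>2" using Cq L0 by simp
    qed (use p in auto)
    \<comment> \<open>The two almost sure properties hold off one null set; removing it from the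
      measurable good event gives the event required by \<open>lesssim_p\<close>.\<close>
    obtain N where N: "\<And>\<omega>. \<omega> \<in> space M - N \<Longrightarrow>
        real_spectrum (JCJ_emp J Xs n \<omega>) \<subseteq> {x. 0 \<le> x \<and> ereal x \<le> \<eta>} \<and>
        (\<forall>k\<ge>1. \<forall>x. (\<forall>i\<in>{1..}. inner x (\<phi> i) = 0) \<longrightarrow> inner (Xs k \<omega>) (J x) = 0)"
      "N \<in> null_sets M"
      using AE_E3[OF AE_conjI[OF spec[OF n] sample_in_range_AE]] by blast
    define E where "E = (E1 \<inter> E2 \<inter> E3) - N"
    have "E \<in> sets M" unfolding E_def using ev N(2) by auto
    moreover have "E \<subseteq> {\<omega>\<in>space M. norm (f - beta_hat g (l n) J Xs Ys n \<omega>)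
        \<le> (\<bar>c0\<bar> + 1) * real n powr (- (b * r / (1 + b + 2 * r * b)))}"
    proof
      fix \<omega> assume \<omega>: "\<omega> \<in> E"
      then have sp: "\<omega> \<in> space M" "\<omega> \<in> space M - N" by (auto simp: E_def E1_def)
      have e: "u1 \<omega> \<le> ennreal (1/4)" "u2 \<omega> \<le> ennreal ((CH * L powr (r + 1/2))\<^sup>2)"
        "u3 \<omega> \<le> ennreal ((Cq * L powr (r + 1/2))\<^sup>2)"
        using \<omega> by (auto simp: E_def E1_def E2_def E3_def)
      have "norm (f - beta_hat g (l n) J Xs Ys n \<omega>) \<le> c0 * L powr r"
        unfolding beta_hat_def c0_def L_def[symmetric]
        by (rule error_on_event[OF n f src conjunct2[OF N(1)[OF sp(2)]] conjunct1[OF N(1)[OF sp(2)]] r L0 L1 K1 c \<tau>c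
              less_imp_le[OF CH] less_imp_le[OF Cq] nn regD w1 wr e[unfolded u1_def u2_def u3_def]])
           (use L0 l\<eta> in \<open>auto simp: L_def\<close>)
      also have "\<dots> \<le> (\<bar>c0\<bar> + 1) * L powr r" by (intro mult_right_mono) auto
      finally show "\<omega> \<in> {\<omega>\<in>space M. norm (f - beta_hat g (l n) J Xs Ys n \<omega>)
          \<le> (\<bar>c0\<bar> + 1) * real n powr (- (b * r / (1 + b + 2 * r * b)))}"
        using sp(1) by (simp add: rate)
    qed
    moreover have "\<delta> \<le> prob E"
    proof -
      have "prob E = prob (E1 \<inter> E2 \<inter> E3)"
        unfolding E_def measure_def using N(2) ev by (subst emeasure_Diff_null_set) auto
      moreover have "space M - (E1 \<inter> E2 \<inter> E3) = (space M - E1) \<union> (space M - E2) \<union> (space M - E3)" by blast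
      then have "1 - prob (E1 \<inter> E2 \<inter> E3) \<le> prob (space M - E1) + prob (space M - E2) + prob (space M - E3)"
        using prob_compl[of "E1 \<inter> E2 \<inter> E3"] ev
          measure_Un_le[of "(space M - E1) \<union> (space M - E2)" M "space M - E3"]
          measure_Un_le[of "space M - E1" M "space M - E2"] by auto
      moreover have "prob (space M - E1) + prob (space M - E2) + prob (space M - E3) \<le> 3 * p"
        using P1 P2 P3 prob_compl[OF ev(1)] prob_compl[OF ev(2)] prob_compl[OF ev(3)] by linarith
      ultimately show ?thesis by (simp add: p_def)
    qed
    ultimately show "\<exists>E\<in>sets M. E \<subseteq> {\<omega>\<in>space M. norm (f - beta_hat g (l n) J Xs Ys n \<omega>)
        \<le> (\<bar>c0\<bar> + 1) * real n powr (- (b * r / (1 + b + 2 * r * b)))} \<and> \<delta> \<le> prob E" by blast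
  qed simp
qed

end

theorem theorem3p3:
  fixes S :: "'a::euclidean_space set"
    and cls :: "('a \<Rightarrow> real) \<Rightarrow> 'h::{real_inner, banach, second_countable_topology}"
    and k :: "'a \<Rightarrow> 'a \<Rightarrow> real"
    and eval_at :: "'k::{real_inner, banach} \<Rightarrow> 'a \<Rightarrow> real"
    and J :: "'k \<Rightarrow> 'h"
    and M :: "'w measure"
    and X :: "'w \<Rightarrow> 'h" and \<epsilon> Y :: "'w \<Rightarrow> real"
    and Xs :: "nat \<Rightarrow> 'w \<Rightarrow> 'h" and Ys :: "nat \<Rightarrow> 'w \<Rightarrow> real"
    and \<beta> h :: 'h
    and g :: "real \<Rightarrow> real \<Rightarrow> real" and \<eta> \<nu> :: ereal
    and \<tau> :: "nat \<Rightarrow> real" and e :: "nat \<Rightarrow> 'h"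
    and \<kappa> \<sigma> A B D s b c1 c2 d1 r :: real
    and l :: "nat \<Rightarrow> real"
  assumes "compact S"
    and "is_L2 S cls"
    (* the RKHS and the inclusion operator *)
    and "bounded_pd_kernel S k \<kappa>"
    and "is_rkhs S k eval_at"
    and "J = incl cls eval_at" and "inj J"
    (* the model and the sample *)
    and "prob_space M"
    and "X \<in> borel_measurable M"
    and "integrable M (\<lambda>\<omega>. (norm (X \<omega>))\<^sup>2)"
    and "\<epsilon> \<in> borel_measurable M"
    and "integrable M (\<lambda>\<omega>. (\<epsilon> \<omega>)\<^sup>2)"
    and "prob_space.expectation M \<epsilon> = 0"
    and "prob_space.variance M \<epsilon> = \<sigma>\<^sup>2"
    and "indep_rv M X \<epsilon>"
    and "Y = (\<lambda>\<omega>. inner (X \<omega>) \<beta> + \<epsilon> \<omega>)"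
    and "prob_space.indep_vars M (\<lambda>_. borel) (\<lambda>i \<omega>. (Xs i \<omega>, Ys i \<omega>)) {1..}"
    and "\<forall>i\<ge>1. distr M borel (\<lambda>\<omega>. (Xs i \<omega>, Ys i \<omega>)) = distr M borel (\<lambda>\<omega>. (X \<omega>, Y \<omega>))"
    (* the regularization family *)
    and "\<eta> > 0"
    and "reg_family \<eta> g A B D"
    and "\<forall>n\<ge>1. AE \<omega> in M. real_spectrum (JCJ_emp J Xs n \<omega>) \<subseteq> {x. 0 \<le> x \<and> ereal x \<le> \<eta>}"
    and "is_qualification \<eta> g \<nu>" and "\<nu> \<ge> ereal (1/2)"
    (* (i) *)
    and "s > 0"
    and "\<beta> = T_half J (op_fun (\<lambda>t. t powr s) (TCT M X J) h)"
    (* (ii) *)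
    and "b > 1" and "c1 > 0" and "c2 > 0"
    and "eigenpairs (TCT M X J) \<tau> e"
    and "\<forall>i\<ge>1. c1 * real i powr (- b) \<le> \<tau> i \<and> \<tau> i \<le> c2 * real i powr (- b)"
    (* (iii) *)
    and "d1 > 0"
    and "\<forall>f. integrable M (\<lambda>\<omega>. (inner (X \<omega>) f) ^ 4) \<and>
             prob_space.expectation M (\<lambda>\<omega>. (inner (X \<omega>) f) ^ 4)
               \<le> d1 * (prob_space.expectation M (\<lambda>\<omega>. (inner (X \<omega>) f)\<^sup>2))\<^sup>2"
    and "r = real_of_ereal (min (ereal s) \<nu>)"
    and "l = (\<lambda>n. real n powr (- (b / (1 + b + 2 * r * b))))"
  shows "lesssim_p M {n. n \<ge> 1 \<and> ereal (l n) \<le> \<eta>}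
           (\<lambda>n \<omega>. norm (inv J \<beta> - beta_hat g (l n) J Xs Ys n \<omega>))
           (\<lambda>n. real n powr (- (b * r / (1 + b + 2 * r * b))))"
proof -
  interpret rs: regression_sample M X \<epsilon> Xs Ys \<beta> \<sigma> d1
    using assms by (intro regression_sample.intro regression_sample_axioms.intro) simp_all
  interpret R: rkhs_in_L2 S cls k \<kappa> eval_at
    using assms(1-4) by (rule rkhs_in_L2.intro)
  let ?Kc = "\<bar>\<kappa>\<bar> * measure (lebesgue_on S) S + 1"
  have TCT_eq: "TCT M X J = T_half J \<circ> cov_op M X \<circ> T_half J" by (simp add: TCT_def)
  have \<tau>: "\<tau> i > 0" if "i \<ge> 1" for i
  proof -
    have "0 < c1 * real i powr (- b)" using that assms(26) by simp
    also have "\<dots> \<le> \<tau> i" using assms(29) that by blast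
    finally show ?thesis .
  qed
  have "preconditioned_covariance J ?Kc (cov_op M X) \<tau> e"
  proof (intro preconditioned_covariance.intro compact_inclusion.intro preconditioned_covariance_axioms.intro)
    show "bounded_linear J" unfolding assms(5) by (rule R.bounded_linear_incl)
    show "positive_trace_class (\<lambda>x. adjoint J (J x)) ?Kc" unfolding assms(5) by (rule R.positive_trace_class_incl)
    show "bounded_linear (cov_op M X)" by (rule rs.bounded_linear_cov)
    show "inner (cov_op M X x) y = inner x (cov_op M X y)" for x y by (rule rs.cov_commute)
    show "0 \<le> inner (cov_op M X x) x" for x by (rule rs.cov_pos)
    show "cov_op M X x = 0" if "inner (cov_op M X x) x = 0" for x by (rule rs.cov_kernel[OF that])
    show "eigensystem (T_half J \<circ> cov_op M X \<circ> T_half J) {1..} e \<tau>"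
      using assms(28) unfolding TCT_eq eigenpairs_def eigensystem_def orthonormal_on_def by simp
  qed (rule \<tau>)
  then interpret regression_rkhs M X \<epsilon> Xs Ys \<beta> \<sigma> d1 J ?Kc \<tau> e
    by (intro regression_rkhs.intro rs.regression_sample_axioms)
  obtain f where f: "J f = T_half J (op_fun (\<lambda>t. t powr s) (T_half J \<circ> cov_op M X \<circ> T_half J) h)"
    and src: "((\<lambda>i. (\<tau> i powr s * inner h (e i)) *\<^sub>R \<phi> i) has_sum f) {1..}"
    using source_element[OF assms(23)] by blast
  have \<beta>: "\<beta> = J f" using assms(24) unfolding f TCT_eq .
  \<comment> \<open>Injectivity identifies the RKHS with a subset of the L2 space, so
    \<open>inv J \<beta>\<close> is \<beta> regarded as an element of the RKHS.\<close>
  have inv: "inv J \<beta> = f" unfolding \<beta> by (rule inv_f_f[OF assms(6)])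
  \<comment> \<open>The minimum is finite because \<open>s\<close> is, so
    \<open>real_of_ereal\<close> returns its true value even for infinite
    \<open>\<nu>\<close>.\<close>
  have r: "0 < r" "r \<le> s" "ereal r \<le> \<nu>"
    using assms(22,23) unfolding assms(32) by (cases \<nu>; auto simp: min_def split: if_splits)+
  have q: "qualifies \<eta> g r" "qualifies \<eta> g (1/2)"
    using is_qualification_qualifies[OF assms(19,21)] r assms(22) by simp_all
  show ?thesis
    unfolding inv assms(33)
  proof (rule convergence_rate[OF \<beta> src _ r(1,2) assms(25,27) _ assms(19) q])
    show "AE \<omega> in M. real_spectrum (JCJ_emp J Xs n \<omega>) \<subseteq> {x. 0 \<le> x \<and> ereal x \<le> \<eta>}" if "1 \<le> n" for n
      using assms(20) that by blast
    show "\<tau> i \<le> c2 * real i powr (- b)" if "1 \<le> i" for i using assms(29) that by blast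
  qed
qed

end
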